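(* Let $\ell>2$ be an odd prime, let $c\in\mathbb F_\ell^*$ be a quadratic nonresidue, and let $t_c$ be the Frobenius trace of the smooth projective model $\mathcal E_c$ over $\mathbb F_\ell$ of $Y^2=(X^2-1)(X^2-c)$. Then $$\frac{1}{\ell-1}\sum_{A\in\mathbb F_\ell^*}K(A,cA)^2=t_c^2+1.$$ Equivalently, for every fixed $k\in\mathbb F_\ell^*$, $$\frac{1}{\ell-1}\sum_{N\in\mathbb F_\ell^*}K(kN,ckN)^2=t_c^2+1.$$
   Context: $\chi$ denotes the Legendre symbol modulo $\ell$ on $\mathbb F_\ell$, with $\chi(0)=0$, and $K(A,B)=\sum_{z\in\mathbb F_\ell}\chi\bigl((z^2-A)(z^2-B)\bigr)$. The smooth projective model of an affine curve over $\mathbb F_\ell$ is the nonsingular projective curve over $\mathbb F_\ell$ birational to it. The Frobenius trace of a smooth projective genus-one curve $E/\mathbb F_\ell$ is $t_E=\ell+1-\#E(\mathbb F_\ell)$. *)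

theory Defs
  imports
    "HOL-Analysis.Analysis"
    "HOL-Library.Poly_Mapping"
    "HOL-Library.Extended_Nat"
    "HOL-Number_Theory.Number_Theory"
    "HOL-Algebra.Algebraic_Closure_Type"
    "Berlekamp_Zassenhaus.Finite_Field"
begin

unbundle no fps_syntax

section \<open>The character sum\<close>

definition chi :: "'p::prime_card mod_ring \<Rightarrow> int" where
  "chi x = Legendre (to_int_mod_ring x) (int CARD('p))"

definition K_sum :: "'p::prime_card mod_ring \<Rightarrow> 'p mod_ring \<Rightarrow> int" where
  "K_sum A B = (\<Sum>z\<in>UNIV. chi ((z^2 - A) * (z^2 - B)))"


section \<open>Multivariate polynomials\<close>

text \<open>Polynomials in variables indexed by a finite type \<open>'n\<close>: finitely supported
  functions from exponent vectors to coefficients, with the convolution product.\<close>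

type_synonym ('n, 'a) mpoly = "('n \<Rightarrow>\<^sub>0 nat) \<Rightarrow>\<^sub>0 'a"

definition eval_mpoly :: "('n::finite, 'a::comm_semiring_1) mpoly \<Rightarrow> 'a^'n \<Rightarrow> 'a" where
  "eval_mpoly p x =
     (\<Sum>m\<in>Poly_Mapping.keys p. Poly_Mapping.lookup p m * (\<Prod>i\<in>UNIV. x $ i ^ Poly_Mapping.lookup m i))"

definition partial_mpoly :: "'n \<Rightarrow> ('n::finite, 'a::comm_semiring_1) mpoly \<Rightarrow> ('n, 'a) mpoly" where
  "partial_mpoly i p =
     (\<Sum>m\<in>Poly_Mapping.keys p.
        Poly_Mapping.single (m - Poly_Mapping.single i 1) (of_nat (Poly_Mapping.lookup m i) * Poly_Mapping.lookup p m))"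

definition gradient :: "('n::finite, 'a::comm_semiring_1) mpoly \<Rightarrow> 'a^'n \<Rightarrow> 'a^'n" where
  "gradient p x = (\<chi> i. eval_mpoly (partial_mpoly i p) x)"

definition homogeneous_of_degree :: "nat \<Rightarrow> ('n::finite, 'a::zero) mpoly \<Rightarrow> bool" where
  "homogeneous_of_degree d p \<longleftrightarrow> (\<forall>m\<in>Poly_Mapping.keys p. (\<Sum>i\<in>UNIV. Poly_Mapping.lookup m i) = d)"

definition homogeneous :: "('n::finite, 'a::zero) mpoly \<Rightarrow> bool" where
  "homogeneous p \<longleftrightarrow> (\<exists>d. homogeneous_of_degree d p)"

definition over_base :: "('n, 'a::field alg_closure) mpoly \<Rightarrow> bool" where
  "over_base p \<longleftrightarrow> (\<forall>m. Poly_Mapping.lookup p m \<in> range to_ac)"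


section \<open>Projective varieties\<close>

text \<open>A point of projective space of dimension \<open>CARD('n) - 1\<close> is the set of all
  homogeneous coordinate vectors representing it.  Varieties are sets of points over an algebraic
  closure, as in Silverman, \<^emph>\<open>The Arithmetic of Elliptic Curves\<close>, Chapter I.\<close>

definition proj_point :: "'a::field^'n \<Rightarrow> ('a^'n) set" where
  "proj_point v = {a *s v | a. a \<noteq> 0}"

definition proj_zeros :: "('n::finite, 'a::field) mpoly set \<Rightarrow> ('a^'n) set set" where
  "proj_zeros S = {proj_point v | v. v \<noteq> 0 \<and> (\<forall>p\<in>S. eval_mpoly p v = 0)}"

definition proj_closed :: "('a::field^'n::finite) set set \<Rightarrow> bool" where
  "proj_closed V \<longleftrightarrow> (\<exists>S. (\<forall>p\<in>S. homogeneous p) \<and> V = proj_zeros S)"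

definition proj_irreducible :: "('a::field^'n::finite) set set \<Rightarrow> bool" where
  "proj_irreducible V \<longleftrightarrow> V \<noteq> {} \<and>
     (\<forall>A B. proj_closed A \<and> proj_closed B \<and> V \<subseteq> A \<union> B \<longrightarrow> V \<subseteq> A \<or> V \<subseteq> B)"

definition proj_variety :: "('a::field^'n::finite) set set \<Rightarrow> bool" where
  "proj_variety V \<longleftrightarrow> proj_closed V \<and> proj_irreducible V"

text \<open>The Krull dimension of the Zariski topology on \<open>V\<close>.\<close>

definition proj_dim :: "('a::field^'n::finite) set set \<Rightarrow> enat" where
  "proj_dim V = Sup {enat d | d. \<exists>Z :: nat \<Rightarrow> ('a^'n) set set.
     (\<forall>i\<le>d. proj_variety (Z i) \<and> Z i \<subseteq> V) \<and> (\<forall>i<d. Z i \<subset> Z (Suc i))}"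

text \<open>The span of a set in the polynomial ring, as a module over itself, is the ideal that the
  set generates.\<close>

definition homogeneous_ideal :: "('a::field^'n::finite) set set \<Rightarrow> ('n, 'a) mpoly set" where
  "homogeneous_ideal V =
     module.span times {p. homogeneous p \<and> (\<forall>v. proj_point v \<in> V \<longrightarrow> eval_mpoly p v = 0)}"

definition defined_over_base :: "('a::field alg_closure^'n::finite) set set \<Rightarrow> bool" where
  "defined_over_base V \<longleftrightarrow>
     (\<exists>S. (\<forall>p\<in>S. homogeneous p \<and> over_base p) \<and> homogeneous_ideal V = module.span times S)"

text \<open>The Jacobian criterion: at each point the Jacobian matrix of a generating set of
  \<open>homogeneous_ideal V\<close> has rank \<open>n - dim V\<close>, where \<open>n = CARD('n) - 1\<close>.  By the product
  rule, the row space of that matrix at a point of \<open>V\<close> is the set of gradients of all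
  elements of the ideal, so no generating set needs to be chosen.\<close>

definition nonsingular :: "('a::field^'n::finite) set set \<Rightarrow> bool" where
  "nonsingular V \<longleftrightarrow> (\<forall>v. proj_point v \<in> V \<longrightarrow>
     enat (vec.dim ((\<lambda>p. gradient p v) ` homogeneous_ideal V)) + proj_dim V + 1 = enat CARD('n))"


section \<open>Birational equivalence\<close>

text \<open>Below \<open>V\<close> and \<open>W\<close> are quasi-projective: open subsets of projective varieties.
  A rational map over the base field is given by a tuple of forms of the same degree with
  coefficients in that field.\<close>

definition forms_over_base :: "('n::finite, 'a::field alg_closure) mpoly^'m \<Rightarrow> bool" where
  "forms_over_base F \<longleftrightarrow> (\<exists>d. \<forall>j. homogeneous_of_degree d (F $ j) \<and> over_base (F $ j))"

definition eval_forms :: "('n::finite, 'a::field) mpoly^'m \<Rightarrow> 'a^'n \<Rightarrow> 'a^'m" where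
  "eval_forms F v = (\<chi> j. eval_mpoly (F $ j) v)"

definition generically_left_inverse ::
  "('m::finite, 'a::field) mpoly^'n::finite \<Rightarrow> ('n, 'a) mpoly^'m \<Rightarrow>
   ('a^'n) set set \<Rightarrow> ('a^'m) set set \<Rightarrow> bool" where
  "generically_left_inverse G F V W \<longleftrightarrow>
     (\<exists>Z. proj_closed Z \<and> V - Z \<noteq> {} \<and>
        (\<forall>v. proj_point v \<in> V - Z \<longrightarrow>
           eval_forms F v \<noteq> 0 \<and> proj_point (eval_forms F v) \<in> W \<and>
           eval_forms G (eval_forms F v) \<noteq> 0 \<and>
           proj_point (eval_forms G (eval_forms F v)) = proj_point v))"

definition birational_over_base ::
  "('a::field alg_closure^'n::finite) set set \<Rightarrow> ('a alg_closure^'m::finite) set set \<Rightarrow> bool" where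
  "birational_over_base V W \<longleftrightarrow>
     (\<exists>F G. forms_over_base F \<and> forms_over_base G \<and>
        generically_left_inverse G F V W \<and> generically_left_inverse F G W V)"


section \<open>Smooth projective models and Frobenius traces\<close>

text \<open>An affine plane curve is viewed as a quasi-projective curve in the chart of the
  projective plane where the last coordinate does not vanish.\<close>

definition plane_points :: "('a::field \<times> 'a) set \<Rightarrow> ('a^3) set set" where
  "plane_points C = {proj_point (vector [x, y, 1]) | x y. (x, y) \<in> C}"

definition smooth_projective_model ::
  "('a::field alg_closure \<times> 'a alg_closure) set \<Rightarrow> ('a alg_closure^'n::finite) set set \<Rightarrow> bool" where
  "smooth_projective_model C E \<longleftrightarrow>
     proj_variety E \<and> proj_dim E = 1 \<and> defined_over_base E \<and> nonsingular E \<and>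
     birational_over_base E (plane_points C)"

definition rational_points :: "('a::field alg_closure^'n::finite) set set \<Rightarrow> ('a alg_closure^'n) set set" where
  "rational_points V = {P \<in> V. \<exists>w :: 'a^'n. P = proj_point (\<chi> i. to_ac (w $ i))}"

definition frobenius_trace :: "('a::{field,finite} alg_closure^'n::finite) set set \<Rightarrow> int" where
  "frobenius_trace E = int CARD('a) + 1 - int (card (rational_points E))"

definition affine_quartic :: "'a::field \<Rightarrow> ('a alg_closure \<times> 'a alg_closure) set" where
  "affine_quartic c = {(x, y). y^2 = (x^2 - 1) * (x^2 - to_ac c)}"

end

theory Submission
  imports Defs
begin


text \<open>
  Let \<open>l\<close> be the characteristic and \<open>T\<close> the sum of \<open>\<chi> (u (u - 1) (u - c))\<close> over all \<open>u\<close>.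
  Collecting the \<open>z\<close> with the same square \<open>u\<close>, and then putting \<open>u = A w\<close>, turns \<open>K(A, c A)\<close> into
  \<open>- 1 + \<chi>(A) T\<close> (\<open>K_sum_twist\<close>).  The values \<open>\<chi>(A)\<close> are signs that cancel in the sum over
  \<open>A \<noteq> 0\<close>, so the mean of the squares is \<open>T\<^sup>2 + 1\<close>.  On the other hand, the affine quartic has
  \<open>l + K(1, c) = l - 1 + T\<close> rational points.  The theorem therefore says that a smooth projective
  model, which may lie in any projective space, has exactly two rational points more than the
  affine curve, namely those at infinity: then its trace is \<open>- T\<close>.

  This is shown by matching the points of the model and of the curve with the places of the common
  function field \<open>K\<close> over an algebraic closure \<open>k\<close> of the prime field.  A place is stored as the
  graph of the residue map of a valuation ring of \<open>K\<close> with residue field \<open>k\<close>; inclusion of such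
  graphs is domination of local rings, and valuation rings are maximal for it (\<open>place_maximal\<close>).

  The curve is represented by a generic point \<open>(x, y)\<close> in a larger field, and the model by the
  image of \<open>(x, y)\<close> under the birational map.  A form vanishes at that image if and only if it
  vanishes on the model (\<open>generic_vanishing_iff\<close>), so the local ring at a point of the model is a
  ring of quotients of forms evaluated there.  At a nonsingular point its maximal ideal is
  principal: the Jacobian criterion gives linear relations modulo the square of the maximal ideal,
  and Nakayama's lemma lifts them.  A local ring of \<open>K\<close> with a principal maximal ideal is a valuation ring,
  because \<open>K\<close> has transcendence degree one (\<open>place_of_uniformizer\<close>).  So every point of the model
  gives a place (\<open>place_E\<close>), and every place arises from one point, its centre (\<open>exists_centre\<close>,
  \<open>place_E_inject\<close>).  For the quartic the same is done by hand: its places are those at the points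
  of the affine curve and two more at infinity (\<open>place_cases\<close>).

  Rationality is read off from the \<open>k\<close>-linear endomorphism \<open>\<psi>\<close> of \<open>K\<close> with \<open>\<psi> x = x^l\<close> and
  \<open>\<psi> y = y^l\<close>.  Pulling back places along \<open>\<psi>\<close> raises the coordinates of a point to the \<open>l\<close>-th power,
  on the curve and also on the model, since the forms of the birational map have coefficients in
  the prime field (\<open>\<psi>_generic_E\<close>).  So the rational points on either side are the places fixed by
  the pull-back.
\<close>

section \<open>Places of a field over a base field\<close>

text \<open>The family may have repetitions; a repetition is itself a relation.\<close>

lemma (in vector_space) exists_nontrivial_relation:
  fixes w :: "'i \<Rightarrow> 'b"
  assumes "finite I" "finite B" "card B < card I" "\<And>i. i \<in> I \<Longrightarrow> w i \<in> span B"
  shows "\<exists>c. (\<exists>i\<in>I. c i \<noteq> 0) \<and> (\<Sum>i\<in>I. scale (c i) (w i)) = 0"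
proof (cases "inj_on w I")
  case True
  have "dependent (w ` I)"
  proof (rule ccontr)
    assume "independent (w ` I)"
    then have "card (w ` I) \<le> card B"
      using independent_span_bound[of B "w ` I"] assms by blast
    with True assms(3) show False by (simp add: card_image)
  qed
  then obtain u where u: "\<exists>v\<in>w ` I. u v \<noteq> 0" "(\<Sum>v\<in>w ` I. scale (u v) v) = 0"
    using dependent_finite[of "w ` I"] assms(1) by blast
  then have "(\<Sum>i\<in>I. scale (u (w i)) (w i)) = 0"
    using True by (simp add: sum.reindex)
  with u(1) show ?thesis by (intro exI[of _ "u \<circ> w"]) auto
next
  case False
  then obtain i j where ij: "i \<in> I" "j \<in> I" "w i = w j" "i \<noteq> j"
    by (auto simp: inj_on_def)
  define c where "c = (\<lambda>k. if k = i then 1 else if k = j then - 1 else 0 :: 'a)"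
  have "(\<Sum>k\<in>I. scale (c k) (w k)) = (\<Sum>k\<in>{i,j}. scale (c k) (w k))"
    using ij assms(1) by (intro sum.mono_neutral_right) (auto simp: c_def)
  also have "\<dots> = 0" using ij by (simp add: c_def)
  finally show ?thesis using ij by (intro exI[of _ c]) (auto simp: c_def)
qed

context field_hom
begin

text \<open>A homomorphism from a subring to the field of constants is represented by its graph, so that
  domain and values are carried by a single set.\<close>

definition specialization :: "('b \<times> 'a) set \<Rightarrow> bool" where
  "specialization H \<longleftrightarrow> (\<forall>a. (hom a, a) \<in> H) \<and>
     (\<forall>w a w' a'. (w, a) \<in> H \<longrightarrow> (w', a') \<in> H \<longrightarrow> (w + w', a + a') \<in> H \<and> (w * w', a * a') \<in> H) \<and>
     (\<forall>a. (0, a) \<in> H \<longrightarrow> a = 0)"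

definition local_specialization :: "('b \<times> 'a) set \<Rightarrow> bool" where
  "local_specialization H \<longleftrightarrow> specialization H \<and>
     (\<forall>w a. (w, a) \<in> H \<longrightarrow> a \<noteq> 0 \<longrightarrow> (1 / w, 1 / a) \<in> H)"

definition localization :: "('b \<times> 'a) set \<Rightarrow> ('b \<times> 'a) set" where
  "localization H = {(w / w', a / a') | w a w' a'. (w, a) \<in> H \<and> (w', a') \<in> H \<and> a' \<noteq> 0}"

text \<open>Of \<open>w\<close> and \<open>1 / w\<close> at least one has a value, and \<open>1 / w\<close> has the value 0 when \<open>w\<close> has none:
  the domain is a valuation ring of \<open>K\<close>, and the graph is that of its residue map.\<close>

definition place :: "'b set \<Rightarrow> ('b \<times> 'a) set \<Rightarrow> bool" where
  "place K H \<longleftrightarrow> local_specialization H \<and> Domain H \<subseteq> K \<and> (\<forall>w\<in>K. w \<in> Domain H \<or> (1 / w, 0) \<in> H)"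

definition algebraically_dependent :: "'b \<Rightarrow> 'b \<Rightarrow> bool" where
  "algebraically_dependent t p \<longleftrightarrow>
     (\<exists>c M. (\<exists>i\<le>M. \<exists>j\<le>M. c i j \<noteq> 0) \<and> (\<Sum>(i, j)\<in>{..M::nat} \<times> {..M::nat}. hom (c i j) * t ^ i * p ^ j) = 0)"

context
  fixes H
  assumes H: "specialization H"
begin

lemma specialization_const: "(hom a, a) \<in> H"
  and specialization_add: "(w, a) \<in> H \<Longrightarrow> (w', a') \<in> H \<Longrightarrow> (w + w', a + a') \<in> H"
  and specialization_mult: "(w, a) \<in> H \<Longrightarrow> (w', a') \<in> H \<Longrightarrow> (w * w', a * a') \<in> H"
  and specialization_zero: "(0, a) \<in> H \<Longrightarrow> a = 0"
  using H by (auto simp: specialization_def)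

lemma specialization_0: "(0, 0) \<in> H" and specialization_1: "(1, 1) \<in> H"
  using specialization_const[of 0] specialization_const[of 1] by auto

lemma specialization_minus: "(w, a) \<in> H \<Longrightarrow> (- w, - a) \<in> H"
  using specialization_mult[OF specialization_const[of "- 1"], of w a] by (simp add: hom_uminus)

lemma specialization_diff: "(w, a) \<in> H \<Longrightarrow> (w', a') \<in> H \<Longrightarrow> (w - w', a - a') \<in> H"
  using specialization_add[OF _ specialization_minus, of w a w' a'] by simp

lemma specialization_power: "(w, a) \<in> H \<Longrightarrow> (w ^ n, a ^ n) \<in> H"
  by (induction n) (auto intro: specialization_1 specialization_mult)

lemma specialization_sum:
  "(\<And>i. i \<in> I \<Longrightarrow> (w i, a i) \<in> H) \<Longrightarrow> (sum w I, sum a I) \<in> H"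
  by (induction I rule: infinite_finite_induct) (auto intro: specialization_0 specialization_add)

lemma specialization_unique: "(w, a) \<in> H \<Longrightarrow> (w, a') \<in> H \<Longrightarrow> a = a'"
  using specialization_diff[of w a w a'] specialization_zero[of "a - a'"] by simp

lemma specialization_nonzero: "(w, a) \<in> H \<Longrightarrow> a \<noteq> 0 \<Longrightarrow> w \<noteq> 0"
  using specialization_zero by auto

lemma specialization_poly: "(w, a) \<in> H \<Longrightarrow> (poly (map_poly hom p) w, poly p a) \<in> H"
  by (induction p)
     (auto intro: specialization_0 specialization_add specialization_mult specialization_const
           simp: map_poly_pCons)

lemma localization_extends: "H \<subseteq> localization H"
proof
  fix z assume "z \<in> H"
  then show "z \<in> localization H"
    unfolding localization_def using specialization_1
    by (cases z) (force intro: exI[of _ 1])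
qed

lemma local_specialization_localization: "local_specialization (localization H)"
  unfolding local_specialization_def specialization_def
proof (intro conjI allI impI)
  show "(hom a, a) \<in> localization H" for a
    using localization_extends specialization_const by blast
next
  fix w a w' a' assume "(w, a) \<in> localization H" "(w', a') \<in> localization H"
  then obtain r s r' s' \<alpha> \<beta> \<alpha>' \<beta>' where *: "w = r / s" "a = \<alpha> / \<beta>" "(r, \<alpha>) \<in> H" "(s, \<beta>) \<in> H" "\<beta> \<noteq> 0"
    "w' = r' / s'" "a' = \<alpha>' / \<beta>'" "(r', \<alpha>') \<in> H" "(s', \<beta>') \<in> H" "\<beta>' \<noteq> 0"
    unfolding localization_def by blast
  then have nz: "s \<noteq> 0" "s' \<noteq> 0" using specialization_nonzero by auto
  have "(r * s' + r' * s, \<alpha> * \<beta>' + \<alpha>' * \<beta>) \<in> H" "(s * s', \<beta> * \<beta>') \<in> H" "(r * r', \<alpha> * \<alpha>') \<in> H"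
    using * by (auto intro: specialization_add specialization_mult)
  moreover have "w + w' = (r * s' + r' * s) / (s * s')" "a + a' = (\<alpha> * \<beta>' + \<alpha>' * \<beta>) / (\<beta> * \<beta>')"
    "w * w' = (r * r') / (s * s')" "a * a' = (\<alpha> * \<alpha>') / (\<beta> * \<beta>')" "\<beta> * \<beta>' \<noteq> 0"
    using * nz by (auto simp: field_simps)
  ultimately show "(w + w', a + a') \<in> localization H" "(w * w', a * a') \<in> localization H"
    unfolding localization_def by blast+
next
  fix a assume "(0, a) \<in> localization H"
  then obtain r s \<alpha> \<beta> where *: "0 = r / s" "a = \<alpha> / \<beta>" "(r, \<alpha>) \<in> H" "(s, \<beta>) \<in> H" "\<beta> \<noteq> 0"
    unfolding localization_def by blast
  then have "s \<noteq> 0" using specialization_nonzero by auto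
  with * have "(0, \<alpha>) \<in> H" by auto
  then show "a = 0" using * specialization_zero by auto
next
  fix w a assume "(w, a) \<in> localization H" "a \<noteq> 0"
  then obtain r s \<alpha> \<beta> where *: "w = r / s" "a = \<alpha> / \<beta>" "(r, \<alpha>) \<in> H" "(s, \<beta>) \<in> H" "\<beta> \<noteq> 0"
    unfolding localization_def by blast
  moreover have "1 / w = s / r" "1 / a = \<beta> / \<alpha>" "\<alpha> \<noteq> 0" using * \<open>a \<noteq> 0\<close> by auto
  ultimately show "(1 / w, 1 / a) \<in> localization H"
    unfolding localization_def by blast
qed

end

lemma local_specialization_imp: "local_specialization H \<Longrightarrow> specialization H"
  by (simp add: local_specialization_def)

lemma local_specialization_divide:
  assumes "local_specialization H" "(w, a) \<in> H" "(w', a') \<in> H" "a' \<noteq> 0"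
  shows "(w / w', a / a') \<in> H"
  using specialization_mult[OF local_specialization_imp[OF assms(1)] assms(2), of "1 / w'" "1 / a'"]
    assms by (auto simp: local_specialization_def)

lemma localization_least:
  "local_specialization H' \<Longrightarrow> H \<subseteq> H' \<Longrightarrow> localization H \<subseteq> H'"
  unfolding localization_def by (auto intro: local_specialization_divide)

text \<open>An element that only the larger ring contains would have an inverse of value 0, and then 1
  would have the value 0 as well.\<close>

lemma place_maximal:
  assumes "place K H" "local_specialization H'" "H \<subseteq> H'" "Domain H' \<subseteq> K"
  shows "H = H'"
proof (intro equalityI assms(3) subrelI)
  note spec = local_specialization_imp[OF assms(2)]
  fix w a assume wa: "(w, a) \<in> H'"
  then have "w \<in> K" using assms(4) by blast
  then consider b where "(w, b) \<in> H" | "(1 / w, 0) \<in> H" "w \<noteq> 0" "w \<notin> Domain H"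
    using assms(1) unfolding place_def
    by (metis DomainE specialization_0 local_specialization_imp DomainI)
  then show "(w, a) \<in> H"
  proof cases
    case 1
    then show ?thesis using specialization_unique[OF spec wa] assms(3) by blast
  next
    case 2
    then have "(w * (1 / w), a * 0) \<in> H'"
      using specialization_mult[OF spec wa] assms(3) by blast
    then show ?thesis using specialization_unique[OF spec _ specialization_1[OF spec]] 2 by fastforce
  qed
qed

text \<open>The point is that no \<open>p \<noteq> 0\<close> is divisible by all powers of \<open>t\<close>. Otherwise, divide an
  algebraic relation between \<open>t\<close> and \<open>p\<close> by its lowest term, first in \<open>p\<close> and then in \<open>t\<close>: every
  other term then has the value 0, so the nonzero coefficient of that term would be 0. Hence each
  element of \<open>K\<close> is a power of \<open>t\<close> times a unit.\<close>

lemma place_of_uniformizer: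
  assumes H: "local_specialization H" and K: "Domain H \<subseteq> K"
    and t: "(t, 0) \<in> H" "t \<noteq> 0"
    and gen: "\<And>w. (w, 0) \<in> H \<Longrightarrow> w / t \<in> Domain H"
    and dep: "\<And>p. p \<in> K \<Longrightarrow> algebraically_dependent t p"
    and frac: "\<And>w. w \<in> K \<Longrightarrow> \<exists>r s. r \<in> Domain H \<and> s \<in> Domain H \<and> s \<noteq> 0 \<and> w = r / s"
  shows "place K H"
proof -
  note spec = local_specialization_imp[OF H]
  have order: "\<exists>n b. b \<noteq> 0 \<and> (p / t ^ n, b) \<in> H" if p: "p \<in> Domain H" "p \<noteq> 0" for p
  proof (rule ccontr)
    assume neg: "\<not> ?thesis"
    have inf: "(p / t ^ n, 0) \<in> H" for n
    proof (induction n)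
      case 0
      then show ?case using p neg by (metis DomainE div_by_1 power_0)
    next
      case (Suc n)
      from gen[OF this] have "p / t ^ Suc n \<in> Domain H" by (simp add: mult.commute)
      then show ?case using neg by (metis DomainE)
    qed
    from dep p K obtain c M where c: "\<exists>i\<le>M. \<exists>j\<le>M. c i j \<noteq> 0"
      and rel: "(\<Sum>(i, j)\<in>{..M} \<times> {..M}. hom (c i j) * t ^ i * p ^ j) = 0"
      unfolding algebraically_dependent_def by blast
    \<comment> \<open>The lowest term of the relation, first in \<open>p\<close> and then in \<open>t\<close>, has the exponents \<open>j0\<close> and
      \<open>i0\<close>.\<close>
    define j0 where "j0 = (LEAST j. j \<le> M \<and> (\<exists>i\<le>M. c i j \<noteq> 0))"
    have j0: "j0 \<le> M" "\<exists>i\<le>M. c i j0 \<noteq> 0"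
      using LeastI_ex[of "\<lambda>j. j \<le> M \<and> (\<exists>i\<le>M. c i j \<noteq> 0)"] c unfolding j0_def by blast+
    define i0 where "i0 = (LEAST i. i \<le> M \<and> c i j0 \<noteq> 0)"
    have i0: "i0 \<le> M" "c i0 j0 \<noteq> 0"
      using LeastI_ex[of "\<lambda>i. i \<le> M \<and> c i j0 \<noteq> 0"] j0 unfolding i0_def by blast+
    have jmin: "j0 \<le> j" if "i \<le> M" "j \<le> M" "c i j \<noteq> 0" for i j
      unfolding j0_def by (rule Least_le) (use that in blast)
    have imin: "i0 \<le> i" if "i \<le> M" "c i j0 \<noteq> 0" for i
      unfolding i0_def by (rule Least_le) (use that in blast)
    have summand: "(hom (c i j) * t ^ i * p ^ j / (t ^ i0 * p ^ j0), if (i, j) = (i0, j0) then c i0 j0 else 0) \<in> H"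
      if ij: "i \<le> M" "j \<le> M" for i j
    proof -
      consider "(i, j) = (i0, j0)" | "c i j = 0" "(i, j) \<noteq> (i0, j0)"
        | "c i j \<noteq> 0" "j = j0" "i0 < i" | "c i j \<noteq> 0" "j0 < j"
        using jmin imin ij i0 by fastforce
      then show ?thesis
      proof cases
        case 1
        then show ?thesis using t p specialization_const[OF spec] by simp
      next
        case 2
        then show ?thesis using specialization_0[OF spec] by auto
      next
        case 3
        then have "hom (c i j) * t ^ i * p ^ j / (t ^ i0 * p ^ j0) = hom (c i j) * t ^ (i - i0)"
          using t p by (simp add: power_diff)
        moreover have "(hom (c i j) * t ^ (i - i0), c i j * 0 ^ (i - i0)) \<in> H"
          by (intro specialization_mult[OF spec] specialization_power[OF spec] specialization_const[OF spec] t)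
        ultimately show ?thesis using 3 by (simp add: power_0_left)
      next
        case 4
        then have "hom (c i j) * t ^ i * p ^ j / (t ^ i0 * p ^ j0)
            = hom (c i j) * t ^ i * ((p / t ^ i0) * p ^ (j - j0 - 1))"
        proof -
          from 4 have "p ^ j = p ^ j0 * (p * p ^ (j - j0 - 1))"
            by (simp flip: power_Suc power_add)
          then show ?thesis using t p by (simp add: field_simps)
        qed
        moreover have "(hom (c i j) * t ^ i * ((p / t ^ i0) * p ^ (j - j0 - 1)), c i j * 0 ^ i * (0 * 0 ^ (j - j0 - 1))) \<in> H"
          using inf[of 0] by (intro specialization_mult[OF spec] specialization_power[OF spec] specialization_const[OF spec] t inf) auto
        ultimately show ?thesis using 4 by auto
      qed
    qed
    have "((\<Sum>z\<in>{..M} \<times> {..M}. (\<lambda>(i, j). hom (c i j) * t ^ i * p ^ j) z / (t ^ i0 * p ^ j0)),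
           (\<Sum>z\<in>{..M} \<times> {..M}. if z = (i0, j0) then c i0 j0 else 0)) \<in> H"
    proof (rule specialization_sum[OF spec])
      fix z assume "z \<in> {..M} \<times> {..M}"
      then obtain i j where z: "z = (i, j)" "i \<le> M" "j \<le> M" by auto
      show "((\<lambda>(i, j). hom (c i j) * t ^ i * p ^ j) z / (t ^ i0 * p ^ j0), if z = (i0, j0) then c i0 j0 else 0) \<in> H"
        unfolding z(1) prod.case by (rule summand[OF z(2,3)])
    qed
    then have "(0, c i0 j0) \<in> H"
      using i0(1) j0(1) rel by (simp flip: sum_divide_distrib)
    then show False using specialization_zero[OF spec] i0 by blast
  qed
  have "w \<in> Domain H \<or> (1 / w, 0) \<in> H" if "w \<in> K" for w
  proof (cases "w = 0")
    case True
    then show ?thesis using specialization_0[OF spec] by auto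
  next
    case False
    obtain r s where rs: "r \<in> Domain H" "s \<in> Domain H" "s \<noteq> 0" "w = r / s" using frac \<open>w \<in> K\<close> by blast
    with False obtain n b m d where nb: "b \<noteq> 0" "(r / t ^ n, b) \<in> H" and md: "d \<noteq> 0" "(s / t ^ m, d) \<in> H"
      using order[of r] order[of s] by auto
    show ?thesis
    proof (cases "m \<le> n")
      case True
      then have "w = t ^ (n - m) * ((r / t ^ n) / (s / t ^ m))"
        using rs t by (simp add: power_diff field_simps)
      moreover have "(t ^ (n - m) * ((r / t ^ n) / (s / t ^ m)), 0 ^ (n - m) * (b / d)) \<in> H"
        using nb md t by (intro specialization_mult[OF spec] specialization_power[OF spec] local_specialization_divide[OF H])
      ultimately show ?thesis by auto
    next
      case False
      have "r \<noteq> 0" using rs \<open>w \<noteq> 0\<close> by auto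
      with False have "1 / w = t ^ (m - n) * ((s / t ^ m) / (r / t ^ n))"
        using rs t \<open>w \<noteq> 0\<close> by (simp add: power_diff field_simps)
      moreover have "(t ^ (m - n) * ((s / t ^ m) / (r / t ^ n)), 0 ^ (m - n) * (d / b)) \<in> H"
        using nb md t by (intro specialization_mult[OF spec] specialization_power[OF spec] local_specialization_divide[OF H])
      ultimately show ?thesis using False by (simp add: power_0_left)
    qed
  qed
  then show ?thesis using H K by (auto simp: place_def)
qed

end


section \<open>The function field of a double cover of the line\<close>

definition (in field_hom) intermediate_field :: "'b set \<Rightarrow> bool" where
  "intermediate_field L \<longleftrightarrow> range hom \<subseteq> L \<and>
     (\<forall>w\<in>L. \<forall>w'\<in>L. w + w' \<in> L \<and> w * w' \<in> L) \<and> (\<forall>w\<in>L. 1 / w \<in> L)"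

context field_hom
begin

context
  fixes L assumes L: "intermediate_field L"
begin

lemma intermediate_const: "hom a \<in> L"
  and intermediate_add: "w \<in> L \<Longrightarrow> w' \<in> L \<Longrightarrow> w + w' \<in> L"
  and intermediate_mult: "w \<in> L \<Longrightarrow> w' \<in> L \<Longrightarrow> w * w' \<in> L"
  using L by (auto simp: intermediate_field_def)

lemma intermediate_divide: "w \<in> L \<Longrightarrow> w' \<in> L \<Longrightarrow> w / w' \<in> L"
  using L intermediate_mult[of w "1 / w'"] by (auto simp: intermediate_field_def)

lemma intermediate_0: "0 \<in> L" and intermediate_1: "1 \<in> L"
  using intermediate_const[of 0] intermediate_const[of 1] by auto

lemma intermediate_power: "w \<in> L \<Longrightarrow> w ^ n \<in> L"
  by (induction n) (auto intro: intermediate_1 intermediate_mult)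

lemma intermediate_sum: "(\<And>i. i \<in> I \<Longrightarrow> w i \<in> L) \<Longrightarrow> sum w I \<in> L"
  by (induction I rule: infinite_finite_induct) (auto intro: intermediate_0 intermediate_add)

lemma intermediate_prod: "(\<And>i. i \<in> I \<Longrightarrow> w i \<in> L) \<Longrightarrow> prod w I \<in> L"
  by (induction I rule: infinite_finite_induct) (auto intro: intermediate_1 intermediate_mult)

lemma intermediate_poly: "w \<in> L \<Longrightarrow> poly (map_poly hom p) w \<in> L"
  by (induction p)
     (auto intro: intermediate_0 intermediate_add intermediate_mult intermediate_const simp: map_poly_pCons)

end
end

text \<open>The generic point \<open>(x, y)\<close> of the curve \<open>Y\<^sup>2 = f(X)\<close>. That the roots of \<open>f\<close> are simple makes
  the affine curve nonsingular; that there is one makes \<open>y\<close> quadratic over the rational functions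
  of \<open>x\<close>.\<close>

locale double_cover = field_hom \<iota> for \<iota> :: "'k::field \<Rightarrow> 'o::field" +
  fixes x y :: 'o and f :: "'k poly"
  assumes transcendental: "poly (map_poly \<iota> a) x = 0 \<Longrightarrow> a = 0"
    and y_square: "y ^ 2 = poly (map_poly \<iota> f) x"
    and simple_roots: "poly f \<alpha> = 0 \<Longrightarrow> poly (pderiv f) \<alpha> \<noteq> 0"
    and has_root: "\<exists>\<alpha>. poly f \<alpha> = 0"
    and two_nonzero: "(2 :: 'k) \<noteq> 0"
begin

interpretation map: map_poly_inj_idom_hom \<iota> ..

definition eval_x :: "'k poly \<Rightarrow> 'o" where "eval_x a = poly (map_poly \<iota> a) x"

lemma eval_x_simps:
  "eval_x (a + b) = eval_x a + eval_x b" "eval_x (a - b) = eval_x a - eval_x b"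
  "eval_x (a * b) = eval_x a * eval_x b" "eval_x (- a) = - eval_x a" "eval_x 0 = 0" "eval_x 1 = 1"
  "eval_x [:c:] = \<iota> c" "eval_x [:c, d:] = \<iota> c + \<iota> d * x" "eval_x (a ^ n) = eval_x a ^ n"
  by (simp_all add: eval_x_def map.hom_add map.hom_minus map.hom_mult map.hom_uminus map.hom_power map_poly_pCons_hom mult.commute)

lemma eval_x_eq_0_iff: "eval_x a = 0 \<longleftrightarrow> a = 0"
  using transcendental by (auto simp: eval_x_def)

definition regular :: "'k poly \<Rightarrow> 'k poly \<Rightarrow> 'o" where
  "regular a b = eval_x a + eval_x b * y"

lemma y_square': "y * y = eval_x f"
  using y_square by (simp add: eval_x_def power2_eq_square)

lemma regular_add: "regular a b + regular a' b' = regular (a + a') (b + b')"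
  by (simp add: regular_def eval_x_simps algebra_simps)

lemma regular_mult: "regular a b * regular a' b' = regular (a * a' + b * b' * f) (a * b' + a' * b)"
proof -
  have "regular a b * regular a' b' =
      eval_x a * eval_x a' + eval_x b * eval_x b' * (y * y) + (eval_x a * eval_x b' + eval_x a' * eval_x b) * y"
    by (simp add: regular_def algebra_simps)
  then show ?thesis unfolding y_square' by (simp add: regular_def eval_x_simps)
qed

text \<open>At a root of \<open>f\<close>, the two sides would have orders of different parity.\<close>

lemma norm_eq_0:
  assumes "a ^ 2 = b ^ 2 * f"
  shows "a = 0 \<and> b = 0"
proof (rule ccontr)
  \<comment> \<open>The order at \<open>\<alpha>\<close> is 1 for \<open>f\<close>, and even for the squares.\<close>
  obtain \<alpha> where \<alpha>: "poly f \<alpha> = 0" using has_root by blast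
  then obtain g where g: "f = [:- \<alpha>, 1:] * g" by (metis dvdE poly_eq_0_iff_dvd)
  have "poly (pderiv f) \<alpha> = poly g \<alpha>" unfolding g pderiv_mult by (simp add: pderiv_pCons)
  then have "poly g \<alpha> \<noteq> 0" using simple_roots[OF \<alpha>] by simp
  then have "g \<noteq> 0" "Polynomial.order \<alpha> g = 0" by (auto intro: order_0I)
  moreover from this have "f \<noteq> 0" unfolding g mult_eq_0_iff by simp
  ultimately have f: "f \<noteq> 0" "Polynomial.order \<alpha> f = 1"
    using order_mult[of "[:- \<alpha>, 1:]" g \<alpha>, folded g] order_power_n_n[of \<alpha> 1] by auto
  assume "\<not> (a = 0 \<and> b = 0)"
  then have nz: "a \<noteq> 0" "b \<noteq> 0" using assms f by auto
  then have "Polynomial.order \<alpha> (a ^ 2) = 2 * Polynomial.order \<alpha> a" "Polynomial.order \<alpha> (b ^ 2 * f) = 2 * Polynomial.order \<alpha> b + 1"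
    using f order_mult[of a a \<alpha>] order_mult[of b b \<alpha>] order_mult[of "b^2" f \<alpha>]
    by (simp_all add: power2_eq_square)
  then show False using assms by simp presburger
qed

lemma regular_eq_0: "regular a b = 0 \<Longrightarrow> a = 0 \<and> b = 0"
proof -
  assume "regular a b = 0"
  then have "regular a b * regular a (- b) = 0" by simp
  then have "eval_x (a ^ 2 - b ^ 2 * f) = 0"
    by (simp add: regular_mult power2_eq_square) (simp add: regular_def eval_x_simps)
  then show ?thesis using norm_eq_0[of a b] by (simp add: eval_x_eq_0_iff)
qed

definition function_field :: "'o set" where
  "function_field = {regular a b / eval_x d | a b d. d \<noteq> 0}"

lemma function_fieldE:
  assumes "w \<in> function_field"
  obtains a b d where "d \<noteq> 0" "eval_x d \<noteq> 0" "w = regular a b / eval_x d"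
  using assms eval_x_eq_0_iff unfolding function_field_def by auto

lemma regular_in_function_field: "regular a b \<in> function_field"
proof -
  have "regular a b = regular a b / eval_x 1" by (simp add: eval_x_simps)
  then show ?thesis unfolding function_field_def using one_neq_zero by blast
qed

lemma intermediate_function_field: "intermediate_field function_field"
  unfolding intermediate_field_def
proof (intro conjI ballI subsetI)
  fix w assume "w \<in> range \<iota>"
  then obtain c where "w = regular [:c:] 0" by (auto simp: regular_def eval_x_simps)
  then show "w \<in> function_field" using regular_in_function_field by simp
next
  fix w w' assume "w \<in> function_field" "w' \<in> function_field"
  then obtain a b d a' b' d' where *: "d \<noteq> 0" "eval_x d \<noteq> 0" "w = regular a b / eval_x d"
    "d' \<noteq> 0" "eval_x d' \<noteq> 0" "w' = regular a' b' / eval_x d'"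
    by (elim function_fieldE)
  have "w + w' = regular (a * d' + a' * d) (b * d' + b' * d) / eval_x (d * d')"
    unfolding *(3) *(6) using *(2,5) by (simp add: regular_def eval_x_simps add_frac_eq algebra_simps)
  moreover have "w * w' = regular (a * a' + b * b' * f) (a * b' + a' * b) / eval_x (d * d')"
    using * by (simp add: eval_x_simps flip: regular_mult)
  moreover have "d * d' \<noteq> 0" using * by simp
  ultimately show "w + w' \<in> function_field" "w * w' \<in> function_field"
    unfolding function_field_def by blast+
next
  fix w assume "w \<in> function_field"
  then obtain a b d where *: "d \<noteq> 0" "eval_x d \<noteq> 0" "w = regular a b / eval_x d"
    by (elim function_fieldE)
  show "1 / w \<in> function_field"
  proof (cases "regular a b = 0")
    case True
    then show ?thesis using * regular_in_function_field[of 0 0] by (simp add: regular_def eval_x_simps)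
  next
    case False
    \<comment> \<open>The inverse of \<open>a + b y\<close> is its conjugate divided by its norm.\<close>
    let ?n = "a ^ 2 - b ^ 2 * f"
    have n: "regular a b * regular a (- b) = eval_x ?n"
      by (simp add: regular_mult power2_eq_square) (simp add: regular_def eval_x_simps)
    have "?n \<noteq> 0" using norm_eq_0[of a b] False by (auto simp: regular_def eval_x_simps)
    then have nz: "eval_x ?n \<noteq> 0" by (simp add: eval_x_eq_0_iff)
    then have "regular a (- b) \<noteq> 0" using n by auto
    have "1 / w = eval_x d * regular a (- b) / (regular a b * regular a (- b))"
      unfolding *(3) using False \<open>regular a (- b) \<noteq> 0\<close> by simp
    also have "\<dots> = regular (a * d) (- b * d) / eval_x ?n"
      unfolding n by (simp add: regular_def eval_x_simps algebra_simps)
    finally have "1 / w = regular (a * d) (- b * d) / eval_x ?n" .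
    then show ?thesis using \<open>?n \<noteq> 0\<close> unfolding function_field_def by blast
  qed
qed

lemma function_field_least:
  assumes L: "intermediate_field L" and "x \<in> L" "y \<in> L"
  shows "function_field \<subseteq> L"
proof
  fix w assume "w \<in> function_field"
  then show "w \<in> L"
    using assms by (elim function_fieldE)
      (auto simp: regular_def eval_x_def intro!: intermediate_poly intermediate_add intermediate_mult intermediate_divide)
qed

lemma x_in_function_field: "x \<in> function_field" and y_in_function_field: "y \<in> function_field"
  using regular_in_function_field[of "[:0, 1:]" 0] regular_in_function_field[of 0 1]
  by (simp_all add: regular_def eval_x_simps)

subsection \<open>Transcendence degree one\<close>

definition regular_le :: "nat \<Rightarrow> 'o set" where
  "regular_le n = {regular a b | a b. Polynomial.degree a \<le> n \<and> Polynomial.degree b \<le> n}"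

lemma regular_le_mult:
  assumes "w \<in> regular_le m" "w' \<in> regular_le n"
  shows "w * w' \<in> regular_le (m + n + Polynomial.degree f)"
proof -
  from assms obtain a b a' b' where *: "w = regular a b" "w' = regular a' b'"
    "Polynomial.degree a \<le> m" "Polynomial.degree b \<le> m" "Polynomial.degree a' \<le> n" "Polynomial.degree b' \<le> n"
    unfolding regular_le_def by blast
  have "Polynomial.degree (a * a' + b * b' * f) \<le> m + n + Polynomial.degree f"
    using * degree_mult_le[of a a'] degree_mult_le[of "b * b'" f] degree_mult_le[of b b']
    by (intro degree_add_le) linarith+
  moreover have "Polynomial.degree (a * b' + a' * b) \<le> m + n + Polynomial.degree f"
    using * degree_mult_le[of a b'] degree_mult_le[of a' b]
    by (intro degree_add_le) linarith+
  ultimately show ?thesis unfolding *(1,2) regular_mult regular_le_def by blast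
qed

lemma regular_le_power:
  "w \<in> regular_le n \<Longrightarrow> w ^ k \<in> regular_le (k * (n + Polynomial.degree f))"
proof (induction k)
  case 0
  have "1 = regular 1 0" by (simp add: regular_def eval_x_simps)
  then show ?case unfolding regular_le_def by fastforce
next
  case (Suc k)
  then have "w * w ^ k \<in> regular_le (n + k * (n + Polynomial.degree f) + Polynomial.degree f)"
    by (intro regular_le_mult)
  then show ?case by (simp add: algebra_simps)
qed

sublocale scale: vector_space "\<lambda>a w. \<iota> a * w"
  by unfold_locales (simp_all add: hom_add hom_mult algebra_simps)

lemma regular_le_span:
  assumes "w \<in> regular_le n"
  shows "w \<in> scale.span ((\<lambda>i. x ^ i) ` {..n} \<union> (\<lambda>i. x ^ i * y) ` {..n})" (is "_ \<in> scale.span ?B")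
proof -
  from assms obtain a b where w: "w = regular a b" and deg: "Polynomial.degree a \<le> n" "Polynomial.degree b \<le> n"
    unfolding regular_le_def by blast
  have eval: "eval_x p = (\<Sum>i\<le>n. \<iota> (Polynomial.coeff p i) * x ^ i)" if "Polynomial.degree p \<le> n" for p
  proof -
    have "eval_x p = (\<Sum>i\<le>Polynomial.degree p. \<iota> (Polynomial.coeff p i) * x ^ i)"
      by (simp add: eval_x_def poly_altdef)
    also have "\<dots> = (\<Sum>i\<le>n. \<iota> (Polynomial.coeff p i) * x ^ i)"
      using that by (intro sum.mono_neutral_left) (auto simp: coeff_eq_0)
    finally show ?thesis .
  qed
  have "w = (\<Sum>i\<le>n. \<iota> (Polynomial.coeff a i) * x ^ i) + (\<Sum>i\<le>n. \<iota> (Polynomial.coeff b i) * (x ^ i * y))"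
    using deg by (simp add: w regular_def eval sum_distrib_right mult.assoc)
  also have "\<dots> \<in> scale.span ?B"
    by (intro scale.span_add scale.span_sum scale.span_scale scale.span_base) auto
  finally show ?thesis .
qed

text \<open>After clearing denominators, the monomials \<open>t^i p^j\<close> with \<open>i, j \<le> M\<close> are \<open>(M + 1)\<^sup>2\<close>
  elements of a space of dimension linear in \<open>M\<close>.\<close>

lemma function_field_algebraically_dependent:
  assumes "t \<in> function_field" "p \<in> function_field"
  shows "algebraically_dependent t p"
proof -
  from assms obtain a b d a' b' d' where *: "d \<noteq> 0" "eval_x d \<noteq> 0" "t = regular a b / eval_x d"
    "d' \<noteq> 0" "eval_x d' \<noteq> 0" "p = regular a' b' / eval_x d'"
    by (elim function_fieldE)
  let ?D = "eval_x (d * d')" and ?A = "regular (a * d') (b * d')" and ?B = "regular (a' * d) (b' * d)"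
  have D: "?D \<noteq> 0" using * by (simp add: eval_x_simps)
  have t: "t = ?A / ?D" and p: "p = ?B / ?D"
    unfolding *(3) *(6) using *(2,5) by (simp_all add: regular_def eval_x_simps field_simps)
  obtain n where n: "?D \<in> regular_le n" "?A \<in> regular_le n" "?B \<in> regular_le n"
  proof
    let ?n = "Polynomial.degree (d * d') + Polynomial.degree (a * d') + Polynomial.degree (b * d') + Polynomial.degree (a' * d) + Polynomial.degree (b' * d)"
    have "?D = regular (d * d') 0" by (simp add: regular_def eval_x_simps)
    then show "?D \<in> regular_le ?n" "?A \<in> regular_le ?n" "?B \<in> regular_le ?n"
      unfolding regular_le_def by fastforce+
  qed
  define e where "e = n + Polynomial.degree f"
  define e' where "e' = e + Polynomial.degree f"
  \<comment> \<open>All the products below lie in \<open>regular_le N\<close>, where \<open>N\<close> is about \<open>2 M e'\<close>; this \<open>M\<close> makes \<open>(M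
    + 1)\<^sup>2\<close> exceed the number \<open>2 (N + 1)\<close> of generators of that space.\<close>
  define M where "M = 4 * e' + 2"
  define N where "N = 2 * M * e' + Polynomial.degree f + Polynomial.degree f"
  have mono: "w \<in> regular_le k \<Longrightarrow> k \<le> k' \<Longrightarrow> w \<in> regular_le k'" for w k k'
    unfolding regular_le_def by force
  have in_le: "?D ^ (2 * M) * t ^ i * p ^ j \<in> regular_le N" if "i \<le> M" "j \<le> M" for i j
  proof -
    have "?D ^ (2 * M) = ?D ^ (2 * M - i - j) * ?D ^ i * ?D ^ j"
      using that by (simp flip: power_add)
    then have "?D ^ (2 * M) * t ^ i * p ^ j = ?D ^ (2 * M - i - j) * ?A ^ i * ?B ^ j"
      using D by (simp add: t p power_divide)
    also have "\<dots> \<in> regular_le ((2 * M - i - j) * e + i * e + Polynomial.degree f + j * e + Polynomial.degree f)"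
      using n by (intro regular_le_mult regular_le_power[folded e_def, where n = n] regular_le_power[where n = n, folded e_def])
    also have "(2 * M - i - j) * e + i * e + Polynomial.degree f + j * e + Polynomial.degree f = 2 * M * e + Polynomial.degree f + Polynomial.degree f"
    proof -
      have "(2 * M - i - j) * e + i * e + j * e = ((2 * M - i - j) + i + j) * e" by (simp add: algebra_simps)
      also have "(2 * M - i - j) + i + j = 2 * M" using that by simp
      finally show ?thesis by simp
    qed
    finally show ?thesis
      by (rule mono) (simp add: N_def e'_def algebra_simps)
  qed
  let ?S = "(\<lambda>i. x ^ i) ` {..N} \<union> (\<lambda>i. x ^ i * y) ` {..N}"
  have "card ?S \<le> 2 * (N + 1)"
    using card_Un_le[of "(\<lambda>i. x ^ i) ` {..N}" "(\<lambda>i. x ^ i * y) ` {..N}"]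
      card_image_le[of "{..N}" "\<lambda>i. x ^ i"] card_image_le[of "{..N}" "\<lambda>i. x ^ i * y"] by simp
  also have "\<dots> < (M + 1) * (M + 1)"
  proof -
    have "Polynomial.degree f \<le> e'" by (simp add: e'_def)
    then have "2 * (N + 1) \<le> 2 * (2 * M * e' + 2 * e' + 1)" by (simp add: N_def)
    also have "\<dots> < (M + 1) * (M + 1)" by (simp add: M_def algebra_simps)
    finally show ?thesis .
  qed
  also have "\<dots> = card ({..M} \<times> {..M})" by (simp add: card_cartesian_product)
  finally have "card ?S < card ({..M} \<times> {..M})" .
  then obtain c where c: "\<exists>z\<in>{..M} \<times> {..M}. c z \<noteq> 0"
    and rel: "(\<Sum>z\<in>{..M} \<times> {..M}. \<iota> (c z) * (case z of (i, j) \<Rightarrow> ?D ^ (2 * M) * t ^ i * p ^ j)) = 0"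
    using scale.exists_nontrivial_relation[of "{..M} \<times> {..M}" ?S
        "\<lambda>z. case z of (i, j) \<Rightarrow> ?D ^ (2 * M) * t ^ i * p ^ j"] in_le regular_le_span by fastforce
  have "?D ^ (2 * M) * (\<Sum>(i, j)\<in>{..M} \<times> {..M}. \<iota> (c (i, j)) * t ^ i * p ^ j) =
      (\<Sum>z\<in>{..M} \<times> {..M}. \<iota> (c z) * (case z of (i, j) \<Rightarrow> ?D ^ (2 * M) * t ^ i * p ^ j))"
    by (auto simp: sum_distrib_left algebra_simps intro!: sum.cong)
  with rel D have "(\<Sum>(i, j)\<in>{..M} \<times> {..M}. \<iota> (c (i, j)) * t ^ i * p ^ j) = 0" by simp
  then show ?thesis using c unfolding algebraically_dependent_def
    by (intro exI[of _ "\<lambda>i j. c (i, j)"] exI[of _ M]) auto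
qed

subsection \<open>The places at the points of the curve\<close>

definition specialize_at :: "'k \<Rightarrow> 'k \<Rightarrow> ('o \<times> 'k) set" where
  "specialize_at \<alpha> \<beta> = {(regular a b, poly a \<alpha> + poly b \<alpha> * \<beta>) | a b. True}"

definition place_at :: "'k \<Rightarrow> 'k \<Rightarrow> ('o \<times> 'k) set" where
  "place_at \<alpha> \<beta> = localization (specialize_at \<alpha> \<beta>)"

context
  fixes \<alpha> \<beta> assumes on_curve: "\<beta> ^ 2 = poly f \<alpha>"
begin

text \<open>The value is well defined because 1 and \<open>y\<close> are independent over the polynomials in \<open>x\<close>.\<close>

lemma specialization_at: "specialization (specialize_at \<alpha> \<beta>)"
  unfolding specialization_def
proof (intro conjI allI impI)
  fix c
  have "\<iota> c = regular [:c:] 0" "c = poly [:c:] \<alpha> + poly 0 \<alpha> * \<beta>"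
    by (simp_all add: regular_def eval_x_simps)
  then show "(\<iota> c, c) \<in> specialize_at \<alpha> \<beta>" unfolding specialize_at_def by blast
next
  fix w c w' c' assume "(w, c) \<in> specialize_at \<alpha> \<beta>" "(w', c') \<in> specialize_at \<alpha> \<beta>"
  then obtain a b a' b' where *: "w = regular a b" "c = poly a \<alpha> + poly b \<alpha> * \<beta>"
     "w' = regular a' b'" "c' = poly a' \<alpha> + poly b' \<alpha> * \<beta>"
    unfolding specialize_at_def by blast
  have "c + c' = poly (a + a') \<alpha> + poly (b + b') \<alpha> * \<beta>" using * by (simp add: algebra_simps)
  then show "(w + w', c + c') \<in> specialize_at \<alpha> \<beta>"
    unfolding specialize_at_def *(1,3) regular_add by blast
  have "c * c' = poly (a * a') \<alpha> + poly (b * b') \<alpha> * \<beta> ^ 2 + poly (a * b' + a' * b) \<alpha> * \<beta>"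
    using * by (simp add: algebra_simps power2_eq_square)
  then have "c * c' = poly (a * a' + b * b' * f) \<alpha> + poly (a * b' + a' * b) \<alpha> * \<beta>"
    by (simp add: on_curve)
  then show "(w * w', c * c') \<in> specialize_at \<alpha> \<beta>"
    unfolding specialize_at_def *(1,3) regular_mult by blast
next
  fix c assume "(0, c) \<in> specialize_at \<alpha> \<beta>"
  then obtain a b where ab: "0 = regular a b" "c = poly a \<alpha> + poly b \<alpha> * \<beta>"
    unfolding specialize_at_def by blast
  then have "a = 0 \<and> b = 0" using regular_eq_0[of a b] by simp
  then show "c = 0" using ab(2) by simp
qed

lemma local_place_at: "local_specialization (place_at \<alpha> \<beta>)"
  unfolding place_at_def by (rule local_specialization_localization[OF specialization_at])

lemma regular_place_at: "(regular a b, poly a \<alpha> + poly b \<alpha> * \<beta>) \<in> place_at \<alpha> \<beta>"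
  using localization_extends[OF specialization_at] unfolding place_at_def specialize_at_def by blast

lemma place_at_least:
  assumes "local_specialization H" "(x, \<alpha>) \<in> H" "(y, \<beta>) \<in> H"
  shows "place_at \<alpha> \<beta> \<subseteq> H"
  unfolding place_at_def
proof (rule localization_least[OF assms(1)], safe)
  fix w c assume "(w, c) \<in> specialize_at \<alpha> \<beta>"
  then obtain a b where "w = regular a b" "c = poly a \<alpha> + poly b \<alpha> * \<beta>"
    unfolding specialize_at_def by auto
  then show "(w, c) \<in> H"
    using assms local_specialization_imp[OF assms(1)] unfolding regular_def eval_x_def
    by (auto intro!: specialization_add specialization_mult specialization_poly)
qed

text \<open>The uniformizer is \<open>x - \<alpha>\<close>, except at a branch point. There it is \<open>y\<close>, because \<open>x - \<alpha>\<close> is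
  \<open>y\<^sup>2\<close> divided by a function that does not vanish at the point.\<close>

lemma place_at: "place function_field (place_at \<alpha> \<beta>)"
proof -
  let ?t = "if \<beta> = 0 then y else x - \<iota> \<alpha>"
  note spec = local_specialization_imp[OF local_place_at]
  have x_at: "(x, \<alpha>) \<in> place_at \<alpha> \<beta>" and y_at: "(y, \<beta>) \<in> place_at \<alpha> \<beta>"
    using regular_place_at[of "[:0, 1:]" 0] regular_place_at[of 0 1]
    by (simp_all add: regular_def eval_x_simps)
  have t0: "?t \<noteq> 0"
    using regular_eq_0[of 0 1] regular_eq_0[of "[:- \<alpha>, 1:]" 0]
    by (auto simp: regular_def eval_x_simps hom_uminus)
  have f_split: "f = [:- \<alpha>, 1:] * synthetic_div f \<alpha> + [:poly f \<alpha>:]"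
    by (rule synthetic_div_correct'[symmetric])
  define g where "g = synthetic_div f \<alpha>"
  have f_eq: "eval_x f - \<iota> (poly f \<alpha>) = (x - \<iota> \<alpha>) * eval_x g"
    by (subst f_split) (simp only: eval_x_simps g_def, simp add: hom_uminus)
  have "\<exists>c. ((x - \<iota> \<alpha>) / ?t, c) \<in> place_at \<alpha> \<beta> \<and> (\<exists>c'. ((y - \<iota> \<beta>) / ?t, c') \<in> place_at \<alpha> \<beta>)"
  proof (cases "\<beta> = 0")
    case True
    then have root: "poly f \<alpha> = 0" using on_curve by simp
    have "poly (pderiv f) \<alpha> = poly g \<alpha>"
      by (subst f_split, unfold root g_def pderiv_add pderiv_mult) (simp add: pderiv_pCons)
    then have g: "poly g \<alpha> \<noteq> 0" using simple_roots[OF root] by simp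
    have "eval_x g \<noteq> 0" using g by (auto simp: eval_x_eq_0_iff)
    moreover have "y * y = (x - \<iota> \<alpha>) * eval_x g" using f_eq root y_square' by simp
    ultimately have "(x - \<iota> \<alpha>) / y = y / eval_x g"
      using t0 True by (simp add: field_simps)
    moreover have "(eval_x g, poly g \<alpha>) \<in> place_at \<alpha> \<beta>"
      using regular_place_at[of g 0] by (simp add: regular_def eval_x_simps)
    then have "(y / eval_x g, \<beta> / poly g \<alpha>) \<in> place_at \<alpha> \<beta>"
      using g y_at by (intro local_specialization_divide[OF local_place_at])
    moreover have "((y - \<iota> \<beta>) / ?t, 1) \<in> place_at \<alpha> \<beta>"
      using True t0 specialization_1[OF spec] by simp
    ultimately show ?thesis using True by auto
  next
    case False
    have "\<beta> + \<beta> \<noteq> 0" using False two_nonzero by (metis mult_2 mult_eq_0_iff)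
    moreover have yb: "(y + \<iota> \<beta>, \<beta> + \<beta>) \<in> place_at \<alpha> \<beta>"
      by (intro specialization_add[OF spec] y_at specialization_const[OF spec])
    ultimately have nz: "y + \<iota> \<beta> \<noteq> 0" using specialization_nonzero[OF spec] by blast
    have "(y - \<iota> \<beta>) * (y + \<iota> \<beta>) = y * y - \<iota> (\<beta> ^ 2)"
      by (simp add: algebra_simps hom_mult power2_eq_square)
    also have "\<dots> = (x - \<iota> \<alpha>) * eval_x g" using f_eq y_square' on_curve by simp
    finally have "(y - \<iota> \<beta>) / (x - \<iota> \<alpha>) = eval_x g / (y + \<iota> \<beta>)"
      using nz t0 False by (simp add: field_simps)
    moreover have "(eval_x g, poly g \<alpha>) \<in> place_at \<alpha> \<beta>"
      using regular_place_at[of g 0] by (simp add: regular_def eval_x_simps)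
    then have "(eval_x g / (y + \<iota> \<beta>), poly g \<alpha> / (\<beta> + \<beta>)) \<in> place_at \<alpha> \<beta>"
      using yb \<open>\<beta> + \<beta> \<noteq> 0\<close> by (intro local_specialization_divide[OF local_place_at])
    moreover have "((x - \<iota> \<alpha>) / ?t, 1) \<in> place_at \<alpha> \<beta>"
      using False t0 specialization_1[OF spec] by simp
    ultimately show ?thesis using False by auto
  qed
  then obtain c1 c2 where c1: "((x - \<iota> \<alpha>) / ?t, c1) \<in> place_at \<alpha> \<beta>"
    and c2: "((y - \<iota> \<beta>) / ?t, c2) \<in> place_at \<alpha> \<beta>" by blast
  show ?thesis
  proof (rule place_of_uniformizer[OF local_place_at _ _ t0])
    show dom: "Domain (place_at \<alpha> \<beta>) \<subseteq> function_field"
      unfolding place_at_def localization_def specialize_at_def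
      using regular_in_function_field intermediate_divide[OF intermediate_function_field] by auto
    have "(x - \<iota> \<alpha>, \<alpha> - \<alpha>) \<in> place_at \<alpha> \<beta>"
      by (intro specialization_diff[OF spec] x_at specialization_const[OF spec])
    then show "(?t, 0) \<in> place_at \<alpha> \<beta>" using y_at by auto
    show "algebraically_dependent ?t p" if "p \<in> function_field" for p
      using that \<open>(?t, 0) \<in> place_at \<alpha> \<beta>\<close> dom by (intro function_field_algebraically_dependent) auto
    show "\<exists>r s. r \<in> Domain (place_at \<alpha> \<beta>) \<and> s \<in> Domain (place_at \<alpha> \<beta>) \<and> s \<noteq> 0 \<and> w = r / s"
      if "w \<in> function_field" for w
    proof -
      from that obtain a b d where *: "eval_x d \<noteq> 0" "w = regular a b / eval_x d" by (elim function_fieldE)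
      moreover have "eval_x d = regular d 0" by (simp add: regular_def eval_x_simps)
      ultimately show ?thesis using regular_place_at by (metis DomainI)
    qed
    show "w / ?t \<in> Domain (place_at \<alpha> \<beta>)" if "(w, 0) \<in> place_at \<alpha> \<beta>" for w
    proof -
      from that obtain a b a' b' where w: "w = regular a b / regular a' b'"
        and nz: "poly a' \<alpha> + poly b' \<alpha> * \<beta> \<noteq> 0"
        and quot: "0 = (poly a \<alpha> + poly b \<alpha> * \<beta>) / (poly a' \<alpha> + poly b' \<alpha> * \<beta>)"
        unfolding place_at_def localization_def specialize_at_def by blast
      have zero: "poly a \<alpha> = - (poly b \<alpha> * \<beta>)" using nz quot by (auto simp: eq_neg_iff_add_eq_0)
      define a1 b1 where "a1 = synthetic_div a \<alpha>" and "b1 = synthetic_div b \<alpha>"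
      have ab: "a = [:- \<alpha>, 1:] * a1 + [:poly a \<alpha>:]" "b = [:- \<alpha>, 1:] * b1 + [:poly b \<alpha>:]"
        unfolding a1_def b1_def by (simp_all only: synthetic_div_correct')
      have ev: "eval_x a = (x - \<iota> \<alpha>) * eval_x a1 + \<iota> (poly a \<alpha>)"
        "eval_x b = (x - \<iota> \<alpha>) * eval_x b1 + \<iota> (poly b \<alpha>)"
        by (subst ab, simp only: eval_x_simps, simp add: hom_uminus)+
      have "regular a b = (x - \<iota> \<alpha>) * regular a1 b1 + \<iota> (poly b \<alpha>) * (y - \<iota> \<beta>)"
        unfolding regular_def ev zero by (simp add: hom_uminus hom_mult algebra_simps)
      then have "w / ?t = ((x - \<iota> \<alpha>) / ?t * regular a1 b1 + \<iota> (poly b \<alpha>) * ((y - \<iota> \<beta>) / ?t)) / regular a' b'"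
        by (simp add: w add_divide_distrib)
      moreover have "(((x - \<iota> \<alpha>) / ?t * regular a1 b1 + \<iota> (poly b \<alpha>) * ((y - \<iota> \<beta>) / ?t)) / regular a' b',
          (c1 * (poly a1 \<alpha> + poly b1 \<alpha> * \<beta>) + poly b \<alpha> * c2) / (poly a' \<alpha> + poly b' \<alpha> * \<beta>)) \<in> place_at \<alpha> \<beta>"
        by (intro local_specialization_divide[OF local_place_at] specialization_add[OF spec]
            specialization_mult[OF spec] specialization_const[OF spec] regular_place_at c1 c2 nz)
      ultimately show ?thesis by auto
    qed
  qed
qed

end

subsection \<open>Substitutions\<close>

text \<open>The fraction \<open>(a(x) + b(x) y) / d(x)\<close> determines \<open>a / d\<close> and \<open>b / d\<close>, so replacing \<open>(x, y)\<close>
  by another generic point of the same curve is well defined.\<close>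

lemma exists_substitution:
  assumes trans': "\<And>a. poly (map_poly \<iota> a) x' = 0 \<Longrightarrow> a = 0"
    and y': "y' ^ 2 = poly (map_poly \<iota> f) x'"
    and in_field: "x' \<in> function_field" "y' \<in> function_field"
  obtains \<psi> where "\<And>a. \<psi> (\<iota> a) = \<iota> a" "\<psi> x = x'" "\<psi> y = y'"
    "\<And>w w'. w \<in> function_field \<Longrightarrow> w' \<in> function_field \<Longrightarrow> \<psi> (w + w') = \<psi> w + \<psi> w'"
    "\<And>w w'. w \<in> function_field \<Longrightarrow> w' \<in> function_field \<Longrightarrow> \<psi> (w * w') = \<psi> w * \<psi> w'"
    "\<And>w. w \<in> function_field \<Longrightarrow> w \<noteq> 0 \<Longrightarrow> \<psi> w \<noteq> 0"
    "\<And>w. w \<in> function_field \<Longrightarrow> \<psi> w \<in> function_field"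
proof -
  interpret C': double_cover \<iota> x' y' f
    using trans' y' simple_roots has_root two_nonzero by unfold_locales auto
  define \<psi> where "\<psi> w = (SOME v. \<exists>a b d. d \<noteq> 0 \<and> w = regular a b / eval_x d \<and> v = C'.regular a b / C'.eval_x d)" for w
  have \<psi>: "\<psi> (regular a b / eval_x d) = C'.regular a b / C'.eval_x d" if "d \<noteq> 0" for a b d
    unfolding \<psi>_def
  proof (rule some_equality)
    show "\<exists>a' b' d'. d' \<noteq> 0 \<and> regular a b / eval_x d = regular a' b' / eval_x d' \<and>
        C'.regular a b / C'.eval_x d = C'.regular a' b' / C'.eval_x d'" using that by blast
    fix v assume "\<exists>a' b' d'. d' \<noteq> 0 \<and> regular a b / eval_x d = regular a' b' / eval_x d' \<and>
        v = C'.regular a' b' / C'.eval_x d'"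
    then obtain a' b' d' where *: "d' \<noteq> 0" "regular a b / eval_x d = regular a' b' / eval_x d'"
      "v = C'.regular a' b' / C'.eval_x d'" by blast
    have nz: "eval_x d \<noteq> 0" "eval_x d' \<noteq> 0" "C'.eval_x d \<noteq> 0" "C'.eval_x d' \<noteq> 0"
      using that * eval_x_eq_0_iff C'.eval_x_eq_0_iff by auto
    then have "regular (a * d' - a' * d) (b * d' - b' * d) = 0"
      using *(2) by (simp add: regular_def eval_x_simps field_simps)
    then have "a * d' = a' * d" "b * d' = b' * d" using regular_eq_0[of "a * d' - a' * d" "b * d' - b' * d"] by auto
    then have "C'.eval_x a * C'.eval_x d' = C'.eval_x a' * C'.eval_x d"
       "C'.eval_x b * C'.eval_x d' = C'.eval_x b' * C'.eval_x d"
      by (metis C'.eval_x_simps(3))+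
    then show "v = C'.regular a b / C'.eval_x d"
      using nz unfolding *(3) C'.regular_def by (simp add: frac_eq_eq algebra_simps)
  qed
  have \<psi>1: "\<psi> (regular a b) = C'.regular a b" for a b
    using \<psi>[of 1 a b] by (simp add: eval_x_simps C'.eval_x_simps)
  show ?thesis
  proof
    show "\<psi> (\<iota> a) = \<iota> a" for a
      using \<psi>1[of "[:a:]" 0] by (simp add: regular_def C'.regular_def eval_x_simps C'.eval_x_simps)
    show "\<psi> x = x'"
      using \<psi>1[of "[:0, 1:]" 0] by (simp add: regular_def C'.regular_def eval_x_simps C'.eval_x_simps)
    show "\<psi> y = y'"
      using \<psi>1[of 0 1] by (simp add: regular_def C'.regular_def eval_x_simps C'.eval_x_simps)
    show "\<psi> w \<noteq> 0" if "w \<in> function_field" "w \<noteq> 0" for w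
    proof -
      from that(1) obtain a b d where *: "d \<noteq> 0" "w = regular a b / eval_x d" by (elim function_fieldE)
      with that(2) have "a \<noteq> 0 \<or> b \<noteq> 0" by (auto simp: regular_def eval_x_simps)
      then have "C'.regular a b \<noteq> 0" using C'.regular_eq_0 by blast
      then show ?thesis using * \<psi> C'.eval_x_eq_0_iff by simp
    qed
    show "\<psi> w \<in> function_field" if "w \<in> function_field" for w
    proof -
      from that obtain a b d where *: "d \<noteq> 0" "w = regular a b / eval_x d" by (elim function_fieldE)
      then have "\<psi> w \<in> C'.function_field" using \<psi> unfolding C'.function_field_def by auto
      then show ?thesis using C'.function_field_least[OF intermediate_function_field in_field] by blast
    qed
    fix w w' assume "w \<in> function_field" "w' \<in> function_field"
    then obtain a b d a' b' d' where *: "d \<noteq> 0" "eval_x d \<noteq> 0" "w = regular a b / eval_x d"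
      "d' \<noteq> 0" "eval_x d' \<noteq> 0" "w' = regular a' b' / eval_x d'"
      by (elim function_fieldE)
    have nz: "C'.eval_x d \<noteq> 0" "C'.eval_x d' \<noteq> 0" "d * d' \<noteq> 0" using * C'.eval_x_eq_0_iff by auto
    have "w + w' = regular (a * d' + a' * d) (b * d' + b' * d) / eval_x (d * d')"
      unfolding *(3) *(6) using *(2,5) by (simp add: regular_def eval_x_simps add_frac_eq algebra_simps)
    moreover have "C'.regular a b / C'.eval_x d + C'.regular a' b' / C'.eval_x d' =
        C'.regular (a * d' + a' * d) (b * d' + b' * d) / C'.eval_x (d * d')"
      using nz by (simp add: C'.regular_def C'.eval_x_simps field_simps)
    ultimately show "\<psi> (w + w') = \<psi> w + \<psi> w'" using * \<psi> nz(3) by metis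
    have "w * w' = regular (a * a' + b * b' * f) (a * b' + a' * b) / eval_x (d * d')"
      using * by (simp add: eval_x_simps flip: regular_mult)
    moreover have "C'.regular a b / C'.eval_x d * (C'.regular a' b' / C'.eval_x d') =
        C'.regular (a * a' + b * b' * f) (a * b' + a' * b) / C'.eval_x (d * d')"
      by (simp add: C'.eval_x_simps flip: C'.regular_mult)
    ultimately show "\<psi> (w * w') = \<psi> w * \<psi> w'" using * \<psi> nz(3) by metis
  qed
qed

end


section \<open>Evaluation of multivariate polynomials\<close>

text \<open>Evaluation at a point whose coordinates lie in an extension of the ring of coefficients.\<close>

definition eval_hom :: "('a \<Rightarrow> 'b) \<Rightarrow> ('n::finite, 'a::comm_ring_1) mpoly \<Rightarrow> 'b::comm_ring_1 ^ 'n \<Rightarrow> 'b" where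
  "eval_hom h p v =
     (\<Sum>m\<in>Poly_Mapping.keys p. h (Poly_Mapping.lookup p m) * (\<Prod>i\<in>UNIV. v $ i ^ Poly_Mapping.lookup m i))"

definition Const :: "'a \<Rightarrow> ('n, 'a::zero) mpoly" where
  "Const c = Poly_Mapping.single 0 c"

definition Var :: "'n \<Rightarrow> ('n, 'a::zero_neq_one) mpoly" where
  "Var i = Poly_Mapping.single (Poly_Mapping.single i 1) 1"

lemma eval_mpoly_eval_hom: "eval_mpoly p v = eval_hom (\<lambda>a. a) p v"
  by (simp add: eval_mpoly_def eval_hom_def)

lemma mpoly_monomial_sum:
  "p = (\<Sum>m\<in>Poly_Mapping.keys p. Poly_Mapping.single m (Poly_Mapping.lookup p m))"
  by (rule poly_mapping_eqI)
     (simp add: lookup_sum lookup_single when_def not_in_keys_iff_lookup_eq_zero)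

lemma mpoly_monomial_induct:
  assumes "P 0" "\<And>m c. P (Poly_Mapping.single m c)" "\<And>p q. P p \<Longrightarrow> P q \<Longrightarrow> P (p + q)"
  shows "P (p :: ('n, 'a::comm_ring_1) mpoly)"
proof -
  have "P (\<Sum>m\<in>A. Poly_Mapping.single m (Poly_Mapping.lookup p m))" for A
    using assms by (induction A rule: infinite_finite_induct) auto
  then show ?thesis by (subst mpoly_monomial_sum)
qed

lemma monomial_eq_prod:
  "Poly_Mapping.single m c = Const c * (\<Prod>i\<in>UNIV. Var i ^ Poly_Mapping.lookup m i)"
  for m :: "'n::finite \<Rightarrow>\<^sub>0 nat" and c :: "'a::comm_ring_1"
proof -
  have pow: "Var i ^ k = (Poly_Mapping.single (Poly_Mapping.single i k) 1 :: ('n, 'a) mpoly)" for i k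
    by (induction k) (simp_all add: Var_def mult_single flip: single_add)
  have "(\<Prod>i\<in>A. Var i ^ Poly_Mapping.lookup m i) =
      (Poly_Mapping.single (\<Sum>i\<in>A. Poly_Mapping.single i (Poly_Mapping.lookup m i)) 1 :: ('n, 'a) mpoly)" for A
    by (induction A rule: infinite_finite_induct) (simp_all add: pow mult_single)
  moreover have "(\<Sum>i\<in>UNIV. Poly_Mapping.single i (Poly_Mapping.lookup m i)) = m"
    by (rule poly_mapping_eqI) (simp add: lookup_sum lookup_single when_def)
  ultimately show ?thesis by (simp add: Const_def mult_single)
qed

lemma mpoly_induct [case_names Const Var add mult]:
  assumes "\<And>c. P (Const c)" "\<And>i. P (Var i)" "\<And>p q. P p \<Longrightarrow> P q \<Longrightarrow> P (p + q)" "\<And>p q. P p \<Longrightarrow> P q \<Longrightarrow> P (p * q)"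
  shows "P (p :: ('n::finite, 'a::comm_ring_1) mpoly)"
proof (rule mpoly_monomial_induct)
  show "P 0" using assms(1)[of 0] by (simp add: Const_def)
  have one: "P 1" using assms(1)[of 1] by (simp add: Const_def)
  have pow: "P (Var i ^ k)" for i k using one assms by (induction k) auto
  have "P (\<Prod>i\<in>A. Var i ^ k i)" for A k
    using one assms pow by (induction A rule: infinite_finite_induct) auto
  then show "P (Poly_Mapping.single m c)" for m c unfolding monomial_eq_prod using assms by blast
qed (use assms in blast)

context comm_ring_hom
begin

lemma eval_hom_superset:
  assumes "finite A" "Poly_Mapping.keys p \<subseteq> A"
  shows "eval_hom hom p v = (\<Sum>m\<in>A. hom (Poly_Mapping.lookup p m) * (\<Prod>i\<in>UNIV. v $ i ^ Poly_Mapping.lookup m i))"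
  unfolding eval_hom_def using assms
  by (intro sum.mono_neutral_left) (auto simp: not_in_keys_iff_lookup_eq_zero)

lemma eval_hom_add: "eval_hom hom (p + q) v = eval_hom hom p v + eval_hom hom q v"
proof -
  let ?A = "Poly_Mapping.keys p \<union> Poly_Mapping.keys q"
  have "Poly_Mapping.keys (p + q) \<subseteq> ?A" by (rule keys_add)
  then show ?thesis
    using eval_hom_superset[of ?A p] eval_hom_superset[of ?A q] eval_hom_superset[of ?A "p + q"]
    by (simp add: lookup_add hom_add ring_distribs sum.distrib)
qed

lemma eval_hom_single:
  "eval_hom hom (Poly_Mapping.single m c) v = hom c * (\<Prod>i\<in>UNIV. v $ i ^ Poly_Mapping.lookup m i)"
  using eval_hom_superset[of "{m}" "Poly_Mapping.single m c"] by simp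

lemma eval_hom_0: "eval_hom hom 0 v = 0"
  by (simp add: eval_hom_def)

lemma eval_hom_Const: "eval_hom hom (Const c) v = hom c"
  by (simp add: Const_def eval_hom_single)

lemma eval_hom_Var: "eval_hom hom (Var i) v = v $ i"
proof -
  have "v $ j ^ Poly_Mapping.lookup (Poly_Mapping.single i (Suc 0)) j = (if j = i then v $ i else 1)" for j
    by (simp add: lookup_single when_def)
  then show ?thesis by (simp add: Var_def eval_hom_single)
qed

lemma eval_hom_mult: "eval_hom hom (p * q) v = eval_hom hom p v * eval_hom hom q v"
proof (induction p rule: mpoly_monomial_induct)
  case (2 m c)
  show ?case
  proof (induction q rule: mpoly_monomial_induct)
    case (2 n d)
    then show ?case
      by (simp add: mult_single eval_hom_single hom_mult lookup_add power_add prod.distrib)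
  next
    case (3 p q)
    show ?case unfolding distrib_left eval_hom_add 3 ..
  qed (simp add: eval_hom_0)
next
  case (3 p p')
  show ?case unfolding distrib_right eval_hom_add 3 ..
qed (simp add: eval_hom_0)

lemma eval_hom_power: "eval_hom hom (p ^ n) v = eval_hom hom p v ^ n"
  by (induction n) (simp_all add: eval_hom_mult eval_hom_Const[of 1, unfolded Const_def, simplified])

lemma eval_hom_scale:
  assumes "homogeneous_of_degree d p"
  shows "eval_hom hom p (c *s v) = c ^ d * eval_hom hom p v"
proof -
  have "hom (Poly_Mapping.lookup p m) * (\<Prod>i\<in>UNIV. (c *s v) $ i ^ Poly_Mapping.lookup m i) =
      c ^ d * (hom (Poly_Mapping.lookup p m) * (\<Prod>i\<in>UNIV. v $ i ^ Poly_Mapping.lookup m i))"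
    if "m \<in> Poly_Mapping.keys p" for m
  proof -
    have "(\<Prod>i\<in>UNIV. c ^ Poly_Mapping.lookup m i) = c ^ d"
      using that assms unfolding homogeneous_of_degree_def by (simp flip: power_sum)
    then have "(\<Prod>i\<in>UNIV. (c *s v) $ i ^ Poly_Mapping.lookup m i) = c ^ d * (\<Prod>i\<in>UNIV. v $ i ^ Poly_Mapping.lookup m i)"
      by (simp add: power_mult_distrib prod.distrib)
    then show ?thesis by (simp only: mult.left_commute)
  qed
  then show ?thesis unfolding eval_hom_def sum_distrib_left by (intro sum.cong) auto
qed

lemma hom_eval_mpoly: "hom (eval_mpoly p v) = eval_hom hom p (\<chi> i. hom (v $ i))"
  by (simp add: eval_mpoly_def eval_hom_def hom_sum hom_mult hom_prod hom_power)

end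

lemma comm_ring_hom_id: "comm_ring_hom (\<lambda>a :: 'a::comm_ring_1. a)"
  by unfold_locales auto

lemmas eval_mpoly_simps =
  comm_ring_hom.eval_hom_add[OF comm_ring_hom_id, folded eval_mpoly_eval_hom] comm_ring_hom.eval_hom_mult[OF comm_ring_hom_id, folded eval_mpoly_eval_hom]
  comm_ring_hom.eval_hom_Const[OF comm_ring_hom_id, folded eval_mpoly_eval_hom] comm_ring_hom.eval_hom_Var[OF comm_ring_hom_id, folded eval_mpoly_eval_hom]
  comm_ring_hom.eval_hom_power[OF comm_ring_hom_id, folded eval_mpoly_eval_hom] comm_ring_hom.eval_hom_0[OF comm_ring_hom_id, folded eval_mpoly_eval_hom]

lemmas eval_mpoly_scale = comm_ring_hom.eval_hom_scale[OF comm_ring_hom_id, folded eval_mpoly_eval_hom]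



subsection \<open>Homogeneous polynomials\<close>

lemma homogeneous_of_degree_add:
  "homogeneous_of_degree d p \<Longrightarrow> homogeneous_of_degree d q \<Longrightarrow> homogeneous_of_degree d (p + q)"
  unfolding homogeneous_of_degree_def using keys_add[of p q] by blast

lemma homogeneous_of_degree_mult:
  fixes p q :: "('n::finite, 'a::comm_ring_1) mpoly"
  assumes "homogeneous_of_degree d p" "homogeneous_of_degree e q"
  shows "homogeneous_of_degree (d + e) (p * q)"
  unfolding homogeneous_of_degree_def
proof
  fix m assume "m \<in> Poly_Mapping.keys (p * q)"
  then obtain a b where "m = a + b" "a \<in> Poly_Mapping.keys p" "b \<in> Poly_Mapping.keys q"
    using keys_mult[of p q] by blast
  then show "(\<Sum>i\<in>UNIV. Poly_Mapping.lookup m i) = d + e"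
    using assms by (simp add: homogeneous_of_degree_def lookup_add sum.distrib)
qed

lemma homogeneous_of_degree_Const: "homogeneous_of_degree 0 (Const c)"
  by (simp add: homogeneous_of_degree_def Const_def)

lemma homogeneous_of_degree_Var: "homogeneous_of_degree 1 (Var i :: ('n::finite, 'a::comm_ring_1) mpoly)"
  by (simp add: homogeneous_of_degree_def Var_def lookup_single when_def)

lemma homogeneous_of_degree_Var_power:
  "homogeneous_of_degree d (Var i ^ d :: ('n::finite, 'a::comm_ring_1) mpoly)"
proof (induction d)
  case 0
  have "homogeneous_of_degree 0 (Const 1 :: ('n, 'a) mpoly)" by (rule homogeneous_of_degree_Const)
  then show ?case by (simp add: Const_def)
next
  case (Suc d)
  then show ?case using homogeneous_of_degree_mult[OF homogeneous_of_degree_Var Suc] by simp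
qed

subsection \<open>Gradients\<close>

lemma eval_partial_mpoly:
  fixes p :: "('n::finite, 'a::comm_ring_1) mpoly"
  shows "eval_mpoly (partial_mpoly i p) v =
    (\<Sum>m\<in>Poly_Mapping.keys p. Poly_Mapping.lookup p m *
      (of_nat (Poly_Mapping.lookup m i) * v $ i ^ (Poly_Mapping.lookup m i - 1) *
        (\<Prod>j\<in>UNIV - {i}. v $ j ^ Poly_Mapping.lookup m j)))"
proof -
  have eval_sum: "eval_mpoly (sum g A) v = (\<Sum>m\<in>A. eval_mpoly (g m) v)"
    for g :: "('n \<Rightarrow>\<^sub>0 nat) \<Rightarrow> ('n, 'a) mpoly" and A
    by (induction A rule: infinite_finite_induct) (simp_all add: eval_mpoly_simps)
  have mon: "(\<Prod>j\<in>UNIV. v $ j ^ Poly_Mapping.lookup (m - Poly_Mapping.single i 1) j) =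
      v $ i ^ (Poly_Mapping.lookup m i - 1) * (\<Prod>j\<in>UNIV - {i}. v $ j ^ Poly_Mapping.lookup m j)" for m
  proof -
    have "Poly_Mapping.lookup (m - Poly_Mapping.single i 1) j =
        (if j = i then Poly_Mapping.lookup m i - 1 else Poly_Mapping.lookup m j)" for j
      by (simp add: lookup_minus lookup_single when_def)
    then have "(\<Prod>j\<in>UNIV. v $ j ^ Poly_Mapping.lookup (m - Poly_Mapping.single i 1) j) =
        (\<Prod>j\<in>UNIV. v $ j ^ (if j = i then Poly_Mapping.lookup m i - 1 else Poly_Mapping.lookup m j))"
      by (simp only:)
    also have "\<dots> = v $ i ^ (Poly_Mapping.lookup m i - 1) *
        (\<Prod>j\<in>UNIV - {i}. v $ j ^ (if j = i then Poly_Mapping.lookup m i - 1 else Poly_Mapping.lookup m j))"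
      using prod.remove[of UNIV i "\<lambda>j. v $ j ^ (if j = i then Poly_Mapping.lookup m i - 1 else Poly_Mapping.lookup m j)"]
      by simp
    also have "(\<Prod>j\<in>UNIV - {i}. v $ j ^ (if j = i then Poly_Mapping.lookup m i - 1 else Poly_Mapping.lookup m j)) =
        (\<Prod>j\<in>UNIV - {i}. v $ j ^ Poly_Mapping.lookup m j)"
      by (rule prod.cong) auto
    finally show ?thesis .
  qed
  show ?thesis
    unfolding partial_mpoly_def eval_sum comm_ring_hom.eval_hom_single[OF comm_ring_hom_id, folded eval_mpoly_eval_hom] mon
    by (simp only: mult_ac)
qed

lemma eval_partial_mpoly_superset:
  fixes p :: "('n::finite, 'a::comm_ring_1) mpoly"
  assumes "finite A" "Poly_Mapping.keys p \<subseteq> A"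
  shows "eval_mpoly (partial_mpoly i p) v =
    (\<Sum>m\<in>A. Poly_Mapping.lookup p m *
      (of_nat (Poly_Mapping.lookup m i) * v $ i ^ (Poly_Mapping.lookup m i - 1) *
        (\<Prod>j\<in>UNIV - {i}. v $ j ^ Poly_Mapping.lookup m j)))"
  unfolding eval_partial_mpoly using assms
  by (intro sum.mono_neutral_left) (auto simp: not_in_keys_iff_lookup_eq_zero)

lemma eval_partial_mpoly_add:
  fixes p q :: "('n::finite, 'a::comm_ring_1) mpoly"
  shows "eval_mpoly (partial_mpoly i (p + q)) v = eval_mpoly (partial_mpoly i p) v + eval_mpoly (partial_mpoly i q) v"
proof -
  let ?A = "Poly_Mapping.keys p \<union> Poly_Mapping.keys q"
  have "Poly_Mapping.keys (p + q) \<subseteq> ?A" by (rule keys_add)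
  then show ?thesis
    using eval_partial_mpoly_superset[of ?A p] eval_partial_mpoly_superset[of ?A q]
      eval_partial_mpoly_superset[of ?A "p + q"]
    by (simp add: lookup_add ring_distribs sum.distrib)
qed

lemma eval_partial_mpoly_0: "eval_mpoly (partial_mpoly i (0 :: ('n::finite, 'a::comm_ring_1) mpoly)) v = 0"
  by (simp add: eval_partial_mpoly)

lemma eval_partial_mpoly_single:
  fixes c :: "'a::comm_ring_1"
  shows "eval_mpoly (partial_mpoly i (Poly_Mapping.single m c)) v =
      c * (of_nat (Poly_Mapping.lookup m i) * v $ i ^ (Poly_Mapping.lookup m i - 1) *
        (\<Prod>j\<in>UNIV - {i}. v $ j ^ Poly_Mapping.lookup m j))"
  using eval_partial_mpoly_superset[of "{m}" "Poly_Mapping.single m c"] by simp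

lemma eval_partial_mpoly_mult:
  fixes p q :: "('n::finite, 'a::comm_ring_1) mpoly"
  shows "eval_mpoly (partial_mpoly i (p * q)) v =
    eval_mpoly p v * eval_mpoly (partial_mpoly i q) v + eval_mpoly q v * eval_mpoly (partial_mpoly i p) v"
proof (induction p rule: mpoly_monomial_induct)
  case (2 m c)
  show ?case
  proof (induction q rule: mpoly_monomial_induct)
    case (2 n d)
    have split: "(\<Prod>j\<in>UNIV. v $ j ^ Poly_Mapping.lookup m j) =
        v $ i ^ Poly_Mapping.lookup m i * (\<Prod>j\<in>UNIV - {i}. v $ j ^ Poly_Mapping.lookup m j)" for m :: "'n \<Rightarrow>\<^sub>0 nat"
      by (subst prod.remove[of UNIV i]) auto
    have pow: "of_nat (a + b) * z ^ (a + b - 1) = of_nat a * (z ^ (a - 1) * z ^ b) + of_nat b * (z ^ a * z ^ (b - 1))"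
      for a b and z :: 'a
    proof (cases "a = 0 \<or> b = 0")
      case False
      then have "z ^ (a - 1) * z ^ b = z ^ (a + b - 1)" "z ^ a * z ^ (b - 1) = z ^ (a + b - 1)"
        by (simp_all flip: power_add)
      then show ?thesis by (simp only: of_nat_add distrib_right)
    qed auto
    let ?m = "Poly_Mapping.lookup m i" and ?n = "Poly_Mapping.lookup n i"
    let ?P = "\<Prod>j\<in>UNIV - {i}. v $ j ^ Poly_Mapping.lookup m j" and ?Q = "\<Prod>j\<in>UNIV - {i}. v $ j ^ Poly_Mapping.lookup n j"
    have "eval_mpoly (partial_mpoly i (Poly_Mapping.single m c * Poly_Mapping.single n d)) v =
        c * d * (of_nat (?m + ?n) * v $ i ^ (?m + ?n - 1) * (?P * ?Q))"
      by (simp add: mult_single eval_partial_mpoly_single lookup_add power_add prod.distrib)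
    also have "\<dots> = c * d * ((of_nat ?m * (v $ i ^ (?m - 1) * v $ i ^ ?n) + of_nat ?n * (v $ i ^ ?m * v $ i ^ (?n - 1))) * (?P * ?Q))"
      by (simp only: pow)
    also have "\<dots> = eval_mpoly (Poly_Mapping.single m c) v * eval_mpoly (partial_mpoly i (Poly_Mapping.single n d)) v +
        eval_mpoly (Poly_Mapping.single n d) v * eval_mpoly (partial_mpoly i (Poly_Mapping.single m c)) v"
      unfolding eval_partial_mpoly_single comm_ring_hom.eval_hom_single[OF comm_ring_hom_id, folded eval_mpoly_eval_hom] split
      by (simp add: algebra_simps)
    finally show ?case .
  next
    case (3 p q)
    show ?case
      unfolding distrib_left eval_partial_mpoly_add 3 eval_mpoly_simps by (simp add: algebra_simps)
  qed (simp add: eval_mpoly_simps eval_partial_mpoly_0)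
next
  case (3 p p')
  show ?case
    unfolding distrib_right eval_partial_mpoly_add 3 eval_mpoly_simps by (simp add: algebra_simps)
qed (simp add: eval_mpoly_simps eval_partial_mpoly_0)

lemma eval_partial_Const: "eval_mpoly (partial_mpoly i (Const c)) v = 0" for c :: "'a::comm_ring_1"
  by (simp add: Const_def eval_partial_mpoly_single)

lemma eval_partial_Var:
  "eval_mpoly (partial_mpoly i (Var j :: ('n::finite, 'a::comm_ring_1) mpoly)) v = (if i = j then 1 else 0)"
  by (auto simp: Var_def eval_partial_mpoly_single lookup_single when_def intro!: prod.neutral)

lemma gradient_nth: "gradient p v $ i = eval_mpoly (partial_mpoly i p) v"
  by (simp add: gradient_def)

lemma euler_homogeneous:
  fixes p :: "('n::finite, 'a::comm_ring_1) mpoly"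
  assumes "homogeneous_of_degree d p"
  shows "(\<Sum>i\<in>UNIV. gradient p v $ i * v $ i) = of_nat d * eval_mpoly p v"
proof -
  have mon: "of_nat (Poly_Mapping.lookup m i) * v $ i ^ (Poly_Mapping.lookup m i - 1) *
      (\<Prod>j\<in>UNIV - {i}. v $ j ^ Poly_Mapping.lookup m j) * v $ i =
      of_nat (Poly_Mapping.lookup m i) * (\<Prod>j\<in>UNIV. v $ j ^ Poly_Mapping.lookup m j)" for m i
  proof -
    have "(\<Prod>j\<in>UNIV. v $ j ^ Poly_Mapping.lookup m j) =
        v $ i ^ Poly_Mapping.lookup m i * (\<Prod>j\<in>UNIV - {i}. v $ j ^ Poly_Mapping.lookup m j)"
      by (subst prod.remove[of UNIV i]) auto
    then show ?thesis by (cases "Poly_Mapping.lookup m i") (simp_all add: mult_ac)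
  qed
  have "(\<Sum>i\<in>UNIV. gradient p v $ i * v $ i) =
      (\<Sum>i\<in>UNIV. \<Sum>m\<in>Poly_Mapping.keys p. Poly_Mapping.lookup p m *
        (of_nat (Poly_Mapping.lookup m i) * (\<Prod>j\<in>UNIV. v $ j ^ Poly_Mapping.lookup m j)))"
    unfolding gradient_nth eval_partial_mpoly sum_distrib_right mult.assoc[of "Poly_Mapping.lookup p _"] mon ..
  also have "\<dots> = (\<Sum>m\<in>Poly_Mapping.keys p. \<Sum>i\<in>UNIV. Poly_Mapping.lookup p m *
        (of_nat (Poly_Mapping.lookup m i) * (\<Prod>j\<in>UNIV. v $ j ^ Poly_Mapping.lookup m j)))"
    by (rule sum.swap)
  also have "\<dots> = (\<Sum>m\<in>Poly_Mapping.keys p. of_nat d * (Poly_Mapping.lookup p m * (\<Prod>j\<in>UNIV. v $ j ^ Poly_Mapping.lookup m j)))"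
  proof (rule sum.cong[OF refl])
    fix m assume "m \<in> Poly_Mapping.keys p"
    then have "d = (\<Sum>i\<in>UNIV. Poly_Mapping.lookup m i)" using assms by (simp add: homogeneous_of_degree_def)
    then show "(\<Sum>i\<in>UNIV. Poly_Mapping.lookup p m * (of_nat (Poly_Mapping.lookup m i) * (\<Prod>j\<in>UNIV. v $ j ^ Poly_Mapping.lookup m j))) =
        of_nat d * (Poly_Mapping.lookup p m * (\<Prod>j\<in>UNIV. v $ j ^ Poly_Mapping.lookup m j))"
      by (simp add: sum_distrib_left sum_distrib_right algebra_simps)
  qed
  finally show ?thesis by (simp add: eval_mpoly_def sum_distrib_left)
qed

text \<open>An ideal arises from 0 by repeatedly adding multiples of its generators.\<close>

lemma ideal_property:
  fixes p :: "('n::finite, 'a::comm_ring_1) mpoly"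
  assumes "p \<in> module.span times S" "P 0" "\<And>r q p. q \<in> S \<Longrightarrow> P p \<Longrightarrow> P (r * q + p)"
  shows "P p"
proof -
  interpret M: Modules.module "times :: ('n, 'a) mpoly \<Rightarrow> _"
    by unfold_locales (simp_all add: algebra_simps)
  from assms(1) show ?thesis
    by (induction rule: M.span_induct_alt) (use assms in auto)
qed


section \<open>Generic points of models of the double cover\<close>

lemma proj_point_eq_iff: "proj_point v = proj_point w \<longleftrightarrow> (\<exists>a. a \<noteq> 0 \<and> w = a *s v)"
  for v w :: "'a::field ^ 'n"
proof
  assume "proj_point v = proj_point w"
  moreover have "w \<in> proj_point w" unfolding proj_point_def by (auto intro!: exI[of _ 1])
  ultimately show "\<exists>a. a \<noteq> 0 \<and> w = a *s v" unfolding proj_point_def by auto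
next
  assume "\<exists>a. a \<noteq> 0 \<and> w = a *s v"
  then obtain a where a: "a \<noteq> 0" "w = a *s v" by blast
  show "proj_point v = proj_point w"
    unfolding proj_point_def
  proof safe
    fix b :: 'a assume "b \<noteq> 0"
    then have "b *s v = (b / a) *s w" "b / a \<noteq> 0" using a by (simp_all add: vector_smult_assoc)
    then show "\<exists>c. b *s v = c *s w \<and> c \<noteq> 0" by blast
    have "b *s w = (b * a) *s v" "b * a \<noteq> 0" using a \<open>b \<noteq> 0\<close> by (simp_all add: vector_smult_assoc)
    then show "\<exists>c. b *s w = c *s v \<and> c \<noteq> 0" by blast
  qed
qed

text \<open>Whether a form vanishes does not depend on the representative of the point.\<close>

lemma proj_point_mem_zeros:
  fixes v :: "'a::field ^ 'n::finite"
  assumes "\<And>p. p \<in> S \<Longrightarrow> homogeneous p"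
  shows "proj_point v \<in> proj_zeros S \<longleftrightarrow> v \<noteq> 0 \<and> (\<forall>p\<in>S. eval_mpoly p v = 0)"
proof
  assume "proj_point v \<in> proj_zeros S"
  then obtain w where w: "w \<noteq> 0" "\<forall>p\<in>S. eval_mpoly p w = 0" "proj_point w = proj_point v"
    unfolding proj_zeros_def by auto
  then obtain a where a: "a \<noteq> 0" "v = a *s w" using proj_point_eq_iff by blast
  have "eval_mpoly p v = 0" if p: "p \<in> S" for p
  proof -
    obtain d where "homogeneous_of_degree d p" using assms[OF p] unfolding homogeneous_def by blast
    then have "eval_mpoly p (a *s w) = a ^ d * eval_mpoly p w" by (rule eval_mpoly_scale)
    then show ?thesis using w p by (simp add: a)
  qed
  moreover have "v \<noteq> 0" using a w by (simp add: vec_eq_iff)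
  ultimately show "v \<noteq> 0 \<and> (\<forall>p\<in>S. eval_mpoly p v = 0)" by blast
qed (auto simp: proj_zeros_def)

text \<open>In a finite field, the product of all \<open>X - a\<close>, increased by 1, has no root.\<close>

lemma infinite_alg_closed_field: "infinite (UNIV :: 'a::alg_closed_field set)"
proof
  assume fin: "finite (UNIV :: 'a set)"
  define p where "p = (\<Prod>a::'a\<in>UNIV. [:- a, 1:]) + 1"
  have "Polynomial.degree (\<Prod>a::'a\<in>UNIV. [:- a, 1:]) = card (UNIV :: 'a set)"
    by (subst degree_prod_eq_sum_degree) auto
  then have "Polynomial.degree p > 0"
    unfolding p_def using fin by (subst degree_add_eq_left) (auto simp: card_gt_0_iff)
  then obtain z where "poly p z = 0" using alg_closed_imp_poly_has_root by blast
  moreover have "poly p z = 1" unfolding p_def using fin by (simp add: poly_prod)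
  ultimately show False by simp
qed

locale double_cover_alg_closed = double_cover \<iota> x y f
  for \<iota> :: "'k::alg_closed_field \<Rightarrow> 'o::field" and x y f
begin

definition curve :: "('k \<times> 'k) set" where "curve = {(\<alpha>, \<beta>). \<beta> ^ 2 = poly f \<alpha>}"

lemma infinite_curve: "infinite curve"
proof
  assume "finite curve"
  then have "finite (fst ` curve)" by simp
  moreover have "\<alpha> \<in> fst ` curve" for \<alpha>
    using nth_root_exists[of 2 "poly f \<alpha>"] unfolding curve_def by force
  ultimately show False using infinite_alg_closed_field finite_subset[of UNIV "fst ` curve"] by blast
qed

text \<open>A polynomial function on the curve, paired with its value at the generic point.\<close>

definition regular_function :: "'o \<Rightarrow> ('k \<Rightarrow> 'k \<Rightarrow> 'k) \<Rightarrow> bool" where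
  "regular_function w \<phi> \<longleftrightarrow> (\<exists>a b. w = regular a b \<and> (\<forall>(\<alpha>, \<beta>)\<in>curve. \<phi> \<alpha> \<beta> = poly a \<alpha> + poly b \<alpha> * \<beta>))"

lemma regular_function_const: "regular_function (\<iota> c) (\<lambda>\<alpha> \<beta>. c)"
  unfolding regular_function_def by (rule exI[of _ "[:c:]"], rule exI[of _ 0]) (simp add: regular_def eval_x_simps)

lemma regular_function_x: "regular_function x (\<lambda>\<alpha> \<beta>. \<alpha>)"
  unfolding regular_function_def by (rule exI[of _ "[:0, 1:]"], rule exI[of _ 0]) (simp add: regular_def eval_x_simps)

lemma regular_function_y: "regular_function y (\<lambda>\<alpha> \<beta>. \<beta>)"
  unfolding regular_function_def by (rule exI[of _ 0], rule exI[of _ 1]) (simp add: regular_def eval_x_simps)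

lemma regular_function_add:
  assumes "regular_function w \<phi>" "regular_function w' \<phi>'"
  shows "regular_function (w + w') (\<lambda>\<alpha> \<beta>. \<phi> \<alpha> \<beta> + \<phi>' \<alpha> \<beta>)"
proof -
  from assms obtain a b a' b' where *: "w = regular a b" "\<forall>(\<alpha>, \<beta>)\<in>curve. \<phi> \<alpha> \<beta> = poly a \<alpha> + poly b \<alpha> * \<beta>"
    "w' = regular a' b'" "\<forall>(\<alpha>, \<beta>)\<in>curve. \<phi>' \<alpha> \<beta> = poly a' \<alpha> + poly b' \<alpha> * \<beta>"
    unfolding regular_function_def by blast
  have "\<phi> \<alpha> \<beta> + \<phi>' \<alpha> \<beta> = poly (a + a') \<alpha> + poly (b + b') \<alpha> * \<beta>" if "(\<alpha>, \<beta>) \<in> curve" for \<alpha> \<beta>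
  proof -
    have "\<phi> \<alpha> \<beta> = poly a \<alpha> + poly b \<alpha> * \<beta>" "\<phi>' \<alpha> \<beta> = poly a' \<alpha> + poly b' \<alpha> * \<beta>" using * that by auto
    then show ?thesis by (simp add: algebra_simps)
  qed
  then show ?thesis unfolding regular_function_def *(1,3) regular_add by blast
qed

lemma regular_function_mult:
  assumes "regular_function w \<phi>" "regular_function w' \<phi>'"
  shows "regular_function (w * w') (\<lambda>\<alpha> \<beta>. \<phi> \<alpha> \<beta> * \<phi>' \<alpha> \<beta>)"
proof -
  from assms obtain a b a' b' where *: "w = regular a b" "\<forall>(\<alpha>, \<beta>)\<in>curve. \<phi> \<alpha> \<beta> = poly a \<alpha> + poly b \<alpha> * \<beta>"
    "w' = regular a' b'" "\<forall>(\<alpha>, \<beta>)\<in>curve. \<phi>' \<alpha> \<beta> = poly a' \<alpha> + poly b' \<alpha> * \<beta>"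
    unfolding regular_function_def by blast
  have "\<phi> \<alpha> \<beta> * \<phi>' \<alpha> \<beta> = poly (a * a' + b * b' * f) \<alpha> + poly (a * b' + a' * b) \<alpha> * \<beta>"
    if "(\<alpha>, \<beta>) \<in> curve" for \<alpha> \<beta>
  proof -
    from that have "poly f \<alpha> = \<beta> * \<beta>" by (simp add: curve_def power2_eq_square)
    moreover have "\<phi> \<alpha> \<beta> = poly a \<alpha> + poly b \<alpha> * \<beta>" "\<phi>' \<alpha> \<beta> = poly a' \<alpha> + poly b' \<alpha> * \<beta>" using * that by auto
    ultimately show ?thesis by (simp add: algebra_simps)
  qed
  then show ?thesis unfolding regular_function_def *(1,3) regular_mult by blast
qed

lemma regular_function_eval:
  fixes w :: "'o ^ 'm::finite" and \<phi> :: "'k \<Rightarrow> 'k \<Rightarrow> 'k ^ 'm"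
  assumes "\<And>i. regular_function (w $ i) (\<lambda>\<alpha> \<beta>. \<phi> \<alpha> \<beta> $ i)"
  shows "regular_function (eval_hom \<iota> p w) (\<lambda>\<alpha> \<beta>. eval_mpoly p (\<phi> \<alpha> \<beta>))"
  by (induction p rule: mpoly_induct)
     (simp_all add: eval_hom_Const eval_hom_Var eval_hom_add eval_hom_mult eval_mpoly_simps assms
       regular_function_const regular_function_add regular_function_mult)

lemma regular_function_vanishing:
  assumes "regular_function 0 \<phi>" "(\<alpha>, \<beta>) \<in> curve"
  shows "\<phi> \<alpha> \<beta> = 0"
  using assms regular_eq_0 unfolding regular_function_def by fastforce

text \<open>A zero of \<open>a + b y\<close> lies over a root of the norm \<open>a\<^sup>2 - b\<^sup>2 f\<close>.\<close>

lemma regular_function_finite_zeros: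
  assumes "regular_function w \<phi>" "w \<noteq> 0"
  shows "finite {(\<alpha>, \<beta>)\<in>curve. \<phi> \<alpha> \<beta> = 0}"
proof -
  from assms(1) obtain a b where w: "w = regular a b" and \<phi>: "\<forall>(\<alpha>, \<beta>)\<in>curve. \<phi> \<alpha> \<beta> = poly a \<alpha> + poly b \<alpha> * \<beta>"
    unfolding regular_function_def by blast
  have n: "a ^ 2 - b ^ 2 * f \<noteq> 0"
    using norm_eq_0[of a b] assms(2) w by (auto simp: regular_def eval_x_simps)
  have "{(\<alpha>, \<beta>)\<in>curve. \<phi> \<alpha> \<beta> = 0} \<subseteq> (SIGMA \<alpha>:{\<alpha>. poly (a ^ 2 - b ^ 2 * f) \<alpha> = 0}. {\<beta>. poly [:- poly f \<alpha>, 0, 1:] \<beta> = 0})"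
  proof clarsimp
    fix \<alpha> \<beta> assume *: "(\<alpha>, \<beta>) \<in> curve" "\<phi> \<alpha> \<beta> = 0"
    then have "poly a \<alpha> = - (poly b \<alpha> * \<beta>)" and \<beta>: "\<beta> ^ 2 = poly f \<alpha>"
      using \<phi> by (auto simp: curve_def eq_neg_iff_add_eq_0)
    then show "(poly a \<alpha>)\<^sup>2 = (poly b \<alpha>)\<^sup>2 * poly f \<alpha> \<and> \<beta> * \<beta> = poly f \<alpha>"
      by (simp add: power_mult_distrib power2_eq_square)
  qed
  moreover have "finite \<dots>"
    using n by (intro finite_SigmaI poly_roots_finite) auto
  ultimately show ?thesis by (rule finite_subset)
qed

lemma regular_function_eq_0:
  assumes "regular_function w \<phi>" "finite B" "\<And>\<alpha> \<beta>. (\<alpha>, \<beta>) \<in> curve - B \<Longrightarrow> \<phi> \<alpha> \<beta> = 0"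
  shows "w = 0"
proof (rule ccontr)
  assume "w \<noteq> 0"
  have "curve \<subseteq> {(\<alpha>, \<beta>)\<in>curve. \<phi> \<alpha> \<beta> = 0} \<union> B" using assms(3) by auto
  then show False
    using regular_function_finite_zeros[OF assms(1) \<open>w \<noteq> 0\<close>] assms(2) infinite_curve
    by (meson finite_UnI finite_subset)
qed

definition generic :: "'o ^ 3" where "generic = vector [x, y, 1]"

definition affine_point :: "'k \<Rightarrow> 'k \<Rightarrow> 'k ^ 3" where "affine_point \<alpha> \<beta> = vector [\<alpha>, \<beta>, 1]"

lemma generic_nth: "generic $ 1 = x" "generic $ 2 = y" "generic $ 3 = 1"
  and affine_point_nth: "affine_point \<alpha> \<beta> $ 1 = \<alpha>" "affine_point \<alpha> \<beta> $ 2 = \<beta>" "affine_point \<alpha> \<beta> $ 3 = 1"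
  by (simp_all add: generic_def affine_point_def)

lemma regular_function_generic: "regular_function (generic $ i) (\<lambda>\<alpha> \<beta>. affine_point \<alpha> \<beta> $ i)"
proof -
  have "\<forall>i. regular_function (generic $ i) (\<lambda>\<alpha> \<beta>. affine_point \<alpha> \<beta> $ i)"
    unfolding forall_3 generic_nth affine_point_nth
    using regular_function_x regular_function_y regular_function_const[of 1] by simp
  then show ?thesis by blast
qed

lemma mem_plane_points_curve:
  "proj_point v \<in> plane_points curve \<longleftrightarrow> (\<exists>(\<alpha>, \<beta>)\<in>curve. \<exists>a. a \<noteq> 0 \<and> v = a *s affine_point \<alpha> \<beta>)"
proof -
  have "proj_point v \<in> plane_points curve \<longleftrightarrow> (\<exists>\<alpha> \<beta>. proj_point v = proj_point (affine_point \<alpha> \<beta>) \<and> (\<alpha>, \<beta>) \<in> curve)"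
    unfolding plane_points_def affine_point_def mem_Collect_eq ..
  also have "\<dots> \<longleftrightarrow> (\<exists>\<alpha> \<beta>. (\<exists>a. a \<noteq> 0 \<and> v = a *s affine_point \<alpha> \<beta>) \<and> (\<alpha>, \<beta>) \<in> curve)"
    using eq_commute[of "proj_point v", THEN trans, OF proj_point_eq_iff] by simp
  finally show ?thesis by auto
qed

end

text \<open>The forms \<open>F\<close> and \<open>G\<close> are mutually inverse birational maps between the projective variety
  \<open>E\<close> and the affine curve.\<close>

locale birational_model = double_cover_alg_closed \<iota> x y f
  for \<iota> :: "'k::alg_closed_field \<Rightarrow> 'o::field" and x y f +
  fixes F :: "('n::finite, 'k) mpoly ^ 3" and G :: "(3, 'k) mpoly ^ 'n" and E :: "('k ^ 'n) set set"
    and dF dG :: nat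
  assumes F_forms: "\<And>j. homogeneous_of_degree dF (F $ j)"
    and G_forms: "\<And>i. homogeneous_of_degree dG (G $ i)"
    and inverse_E: "generically_left_inverse G F E (plane_points curve)"
    and inverse_curve: "generically_left_inverse F G (plane_points curve) E"
    and closed_E: "proj_closed E"
    and irreducible_E: "proj_irreducible E"
begin

lemma eval_forms_scale:
  fixes H :: "('i::finite, 'k) mpoly ^ 'm"
  assumes "\<And>j. homogeneous_of_degree d (H $ j)"
  shows "eval_forms H (c *s v) = c ^ d *s eval_forms H v"
  using eval_mpoly_scale[OF assms] by (simp add: eval_forms_def vec_eq_iff)

lemma mem_E_nonzero: "proj_point v \<in> E \<Longrightarrow> v \<noteq> 0"
  using closed_E proj_point_mem_zeros unfolding proj_closed_def by metis

lemma mem_E_proj_point: "P \<in> E \<Longrightarrow> \<exists>v. P = proj_point v"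
  using closed_E unfolding proj_closed_def proj_zeros_def by blast

definition generic_E :: "'o ^ 'n" where "generic_E = (\<chi> i. eval_hom \<iota> (G $ i) generic)"

lemma regular_function_generic_E:
  "regular_function (generic_E $ i) (\<lambda>\<alpha> \<beta>. eval_forms G (affine_point \<alpha> \<beta>) $ i)"
  unfolding generic_E_def eval_forms_def vec_lambda_beta
  by (rule regular_function_eval) (rule regular_function_generic)

lemma regular_function_eval_generic_E:
  "regular_function (eval_hom \<iota> p generic_E) (\<lambda>\<alpha> \<beta>. eval_mpoly p (eval_forms G (affine_point \<alpha> \<beta>)))"
  by (rule regular_function_eval) (rule regular_function_generic_E)

text \<open>Some form that cuts out the exceptional set does not vanish identically on the curve, so it
  has only finitely many zeros there.\<close>

lemma generic_inverse_curve:
  obtains B where "finite B"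
    "\<And>\<alpha> \<beta>. (\<alpha>, \<beta>) \<in> curve - B \<Longrightarrow> proj_point (eval_forms G (affine_point \<alpha> \<beta>)) \<in> E"
    "\<And>\<alpha> \<beta>. (\<alpha>, \<beta>) \<in> curve - B \<Longrightarrow> \<exists>a. a \<noteq> 0 \<and> eval_forms F (eval_forms G (affine_point \<alpha> \<beta>)) = a *s affine_point \<alpha> \<beta>"
proof -
  from inverse_curve obtain Z where Z: "proj_closed Z" "plane_points curve - Z \<noteq> {}"
    and inv: "\<And>v. proj_point v \<in> plane_points curve - Z \<Longrightarrow> proj_point (eval_forms G v) \<in> E \<and>
      proj_point (eval_forms F (eval_forms G v)) = proj_point v"
    unfolding generically_left_inverse_def by blast
  from Z(1) obtain S where S: "\<And>p. p \<in> S \<Longrightarrow> homogeneous p" "Z = proj_zeros S"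
    unfolding proj_closed_def by blast
  from Z(2) obtain \<alpha>0 \<beta>0 where 0: "(\<alpha>0, \<beta>0) \<in> curve" "proj_point (affine_point \<alpha>0 \<beta>0) \<notin> Z"
    unfolding plane_points_def affine_point_def by blast
  have "affine_point \<alpha>0 \<beta>0 \<noteq> 0" using affine_point_nth(3)[of \<alpha>0 \<beta>0] by auto
  with 0 S obtain p where p: "p \<in> S" "eval_mpoly p (affine_point \<alpha>0 \<beta>0) \<noteq> 0"
    using proj_point_mem_zeros[of S "affine_point \<alpha>0 \<beta>0"] by auto
  have reg: "regular_function (eval_hom \<iota> p generic) (\<lambda>\<alpha> \<beta>. eval_mpoly p (affine_point \<alpha> \<beta>))"
    by (rule regular_function_eval) (rule regular_function_generic)
  then have nz: "eval_hom \<iota> p generic \<noteq> 0"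
    using regular_function_vanishing[OF _ 0(1)] p(2) by force
  show ?thesis
  proof
    show "finite {(\<alpha>, \<beta>)\<in>curve. eval_mpoly p (affine_point \<alpha> \<beta>) = 0}"
      by (rule regular_function_finite_zeros[OF reg nz])
    fix \<alpha> \<beta> assume *: "(\<alpha>, \<beta>) \<in> curve - {(\<alpha>, \<beta>)\<in>curve. eval_mpoly p (affine_point \<alpha> \<beta>) = 0}"
    then have "proj_point (affine_point \<alpha> \<beta>) \<notin> Z"
      using proj_point_mem_zeros[of S "affine_point \<alpha> \<beta>"] S p by auto
    moreover have "proj_point (affine_point \<alpha> \<beta>) \<in> plane_points curve"
      using * unfolding plane_points_def affine_point_def by auto
    ultimately have **: "proj_point (eval_forms G (affine_point \<alpha> \<beta>)) \<in> E"
      "proj_point (affine_point \<alpha> \<beta>) = proj_point (eval_forms F (eval_forms G (affine_point \<alpha> \<beta>)))"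
      using inv by auto
    then show "proj_point (eval_forms G (affine_point \<alpha> \<beta>)) \<in> E"
      "\<exists>a. a \<noteq> 0 \<and> eval_forms F (eval_forms G (affine_point \<alpha> \<beta>)) = a *s affine_point \<alpha> \<beta>"
      unfolding proj_point_eq_iff by blast+
  qed
qed

text \<open>The map \<open>G\<close> sends all but finitely many points of the curve to \<open>E\<close>, which gives one
  direction. For the other, the points outside a proper closed subset of \<open>E\<close> are images of points
  of the curve, and \<open>E\<close> is irreducible.\<close>

lemma generic_vanishing_iff:
  assumes p: "homogeneous p"
  shows "eval_hom \<iota> p generic_E = 0 \<longleftrightarrow> (\<forall>v. proj_point v \<in> E \<longrightarrow> eval_mpoly p v = 0)"
proof
  assume "\<forall>v. proj_point v \<in> E \<longrightarrow> eval_mpoly p v = 0"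
  moreover obtain B where "finite B" "\<And>\<alpha> \<beta>. (\<alpha>, \<beta>) \<in> curve - B \<Longrightarrow> proj_point (eval_forms G (affine_point \<alpha> \<beta>)) \<in> E"
    using generic_inverse_curve by metis
  ultimately show "eval_hom \<iota> p generic_E = 0"
    using regular_function_eq_0[OF regular_function_eval_generic_E] by blast
next
  assume zero: "eval_hom \<iota> p generic_E = 0"
  obtain d where d: "homogeneous_of_degree d p" using p by (auto simp: homogeneous_def)
  from inverse_E obtain Z where Z: "proj_closed Z" "E - Z \<noteq> {}"
    and inv: "\<And>v. proj_point v \<in> E - Z \<Longrightarrow> proj_point (eval_forms F v) \<in> plane_points curve \<and>
      proj_point (eval_forms G (eval_forms F v)) = proj_point v"
    unfolding generically_left_inverse_def by blast
  have van: "eval_mpoly p v = 0" if v: "proj_point v \<in> E - Z" for v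
  proof -
    from inv[OF v] obtain \<alpha> \<beta> a b where c: "(\<alpha>, \<beta>) \<in> curve" and a: "a \<noteq> 0" "eval_forms F v = a *s affine_point \<alpha> \<beta>"
      and b: "b \<noteq> 0" "v = b *s eval_forms G (eval_forms F v)"
      unfolding mem_plane_points_curve proj_point_eq_iff[of "eval_forms G _"] by auto
    have "eval_mpoly p (eval_forms G (affine_point \<alpha> \<beta>)) = 0"
      using regular_function_vanishing[OF _ c] regular_function_eval_generic_E[of p] zero by auto
    then have "eval_mpoly p (b *s (a ^ dG *s eval_forms G (affine_point \<alpha> \<beta>))) = 0"
      by (simp add: eval_mpoly_scale[OF d])
    then show ?thesis using a b eval_forms_scale[OF G_forms] by metis
  qed
  have mem: "proj_point v \<in> proj_zeros {p} \<longleftrightarrow> v \<noteq> 0 \<and> eval_mpoly p v = 0" for v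
    using proj_point_mem_zeros[of "{p}" v] p by simp
  have closed: "proj_closed (proj_zeros {p})" unfolding proj_closed_def using p by blast
  have "E \<subseteq> Z \<union> proj_zeros {p}"
  proof
    fix P assume "P \<in> E"
    then obtain v where "P = proj_point v" using mem_E_proj_point by blast
    then show "P \<in> Z \<union> proj_zeros {p}"
      using van[of v] \<open>P \<in> E\<close> mem[of v] mem_E_nonzero[of v] by auto
  qed
  then have "E \<subseteq> proj_zeros {p}" using irreducible_E Z closed unfolding proj_irreducible_def by blast
  then show "\<forall>v. proj_point v \<in> E \<longrightarrow> eval_mpoly p v = 0"
    using mem by blast
qed

lemma generic_E_in_function_field: "generic_E $ i \<in> function_field"
  using regular_function_generic_E[of i] regular_in_function_field unfolding regular_function_def by auto

lemma generic_E_nonzero: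
  fixes v :: "'k ^ 'n"
  assumes "proj_point v \<in> E" "v $ j \<noteq> 0"
  shows "generic_E $ j \<noteq> 0"
proof
  assume "generic_E $ j = 0"
  moreover have "homogeneous (Var j :: ('n, 'k) mpoly)"
    using homogeneous_of_degree_Var unfolding homogeneous_def by blast
  ultimately show False
    using generic_vanishing_iff[of "Var j"] assms by (auto simp: eval_hom_Var eval_mpoly_simps)
qed

text \<open>The identities hold at all but finitely many points of the curve, hence at the generic
  point.\<close>

lemma generic_inverse_E:
  shows "eval_hom \<iota> (F $ 3) generic_E \<noteq> 0"
    and "x = eval_hom \<iota> (F $ 1) generic_E / eval_hom \<iota> (F $ 3) generic_E"
    and "y = eval_hom \<iota> (F $ 2) generic_E / eval_hom \<iota> (F $ 3) generic_E"
proof -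
  obtain B where B: "finite B"
    and inv: "\<And>\<alpha> \<beta>. (\<alpha>, \<beta>) \<in> curve - B \<Longrightarrow> \<exists>a. a \<noteq> 0 \<and> eval_forms F (eval_forms G (affine_point \<alpha> \<beta>)) = a *s affine_point \<alpha> \<beta>"
    using generic_inverse_curve by metis
  have Fj: "eval_mpoly (F $ j) (eval_forms G (affine_point \<alpha> \<beta>)) = eval_forms F (eval_forms G (affine_point \<alpha> \<beta>)) $ j" for j \<alpha> \<beta>
    by (simp add: eval_forms_def)
  have "curve - B \<noteq> {}" using infinite_curve B by (metis Diff_eq_empty_iff finite_subset)
  then obtain \<alpha> \<beta> where "(\<alpha>, \<beta>) \<in> curve - B" by fast
  then obtain a where "a \<noteq> 0" "eval_mpoly (F $ 3) (eval_forms G (affine_point \<alpha> \<beta>)) = a"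
    using inv[of \<alpha> \<beta>] unfolding Fj by (auto simp: affine_point_nth)
  then show nz: "eval_hom \<iota> (F $ 3) generic_E \<noteq> 0"
    using regular_function_vanishing[of _ \<alpha> \<beta>] regular_function_eval_generic_E[of "F $ 3"] \<open>(\<alpha>, \<beta>) \<in> curve - B\<close> by force
  have rel: "eval_hom \<iota> (F $ j) generic_E + \<iota> (- 1) * (generic $ j * eval_hom \<iota> (F $ 3) generic_E) = 0" for j
  proof (rule regular_function_eq_0[OF _ B])
    show "regular_function (eval_hom \<iota> (F $ j) generic_E + \<iota> (- 1) * (generic $ j * eval_hom \<iota> (F $ 3) generic_E))
      (\<lambda>\<alpha> \<beta>. eval_mpoly (F $ j) (eval_forms G (affine_point \<alpha> \<beta>)) +
         (- 1) * (affine_point \<alpha> \<beta> $ j * eval_mpoly (F $ 3) (eval_forms G (affine_point \<alpha> \<beta>))))"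
      by (intro regular_function_add regular_function_mult regular_function_const regular_function_generic
          regular_function_eval_generic_E)
    fix \<alpha> \<beta> assume "(\<alpha>, \<beta>) \<in> curve - B"
    then show "eval_mpoly (F $ j) (eval_forms G (affine_point \<alpha> \<beta>)) +
         (- 1) * (affine_point \<alpha> \<beta> $ j * eval_mpoly (F $ 3) (eval_forms G (affine_point \<alpha> \<beta>))) = 0"
      using inv[of \<alpha> \<beta>] unfolding Fj by (auto simp: affine_point_nth)
  qed
  show "x = eval_hom \<iota> (F $ 1) generic_E / eval_hom \<iota> (F $ 3) generic_E"
    using rel[of 1] nz by (simp add: generic_nth hom_uminus)
  show "y = eval_hom \<iota> (F $ 2) generic_E / eval_hom \<iota> (F $ 3) generic_E"
    using rel[of 2] nz by (simp add: generic_nth hom_uminus)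
qed

end


section \<open>Local rings at nonsingular points\<close>

text \<open>All of \<open>D\<close> is orthogonal to \<open>q\<close>, but the \<open>i\<close>-th unit vector is not. So the two together span
  a hyperplane, and some other unit vector lies outside it.\<close>

lemma exists_axis_complement:
  fixes D :: "('a::field ^ 'n::finite) set" and q :: "'a ^ 'n"
  assumes dim: "vec.dim D + 2 = CARD('n)" and q: "q $ i \<noteq> 0"
    and orth: "\<And>d. d \<in> D \<Longrightarrow> (\<Sum>k\<in>UNIV. d $ k * q $ k) = 0"
  obtains j where "\<And>g. \<exists>c. g - c *s axis j 1 \<in> vec.span (insert (axis i 1) D)"
proof -
  let ?D = "insert (axis i 1) D"
  have "(\<Sum>k\<in>UNIV. d $ k * q $ k) = 0" if "d \<in> vec.span D" for d
    using that
  proof (induction rule: vec.span_induct_alt)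
    case (step c x y)
    have "(\<Sum>k\<in>UNIV. (c *s x + y) $ k * q $ k) = c * (\<Sum>k\<in>UNIV. x $ k * q $ k) + (\<Sum>k\<in>UNIV. y $ k * q $ k)"
      by (simp add: sum_distrib_left sum.distrib algebra_simps)
    then show ?case using orth step by simp
  qed simp
  moreover have "(\<Sum>k\<in>UNIV. axis i 1 $ k * q $ k) = q $ i"
    by (subst sum.remove[of UNIV i]) (auto simp: axis_def intro!: sum.neutral)
  ultimately have "axis i 1 \<notin> vec.span D" using q by metis
  then have dim1: "vec.dim ?D = vec.dim D + 1" by (simp add: vec.dim_insert)
  have "\<exists>j. axis j 1 \<notin> vec.span ?D"
  proof (rule ccontr)
    assume "\<not> ?thesis"
    then have "cart_basis \<subseteq> vec.span ?D" by (auto simp: cart_basis_def)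
    then have "vec.span ?D = UNIV"
      using span_cart_basis vec.span_minimal[OF _ vec.subspace_span] by blast
    then have "vec.dim ?D = CARD('n)" by (metis vec.dim_span vec_dim_card)
    then show False using dim dim1 by simp
  qed
  then obtain j where "axis j 1 \<notin> vec.span ?D" by blast
  then have "vec.dim (insert (axis j 1) ?D) = CARD('n)" using dim dim1 vec.dim_insert[of "axis j 1" ?D] by simp
  then have "vec.span (insert (axis j 1) ?D) = (UNIV :: ('a ^ 'n) set)"
    using vec.dim_eq_full[of "insert (axis j 1) ?D"] by (simp add: vec.dimension_def card_cart_basis)
  then have "\<exists>c. g - c *s axis j 1 \<in> vec.span ?D" for g :: "'a ^ 'n"
    using vec.span_breakdown_eq by blast
  then show ?thesis by (rule that)
qed

context field_hom
begin

lemma specialization_eval_hom: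
  fixes w :: "'b ^ 'n::finite" and u :: "'a ^ 'n"
  assumes "specialization H" "\<And>i. (w $ i, u $ i) \<in> H"
  shows "(eval_hom hom p w, eval_mpoly p u) \<in> H"
  by (induction p rule: mpoly_induct)
     (simp_all add: eval_hom_Const eval_hom_Var eval_hom_add eval_hom_mult eval_mpoly_simps assms
       specialization_const specialization_add specialization_mult)

lemma intermediate_eval_hom:
  fixes w :: "'b ^ 'n::finite"
  assumes "intermediate_field L" "\<And>i. w $ i \<in> L"
  shows "eval_hom hom p w \<in> L"
  unfolding eval_hom_def using assms
  by (intro intermediate_sum intermediate_mult intermediate_prod intermediate_power intermediate_const) auto

lemma intermediate_fractions:
  assumes H: "specialization H"
  shows "intermediate_field {r / s | r s. r \<in> Domain H \<and> s \<in> Domain H \<and> s \<noteq> 0}" (is "intermediate_field ?L")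
  unfolding intermediate_field_def
proof (intro conjI ballI subsetI)
  have one: "1 \<in> Domain H" using specialization_1[OF H] by blast
  have dom: "w \<in> Domain H \<Longrightarrow> w' \<in> Domain H \<Longrightarrow> w + w' \<in> Domain H"
    "w \<in> Domain H \<Longrightarrow> w' \<in> Domain H \<Longrightarrow> w * w' \<in> Domain H" for w w'
    using specialization_add[OF H] specialization_mult[OF H] by blast+
  fix w
  show "w \<in> ?L" if "w \<in> range hom"
  proof -
    have "w = w / 1" "w \<in> Domain H" using that specialization_const[OF H] by auto
    then show ?thesis using one by fastforce
  qed
  assume "w \<in> ?L"
  then obtain r s where rs: "r \<in> Domain H" "s \<in> Domain H" "s \<noteq> 0" "w = r / s" by blast
  show "1 / w \<in> ?L"
  proof (cases "r = 0")
    case True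
    then have "1 / w = r / s" using rs by simp
    then show ?thesis using rs by blast
  next
    case False
    then have "1 / w = s / r" using rs by simp
    then show ?thesis using rs False by blast
  qed
  fix w' assume "w' \<in> ?L"
  then obtain r' s' where rs': "r' \<in> Domain H" "s' \<in> Domain H" "s' \<noteq> 0" "w' = r' / s'" by blast
  have "w + w' = (r * s' + r' * s) / (s * s')" "w * w' = (r * r') / (s * s')"
    unfolding rs(4) rs'(4) using rs(3) rs'(3) by (simp_all add: add_frac_eq)
  moreover have "r * s' + r' * s \<in> Domain H" "r * r' \<in> Domain H" "s * s' \<in> Domain H" "s * s' \<noteq> 0"
    using dom rs rs' by auto
  ultimately show "w + w' \<in> ?L" "w * w' \<in> ?L" by blast+
qed

text \<open>Nakayama's lemma, by elimination: the coefficient of \<open>z a\<close> on the right has the value 0, so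
  the equation can be solved for \<open>z a\<close>, and \<open>z a\<close> can be eliminated from the other equations.\<close>

lemma nakayama:
  assumes H: "local_specialization H" and "finite A"
    and "\<And>i. i \<in> A \<Longrightarrow> \<exists>s m. s \<in> Domain H \<and> (\<forall>k\<in>A. (m k, 0) \<in> H) \<and> z i = t * s + (\<Sum>k\<in>A. m k * z k)"
  shows "\<forall>i\<in>A. \<exists>s\<in>Domain H. z i = t * s"
  using assms(2,3)
proof (induction A rule: finite_induct)
  case (insert a A)
  note spec = local_specialization_imp[OF H]
  obtain s m where s: "s \<in> Domain H" and m: "\<forall>k\<in>insert a A. (m k, 0) \<in> H"
    and za: "z a = t * s + (\<Sum>k\<in>insert a A. m k * z k)" using insert.prems[of a, OF insertI1] by blast
  have unit: "(1 - m a, 1 - 0) \<in> H" using m by (intro specialization_diff[OF spec] specialization_1[OF spec]) auto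
  then have nz: "1 - m a \<noteq> 0" using specialization_nonzero[OF spec unit] by simp
  define s' where "s' = s / (1 - m a)"
  define m' where "m' k = m k / (1 - m a)" for k
  have s': "s' \<in> Domain H"
    using s local_specialization_divide[OF H _ unit, of s] unfolding s'_def by auto
  have m': "(m' k, 0) \<in> H" if "k \<in> A" for k
    using m that local_specialization_divide[OF H _ unit, of "m k" 0] unfolding m'_def by simp
  have move: "x = u + (b + v) \<Longrightarrow> x - b = u + v" for x u b v :: 'b by simp
  have "z a - m a * z a = t * s + (\<Sum>k\<in>A. m k * z k)"
    by (rule move[OF za[unfolded sum.insert[OF insert.hyps]]])
  then have "z a * (1 - m a) = t * s + (\<Sum>k\<in>A. m k * z k)"
    by (simp only: right_diff_distrib mult_1_right mult.commute[of "z a"])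
  then have "z a = (t * s + (\<Sum>k\<in>A. m k * z k)) / (1 - m a)"
    using nonzero_eq_divide_eq[OF nz] by blast
  also have "\<dots> = t * s' + (\<Sum>k\<in>A. m' k * z k)"
    by (simp add: s'_def m'_def add_divide_distrib sum_divide_distrib)
  finally have za': "z a = t * s' + (\<Sum>k\<in>A. m' k * z k)" .
  have IH: "\<forall>i\<in>A. \<exists>s\<in>Domain H. z i = t * s"
  proof (rule insert.IH)
    fix i assume i: "i \<in> A"
    then obtain r n where r: "r \<in> Domain H" and n: "\<forall>k\<in>insert a A. (n k, 0) \<in> H"
      and zi: "z i = t * r + (\<Sum>k\<in>insert a A. n k * z k)" using insert.prems[of i, OF insertI2] by blast
    have "z i = t * r + n a * z a + (\<Sum>k\<in>A. n k * z k)"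
      using zi unfolding sum.insert[OF insert.hyps] by (simp only: add.assoc)
    also have "\<dots> = t * (r + n a * s') + (\<Sum>k\<in>A. (n a * m' k + n k) * z k)"
    proof -
      have "(\<Sum>k\<in>A. (n a * m' k + n k) * z k) = n a * (\<Sum>k\<in>A. m' k * z k) + (\<Sum>k\<in>A. n k * z k)"
        by (simp only: distrib_right sum.distrib sum_distrib_left mult.assoc)
      then show ?thesis unfolding za' by (simp only: distrib_left mult_ac add_ac)
    qed
    finally have "z i = t * (r + n a * s') + (\<Sum>k\<in>A. (n a * m' k + n k) * z k)" .
    moreover have "r + n a * s' \<in> Domain H"
      using r n s' specialization_add[OF spec] specialization_mult[OF spec] by blast
    moreover have "(n a * m' k + n k, 0) \<in> H" if k: "k \<in> A" for k
    proof -
      have "(n a * m' k + n k, 0 * 0 + 0) \<in> H"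
        using n m' k by (intro specialization_add[OF spec] specialization_mult[OF spec]) auto
      then show ?thesis by simp
    qed
    ultimately show "\<exists>s m. s \<in> Domain H \<and> (\<forall>k\<in>A. (m k, 0) \<in> H) \<and> z i = t * s + (\<Sum>k\<in>A. m k * z k)"
      by (intro exI[of _ "r + n a * s'"] exI[of _ "\<lambda>k. n a * m' k + n k"] conjI ballI)
  qed
  then obtain r where r: "\<And>k. k \<in> A \<Longrightarrow> r k \<in> Domain H \<and> z k = t * r k"
    using bchoice[of A "\<lambda>k r. r \<in> Domain H \<and> z k = t * r"] by blast
  have "(\<Sum>k\<in>A. m' k * z k) = t * (\<Sum>k\<in>A. m' k * r k)"
    unfolding sum_distrib_left
  proof (rule sum.cong[OF refl])
    show "m' k * z k = t * (m' k * r k)" if "k \<in> A" for k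
      using r[OF that] by (simp only: mult.left_commute)
  qed
  then have "z a = t * (s' + (\<Sum>k\<in>A. m' k * r k))" using za' by (simp only: distrib_left)
  moreover have "s' + (\<Sum>k\<in>A. m' k * r k) \<in> Domain H"
  proof -
    have "\<forall>k\<in>A. \<exists>b. (r k, b) \<in> H" using r by blast
    then obtain b where b: "\<And>k. k \<in> A \<Longrightarrow> (r k, b k) \<in> H" using bchoice[of A "\<lambda>k b. (r k, b) \<in> H"] by blast
    have "((\<Sum>k\<in>A. m' k * r k), (\<Sum>k\<in>A. 0 * b k)) \<in> H"
      using m' b by (intro specialization_sum[OF spec] specialization_mult[OF spec]) auto
    then show ?thesis using s' specialization_add[OF spec] by blast
  qed
  ultimately have "\<exists>s\<in>Domain H. z a = t * s" by blast
  then show ?case using IH by blast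
qed simp

text \<open>When the \<open>z $ i\<close> generate the maximal ideal of a local ring, this is its square.\<close>

definition second_order :: "('b \<times> 'a) set \<Rightarrow> 'b ^ 'n \<Rightarrow> 'b set" where
  "second_order H z = {(\<Sum>i\<in>UNIV. m i * z $ i) | m. \<forall>i. (m i, 0) \<in> H}"

lemma second_orderI:
  "u = (\<Sum>i\<in>UNIV. m i * z $ i) \<Longrightarrow> (\<And>i. (m i, 0) \<in> H) \<Longrightarrow> u \<in> second_order H z"
  unfolding second_order_def mem_Collect_eq by (rule exI[of _ m]) simp

text \<open>In the case of a product, the product of the two increments is of second order, and the rest
  is the product rule.\<close>

lemma taylor:
  fixes w z :: "'b ^ 'n::finite" and q :: "'a ^ 'n"
  assumes spec: "specialization H" and w: "\<And>i. (w $ i, q $ i) \<in> H" and z: "\<And>i. z $ i = w $ i - hom (q $ i)"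
  shows "eval_hom hom p w - hom (eval_mpoly p q) - (\<Sum>i\<in>UNIV. hom (gradient p q $ i) * z $ i) \<in> second_order H z"
    (is "?R p \<in> ?J")
proof -
  have z0: "(z $ i, 0) \<in> H" for i
    using specialization_diff[OF spec w[of i] specialization_const[OF spec, of "q $ i"]] by (simp add: z)
  have plus_closed: "u + u' \<in> ?J" if "u \<in> ?J" "u' \<in> ?J" for u u'
  proof -
    from that obtain m m' where m: "\<forall>i. (m i, 0) \<in> H" "u = (\<Sum>i\<in>UNIV. m i * z $ i)"
      "\<forall>i. (m' i, 0) \<in> H" "u' = (\<Sum>i\<in>UNIV. m' i * z $ i)" unfolding second_order_def by blast
    have "u + u' = (\<Sum>i\<in>UNIV. (m i + m' i) * z $ i)" by (simp add: m sum.distrib algebra_simps)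
    moreover have "(m i + m' i, 0) \<in> H" for i
      using specialization_add[OF spec, of "m i" 0 "m' i" 0] m by simp
    ultimately show ?thesis by (rule second_orderI)
  qed
  have scale: "h * u \<in> ?J" if "(h, b) \<in> H" "u \<in> ?J" for h b u
  proof -
    from that obtain m where m: "\<forall>i. (m i, 0) \<in> H" "u = (\<Sum>i\<in>UNIV. m i * z $ i)"
      unfolding second_order_def by blast
    have "h * u = (\<Sum>i\<in>UNIV. (h * m i) * z $ i)" by (simp add: m sum_distrib_left mult.assoc)
    moreover have "(h * m i, 0) \<in> H" for i
      using specialization_mult[OF spec, of h b "m i" 0] m that by simp
    ultimately show ?thesis by (rule second_orderI)
  qed
  have zero: "0 \<in> ?J"
    using specialization_0[OF spec] by (intro second_orderI[of _ "\<lambda>_. 0"]) simp_all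
  show ?thesis
  proof (induction p rule: mpoly_induct)
    case (Const c)
    then show ?case by (simp add: eval_hom_Const eval_mpoly_simps gradient_nth eval_partial_Const zero)
  next
    case (Var j)
    have "(\<Sum>i\<in>UNIV. hom (gradient (Var j) q $ i) * z $ i) = z $ j"
      by (subst sum.remove[of UNIV j]) (auto simp: gradient_nth eval_partial_Var intro!: sum.neutral)
    then show ?case by (simp add: eval_hom_Var eval_mpoly_simps z zero)
  next
    case (add p p')
    have eq: "?R (p + p') = ?R p + ?R p'"
      by (simp add: eval_hom_add eval_mpoly_simps gradient_nth eval_partial_mpoly_add hom_add
          sum.distrib algebra_simps)
    show ?case unfolding eq by (rule plus_closed[OF add])
  next
    case (mult p p')
    define D where "D = eval_hom hom p w - hom (eval_mpoly p q)"
    have D: "(D, 0) \<in> H"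
      using specialization_diff[OF spec specialization_eval_hom[OF spec w, of p]
          specialization_const[OF spec, of "eval_mpoly p q"]]
      unfolding D_def by simp
    have "D * (\<Sum>i\<in>UNIV. hom (gradient p' q $ i) * z $ i) = (\<Sum>i\<in>UNIV. (D * hom (gradient p' q $ i)) * z $ i)"
      by (simp add: sum_distrib_left mult.assoc)
    moreover have "(D * hom (gradient p' q $ i), 0) \<in> H" for i
      using specialization_mult[OF spec D specialization_const[OF spec]] by simp
    ultimately have DL: "D * (\<Sum>i\<in>UNIV. hom (gradient p' q $ i) * z $ i) \<in> ?J"
      by (rule second_orderI)
    have L: "(\<Sum>i\<in>UNIV. hom (gradient (p * p') q $ i) * z $ i) =
        hom (eval_mpoly p q) * (\<Sum>i\<in>UNIV. hom (gradient p' q $ i) * z $ i) +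
        hom (eval_mpoly p' q) * (\<Sum>i\<in>UNIV. hom (gradient p q $ i) * z $ i)"
      by (simp add: gradient_nth eval_partial_mpoly_mult hom_add hom_mult sum_distrib_left
          sum.distrib algebra_simps)
    have eq: "?R (p * p') = D * ?R p' + D * (\<Sum>i\<in>UNIV. hom (gradient p' q $ i) * z $ i) +
        hom (eval_mpoly p q) * ?R p' + hom (eval_mpoly p' q) * ?R p"
      unfolding L by (simp add: D_def eval_hom_mult eval_mpoly_simps hom_mult algebra_simps)
    show ?case
      unfolding eq
      by (intro plus_closed DL scale[OF D] scale[OF specialization_const[OF spec]] mult)
  qed
qed

end


section \<open>Places of the function field and points of a nonsingular model\<close>

context birational_model
begin

text \<open>The local ring of \<open>E\<close> at \<open>v\<close>, as quotients of forms of the same degree evaluated at the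
  generic point, with their values at \<open>v\<close>.\<close>

definition place_E :: "'k ^ 'n \<Rightarrow> ('o \<times> 'k) set" where
  "place_E v = {(eval_hom \<iota> p generic_E / eval_hom \<iota> r generic_E, eval_mpoly p v / eval_mpoly r v) | p r d.
     homogeneous_of_degree d p \<and> homogeneous_of_degree d r \<and> eval_mpoly r v \<noteq> 0}"

lemma place_EI:
  assumes "homogeneous_of_degree d p" "homogeneous_of_degree d r" "eval_mpoly r v \<noteq> 0"
  shows "(eval_hom \<iota> p generic_E / eval_hom \<iota> r generic_E, eval_mpoly p v / eval_mpoly r v) \<in> place_E v"
  using assms unfolding place_E_def by blast

lemma place_EE:
  assumes "(w, a) \<in> place_E v"
  obtains p r d where "homogeneous_of_degree d p" "homogeneous_of_degree d r" "eval_mpoly r v \<noteq> 0"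
    "w = eval_hom \<iota> p generic_E / eval_hom \<iota> r generic_E" "a = eval_mpoly p v / eval_mpoly r v"
  using assms unfolding place_E_def by blast

lemma coordinate_place_E:
  fixes v :: "'k ^ 'n"
  assumes "v $ j \<noteq> 0"
  shows "(generic_E $ i / generic_E $ j, v $ i / v $ j) \<in> place_E v"
  using place_EI[OF homogeneous_of_degree_Var homogeneous_of_degree_Var, of j v i] assms
  by (simp add: eval_hom_Var eval_mpoly_simps)

lemma local_place_E:
  assumes v: "proj_point v \<in> E"
  shows "local_specialization (place_E v)"
proof -
  have generic_nz: "eval_hom \<iota> r generic_E \<noteq> 0" if "homogeneous_of_degree d r" "eval_mpoly r v \<noteq> 0" for r d
    using generic_vanishing_iff[of r] that v unfolding homogeneous_def by blast
  show ?thesis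
    unfolding local_specialization_def specialization_def
  proof (intro conjI allI impI)
    fix a
    show "(\<iota> a, a) \<in> place_E v"
      using place_EI[OF homogeneous_of_degree_Const[of a] homogeneous_of_degree_Const[of 1], of v]
      by (simp add: eval_hom_Const eval_mpoly_simps)
  next
    fix w a w' a' assume "(w, a) \<in> place_E v" "(w', a') \<in> place_E v"
    then obtain p r d p' r' d' where *: "homogeneous_of_degree d p" "homogeneous_of_degree d r" "eval_mpoly r v \<noteq> 0"
      "homogeneous_of_degree d' p'" "homogeneous_of_degree d' r'" "eval_mpoly r' v \<noteq> 0"
      and w: "w = eval_hom \<iota> p generic_E / eval_hom \<iota> r generic_E" "a = eval_mpoly p v / eval_mpoly r v"
        "w' = eval_hom \<iota> p' generic_E / eval_hom \<iota> r' generic_E" "a' = eval_mpoly p' v / eval_mpoly r' v"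
      by (elim place_EE)
    have nz: "eval_hom \<iota> r generic_E \<noteq> 0" "eval_hom \<iota> r' generic_E \<noteq> 0"
      using generic_nz * by blast+
    have h: "homogeneous_of_degree (d + d') (p * r' + p' * r)" "homogeneous_of_degree (d + d') (p * p')"
      "homogeneous_of_degree (d + d') (r * r')"
      using homogeneous_of_degree_mult[OF *(1,5)] homogeneous_of_degree_mult[OF *(4,2)]
        homogeneous_of_degree_mult[OF *(1,4)] homogeneous_of_degree_mult[OF *(2,5)]
      by (simp_all add: add.commute homogeneous_of_degree_add)
    have "eval_mpoly (r * r') v \<noteq> 0" using * by (simp add: eval_mpoly_simps)
    note I = place_EI[OF h(1) h(3) this] place_EI[OF h(2) h(3) this]
    show "(w + w', a + a') \<in> place_E v"
      using I(1) nz *(3,6) unfolding w by (simp add: eval_hom_add eval_hom_mult eval_mpoly_simps add_frac_eq)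
    show "(w * w', a * a') \<in> place_E v"
      using I(2) nz *(3,6) unfolding w by (simp add: eval_hom_add eval_hom_mult eval_mpoly_simps)
  next
    fix a assume "(0, a) \<in> place_E v"
    then obtain p r d where *: "homogeneous_of_degree d p" "homogeneous_of_degree d r" "eval_mpoly r v \<noteq> 0"
      "0 = eval_hom \<iota> p generic_E / eval_hom \<iota> r generic_E" "a = eval_mpoly p v / eval_mpoly r v"
      by (elim place_EE)
    then have "eval_hom \<iota> p generic_E = 0" using generic_nz[OF *(2,3)] by simp
    then have "eval_mpoly p v = 0"
      using generic_vanishing_iff[of p] *(1) v unfolding homogeneous_def by blast
    then show "a = 0" using * by simp
  next
    fix w a assume "(w, a) \<in> place_E v" "a \<noteq> 0"
    then obtain p r d where *: "homogeneous_of_degree d p" "homogeneous_of_degree d r" "eval_mpoly r v \<noteq> 0"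
      "w = eval_hom \<iota> p generic_E / eval_hom \<iota> r generic_E" "a = eval_mpoly p v / eval_mpoly r v"
      by (elim place_EE)
    then have "eval_mpoly p v \<noteq> 0" using \<open>a \<noteq> 0\<close> by auto
    from place_EI[OF *(2,1) this] show "(1 / w, 1 / a) \<in> place_E v" unfolding *(4,5) by simp
  qed
qed

lemma eval_generic_scale:
  assumes "homogeneous_of_degree d p" "generic_E $ j \<noteq> 0"
  shows "eval_hom \<iota> p generic_E = generic_E $ j ^ d * eval_hom \<iota> p (\<chi> i. generic_E $ i / generic_E $ j)"
proof -
  have "generic_E = generic_E $ j *s (\<chi> i. generic_E $ i / generic_E $ j)"
    using assms(2) by (simp add: vec_eq_iff)
  then show ?thesis using eval_hom_scale[OF assms(1)] by metis
qed

text \<open>The quotients of the coordinates generate the local ring.\<close>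

lemma place_E_least:
  fixes v :: "'k ^ 'n"
  assumes H: "local_specialization H" and j: "v $ j \<noteq> 0" "generic_E $ j \<noteq> 0"
    and coords: "\<And>i. (generic_E $ i / generic_E $ j, v $ i / v $ j) \<in> H"
  shows "place_E v \<subseteq> H"
proof (rule subrelI)
  fix w a assume "(w, a) \<in> place_E v"
  then obtain p r d where *: "homogeneous_of_degree d p" "homogeneous_of_degree d r" "eval_mpoly r v \<noteq> 0"
    "w = eval_hom \<iota> p generic_E / eval_hom \<iota> r generic_E" "a = eval_mpoly p v / eval_mpoly r v"
    by (elim place_EE)
  let ?w = "\<chi> i. generic_E $ i / generic_E $ j" and ?u = "\<chi> i. v $ i / v $ j"
  have u: "eval_mpoly p v = v $ j ^ d * eval_mpoly p ?u" if "homogeneous_of_degree d p" for p :: "('n, 'k) mpoly"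
  proof -
    have "v = v $ j *s ?u" using j by (simp add: vec_eq_iff)
    then show ?thesis using eval_mpoly_scale[OF that] by metis
  qed
  have "(eval_hom \<iota> p ?w, eval_mpoly p ?u) \<in> H" for p
    by (rule specialization_eval_hom[OF local_specialization_imp[OF H]]) (simp add: coords)
  moreover have "eval_mpoly r ?u \<noteq> 0" using u[OF *(2)] *(3) by auto
  ultimately have "(eval_hom \<iota> p ?w / eval_hom \<iota> r ?w, eval_mpoly p ?u / eval_mpoly r ?u) \<in> H"
    by (intro local_specialization_divide[OF H])
  then show "(w, a) \<in> H"
    unfolding *(4,5) u[OF *(1)] u[OF *(2)] eval_generic_scale[OF *(1) j(2)] eval_generic_scale[OF *(2) j(2)]
    using j by simp
qed

lemma Domain_place_E: "Domain (place_E v) \<subseteq> function_field"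
proof
  fix w assume "w \<in> Domain (place_E v)"
  then obtain p r where "w = eval_hom \<iota> p generic_E / eval_hom \<iota> r generic_E"
    by (auto elim: place_EE)
  then show "w \<in> function_field"
    using intermediate_divide[OF intermediate_function_field]
      intermediate_eval_hom[OF intermediate_function_field generic_E_in_function_field] by blast
qed

text \<open>Each fraction of \<open>x\<close> and \<open>y\<close> is one of forms in the generic point, because \<open>F\<close> inverts \<open>G\<close>.\<close>

lemma place_E_fractions:
  fixes v :: "'k ^ 'n"
  assumes v: "proj_point v \<in> E" and w: "w \<in> function_field"
  shows "\<exists>r s. r \<in> Domain (place_E v) \<and> s \<in> Domain (place_E v) \<and> s \<noteq> 0 \<and> w = r / s"
proof -
  let ?L = "{r / s | r s. r \<in> Domain (place_E v) \<and> s \<in> Domain (place_E v) \<and> s \<noteq> 0}"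
  note spec = local_specialization_imp[OF local_place_E[OF v]]
  obtain j where j: "v $ j \<noteq> 0" using mem_E_nonzero[OF v] by (auto simp: vec_eq_iff)
  let ?g = "eval_hom \<iota> (Var j ^ dF) generic_E"
  have gnz: "?g \<noteq> 0"
    using generic_E_nonzero[OF v j] by (simp add: eval_hom_power eval_hom_Var)
  have dom: "eval_hom \<iota> (F $ i) generic_E / ?g \<in> Domain (place_E v)" for i
    using place_EI[OF F_forms[of i] homogeneous_of_degree_Var_power[of dF j], of v] j
    by (auto simp: eval_mpoly_simps)
  have quot: "eval_hom \<iota> (F $ i) generic_E / eval_hom \<iota> (F $ 3) generic_E \<in> ?L" for i
  proof -
    have "eval_hom \<iota> (F $ i) generic_E / eval_hom \<iota> (F $ 3) generic_E =
        (eval_hom \<iota> (F $ i) generic_E / ?g) / (eval_hom \<iota> (F $ 3) generic_E / ?g)"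
      using gnz by simp
    moreover have "eval_hom \<iota> (F $ 3) generic_E / ?g \<noteq> 0" using gnz generic_inverse_E(1) by simp
    ultimately show ?thesis using dom by blast
  qed
  have "x \<in> ?L" by (subst generic_inverse_E(2)) (rule quot)
  moreover have "y \<in> ?L" by (subst generic_inverse_E(3)) (rule quot)
  ultimately have "function_field \<subseteq> ?L"
    by (rule function_field_least[OF intermediate_fractions[OF spec]])
  then show ?thesis using w by blast
qed

end

locale nonsingular_model = birational_model \<iota> x y f F G E dF dG
  for \<iota> :: "'k::alg_closed_field \<Rightarrow> 'o::field" and x y f
    and F :: "('n::finite, 'k) mpoly ^ 3" and G :: "(3, 'k) mpoly ^ 'n" and E :: "('k ^ 'n) set set"
    and dF dG :: nat +
  assumes nonsingular_E: "nonsingular E" and dim_E: "proj_dim E = 1"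
begin

text \<open>The Jacobian criterion says that the gradients span a space of codimension two. By Euler's
  identity they are orthogonal to \<open>q\<close>.\<close>

lemma gradient_span:
  fixes q :: "'k ^ 'n"
  assumes q: "proj_point q \<in> E" "q $ i0 \<noteq> 0"
  obtains j where "\<And>g. \<exists>c. g - c *s axis j 1 \<in>
    vec.span (insert (axis i0 1) ((\<lambda>p. gradient p q) ` homogeneous_ideal E))"
proof (rule exists_axis_complement[of "(\<lambda>p. gradient p q) ` homogeneous_ideal E" q i0])
  have "enat (vec.dim ((\<lambda>p. gradient p q) ` homogeneous_ideal E)) + 1 + 1 = enat CARD('n)"
    using nonsingular_E q(1) dim_E unfolding nonsingular_def by metis
  then show "vec.dim ((\<lambda>p. gradient p q) ` homogeneous_ideal E) + 2 = CARD('n)"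
    by (simp add: one_enat_def)
  show "q $ i0 \<noteq> 0" by fact
  fix d assume "d \<in> (\<lambda>p. gradient p q) ` homogeneous_ideal E"
  then obtain p where p: "p \<in> homogeneous_ideal E" "d = gradient p q" by blast
  have "eval_mpoly p q = 0 \<and> (\<Sum>k\<in>UNIV. gradient p q $ k * q $ k) = 0"
    using p(1) unfolding homogeneous_ideal_def
  proof (rule ideal_property)
    show "eval_mpoly 0 q = 0 \<and> (\<Sum>k\<in>UNIV. gradient (0 :: ('n, 'k) mpoly) q $ k * q $ k) = 0"
      by (simp add: eval_mpoly_simps gradient_nth eval_partial_mpoly_0)
    fix r s p :: "('n, 'k) mpoly"
    assume s: "s \<in> {p. homogeneous p \<and> (\<forall>v. proj_point v \<in> E \<longrightarrow> eval_mpoly p v = 0)}"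
      and p: "eval_mpoly p q = 0 \<and> (\<Sum>k\<in>UNIV. gradient p q $ k * q $ k) = 0"
    from s q have s0: "eval_mpoly s q = 0" by blast
    from s obtain e where "homogeneous_of_degree e s" unfolding homogeneous_def by blast
    from euler_homogeneous[OF this, of q] have "(\<Sum>k\<in>UNIV. gradient s q $ k * q $ k) = 0"
      using s0 by simp
    then have "(\<Sum>k\<in>UNIV. eval_mpoly r q * (gradient s q $ k * q $ k)) = 0"
      by (simp flip: sum_distrib_left)
    moreover have "gradient (r * s + p) q $ k * q $ k =
        eval_mpoly r q * (gradient s q $ k * q $ k) + gradient p q $ k * q $ k" for k
      unfolding gradient_nth eval_partial_mpoly_add eval_partial_mpoly_mult s0
      by (simp add: algebra_simps)
    ultimately have "(\<Sum>k\<in>UNIV. gradient (r * s + p) q $ k * q $ k) = 0"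
      using p by (simp add: sum.distrib)
    then show "eval_mpoly (r * s + p) q = 0 \<and> (\<Sum>k\<in>UNIV. gradient (r * s + p) q $ k * q $ k) = 0"
      using p s0 by (simp add: eval_mpoly_simps)
  qed
  then show "(\<Sum>k\<in>UNIV. d $ k * q $ k) = 0" unfolding p(2) ..
qed (use that in blast)

text \<open>In the chart where the coordinate \<open>i0\<close> is 1, the increments \<open>z $ i\<close> of the coordinates
  generate the maximal ideal. The gradients of the ideal of \<open>E\<close> are the coefficients of linear
  relations between them modulo its square. By \<open>gradient_span\<close> there are so many of these that
  every \<open>z $ i\<close> is a multiple of one \<open>z $ j\<close> modulo the square, and hence, by Nakayama's lemma, a
  multiple of \<open>z $ j\<close>.\<close>

theorem place_E:
  fixes v :: "'k ^ 'n"
  assumes v: "proj_point v \<in> E"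
  shows "place function_field (place_E v)"
proof -
  let ?H = "place_E v"
  note H = local_place_E[OF v]
  note spec = local_specialization_imp[OF H]
  obtain i0 where i0: "v $ i0 \<noteq> 0" using mem_E_nonzero[OF v] by (auto simp: vec_eq_iff)
  note g0 = generic_E_nonzero[OF v i0]
  define q where "q = (\<chi> i. v $ i / v $ i0)"
  define w where "w = (\<chi> i. generic_E $ i / generic_E $ i0)"
  define z where "z = (\<chi> i. w $ i - \<iota> (q $ i))"
  have q0: "q $ i0 = 1" using i0 by (simp add: q_def)
  have v_q: "v = v $ i0 *s q" using i0 by (simp add: q_def vec_eq_iff)
  have q_E: "proj_point q \<in> E"
  proof -
    have "proj_point q = proj_point v" unfolding proj_point_eq_iff using v_q i0 by blast
    then show ?thesis using v by simp
  qed
  have wq: "(w $ i, q $ i) \<in> ?H" for i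
    using coordinate_place_E[OF i0] by (simp add: w_def q_def)
  have z_nth: "z $ i = w $ i - \<iota> (q $ i)" for i by (simp add: z_def)
  have z0: "z $ i0 = 0" using g0 q0 by (simp add: z_nth w_def)
  have z_max: "(z $ i, 0) \<in> ?H" for i
    using specialization_diff[OF spec wq[of i] specialization_const[OF spec, of "q $ i"]] by (simp add: z_nth)
  note expand = taylor[OF spec wq z_nth]
  have eval_v: "eval_mpoly p v = v $ i0 ^ d * eval_mpoly p q" if "homogeneous_of_degree d p" for p :: "('n, 'k) mpoly" and d
    using eval_mpoly_scale[OF that, of "v $ i0" q] v_q by simp
  have eval_w: "eval_hom \<iota> p generic_E = generic_E $ i0 ^ d * eval_hom \<iota> p w" if "homogeneous_of_degree d p" for p :: "('n, 'k) mpoly" and d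
    using eval_generic_scale[OF that g0] by (simp add: w_def)
  have ideal: "eval_hom \<iota> p w = 0 \<and> eval_mpoly p q = 0" if "p \<in> homogeneous_ideal E" for p
    using that unfolding homogeneous_ideal_def
  proof (rule ideal_property)
    show "eval_hom \<iota> 0 w = 0 \<and> eval_mpoly 0 q = 0" by (simp add: eval_hom_0 eval_mpoly_simps)
    fix r s p :: "('n, 'k) mpoly"
    assume s: "s \<in> {p. homogeneous p \<and> (\<forall>v. proj_point v \<in> E \<longrightarrow> eval_mpoly p v = 0)}"
      and p: "eval_hom \<iota> p w = 0 \<and> eval_mpoly p q = 0"
    from s q_E have s0: "eval_mpoly s q = 0" by blast
    from s obtain e where e: "homogeneous_of_degree e s" unfolding homogeneous_def by blast
    have "eval_hom \<iota> s generic_E = 0" using generic_vanishing_iff[of s] s by blast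
    then have "eval_hom \<iota> s w = 0" using eval_w[OF e] g0 by simp
    then show "eval_hom \<iota> (r * s + p) w = 0 \<and> eval_mpoly (r * s + p) q = 0"
      using p s0 by (simp add: eval_hom_add eval_hom_mult eval_mpoly_simps)
  qed
  \<comment> \<open>The relations between the \<open>z $ i\<close> modulo the square of the maximal ideal form a subspace, so
    it is enough to find them for a spanning set.\<close>
  define W where "W = {g :: 'k ^ 'n. (\<Sum>i\<in>UNIV. \<iota> (g $ i) * z $ i) \<in> second_order ?H z}"
  have W: "vec.subspace W"
    unfolding vec.subspace_def
  proof (intro conjI ballI allI)
    show "0 \<in> W"
      unfolding W_def mem_Collect_eq
      using specialization_0[OF spec] by (intro second_orderI[of _ "\<lambda>_. 0"]) simp_all
    fix g assume "g \<in> W"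
    then obtain m where m: "(\<Sum>i\<in>UNIV. \<iota> (g $ i) * z $ i) = (\<Sum>i\<in>UNIV. m i * z $ i)" "\<forall>i. (m i, 0) \<in> ?H"
      unfolding W_def second_order_def by blast
    show "c *s g \<in> W" for c
      unfolding W_def mem_Collect_eq
    proof (rule second_orderI)
      have "(\<Sum>i\<in>UNIV. \<iota> ((c *s g) $ i) * z $ i) = \<iota> c * (\<Sum>i\<in>UNIV. \<iota> (g $ i) * z $ i)"
        by (simp add: hom_mult sum_distrib_left mult.assoc del: scale.scale_scale)
      then show "(\<Sum>i\<in>UNIV. \<iota> ((c *s g) $ i) * z $ i) = (\<Sum>i\<in>UNIV. (\<iota> c * m i) * z $ i)"
        unfolding m(1) by (simp add: sum_distrib_left mult.assoc del: scale.scale_scale)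
      show "(\<iota> c * m i, 0) \<in> ?H" for i
        using specialization_mult[OF spec specialization_const[OF spec, of c], of "m i" 0] m by simp
    qed
    fix g' assume "g' \<in> W"
    then obtain m' where m': "(\<Sum>i\<in>UNIV. \<iota> (g' $ i) * z $ i) = (\<Sum>i\<in>UNIV. m' i * z $ i)" "\<forall>i. (m' i, 0) \<in> ?H"
      unfolding W_def second_order_def by blast
    show "g + g' \<in> W"
      unfolding W_def mem_Collect_eq
    proof (rule second_orderI)
      have "(\<Sum>i\<in>UNIV. \<iota> ((g + g') $ i) * z $ i) = (\<Sum>i\<in>UNIV. \<iota> (g $ i) * z $ i) + (\<Sum>i\<in>UNIV. \<iota> (g' $ i) * z $ i)"
        by (simp add: hom_add sum.distrib distrib_right)
      then show "(\<Sum>i\<in>UNIV. \<iota> ((g + g') $ i) * z $ i) = (\<Sum>i\<in>UNIV. (m i + m' i) * z $ i)"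
        unfolding m(1) m'(1) by (simp add: sum.distrib distrib_right)
      show "(m i + m' i, 0) \<in> ?H" for i
        using specialization_add[OF spec, of "m i" 0 "m' i" 0] m m' by simp
    qed
  qed
  have "axis i0 1 \<in> W"
  proof -
    have "(\<Sum>i\<in>UNIV. \<iota> (axis i0 1 $ i) * z $ i) = 0"
      using z0 by (intro sum.neutral) (auto simp: axis_def)
    then show ?thesis using vec.subspace_0[OF W] unfolding W_def by simp
  qed
  moreover have "(\<lambda>p. gradient p q) ` homogeneous_ideal E \<subseteq> W"
  proof safe
    fix p assume p: "p \<in> homogeneous_ideal E"
    have "- (\<Sum>i\<in>UNIV. \<iota> (gradient p q $ i) * z $ i) \<in> second_order ?H z"
      using expand[of p] ideal[OF p] by simp
    then have "- gradient p q \<in> W"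
      unfolding W_def by (simp add: hom_uminus sum_negf)
    then show "gradient p q \<in> W" using vec.subspace_neg[OF W] by fastforce
  qed
  ultimately have span_W: "vec.span (insert (axis i0 1) ((\<lambda>p. gradient p q) ` homogeneous_ideal E)) \<subseteq> W"
    by (intro vec.span_minimal W) simp
  obtain j where j: "\<And>g. \<exists>c. g - c *s axis j 1 \<in>
      vec.span (insert (axis i0 1) ((\<lambda>p. gradient p q) ` homogeneous_ideal E))"
    using gradient_span[OF q_E, of i0] q0 by auto
  let ?t = "z $ j"
  have axis_sum: "(\<Sum>k\<in>UNIV. \<iota> (axis i 1 $ k) * z $ k) = z $ i" for i
    by (subst sum.remove[of UNIV i]) (auto simp: axis_def intro!: sum.neutral)
  have relation: "\<exists>s m. s \<in> Domain ?H \<and> (\<forall>k\<in>UNIV. (m k, 0) \<in> ?H) \<and> z $ i = ?t * s + (\<Sum>k\<in>UNIV. m k * z $ k)" for i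
  proof -
    from j[of "axis i 1"] span_W obtain c where "axis i 1 - c *s axis j 1 \<in> W" by blast
    then obtain m where m: "(\<Sum>k\<in>UNIV. \<iota> ((axis i 1 - c *s axis j 1) $ k) * z $ k) = (\<Sum>k\<in>UNIV. m k * z $ k)"
      "\<forall>k. (m k, 0) \<in> ?H"
      unfolding W_def second_order_def by blast
    have "(\<Sum>k\<in>UNIV. \<iota> ((axis i 1 - c *s axis j 1) $ k) * z $ k) =
        (\<Sum>k\<in>UNIV. \<iota> (axis i 1 $ k) * z $ k) - \<iota> c * (\<Sum>k\<in>UNIV. \<iota> (axis j 1 $ k) * z $ k)"
      by (simp add: hom_minus hom_mult left_diff_distrib sum_subtractf sum_distrib_left mult.assoc
          del: scale.scale_scale)
    then have "z $ i - \<iota> c * ?t = (\<Sum>k\<in>UNIV. m k * z $ k)" unfolding m(1) axis_sum by simp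
    then have "z $ i = ?t * \<iota> c + (\<Sum>k\<in>UNIV. m k * z $ k)" by (metis diff_eq_eq add.commute mult.commute)
    moreover have "\<iota> c \<in> Domain ?H" using specialization_const[OF spec] by blast
    ultimately show ?thesis using m(2) by (intro exI[of _ "\<iota> c"] exI[of _ m]) simp
  qed
  have "\<forall>i\<in>UNIV. \<exists>s\<in>Domain ?H. z $ i = ?t * s"
    by (rule nakayama[OF H finite relation])
  then have z_multiple: "\<exists>s\<in>Domain ?H. z $ i = ?t * s" for i by blast
  show ?thesis
  proof (rule place_of_uniformizer[OF H Domain_place_E z_max])
    \<comment> \<open>If \<open>z $ j\<close> were 0, all quotients of coordinates of the generic point would be constant, and
      so would \<open>x\<close>.\<close>
    show t0: "?t \<noteq> 0"
    proof
      assume "?t = 0"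
      then have "z $ i = 0" for i using z_multiple[of i] by auto
      then have w_const: "w = (\<chi> i. \<iota> (q $ i))" by (simp add: z_nth vec_eq_iff)
      have const: "eval_hom \<iota> p w \<in> range \<iota>" for p
        unfolding w_const by (metis hom_eval_mpoly rangeI)
      obtain a where a: "eval_hom \<iota> (F $ 1) w = \<iota> a" using const by blast
      obtain b where b: "eval_hom \<iota> (F $ 3) w = \<iota> b" using const by blast
      have "x = \<iota> a / \<iota> b"
        using generic_inverse_E(2) g0 unfolding eval_w[OF F_forms] a b by simp
      then have "x = \<iota> (a / b)" by (simp add: hom_div)
      then have "eval_x [:- (a / b), 1:] = 0" unfolding eval_x_simps by (simp add: hom_uminus)
      then show False unfolding eval_x_eq_0_iff by simp
    qed
    show "algebraically_dependent ?t p" if "p \<in> function_field" for p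
      using that z_max Domain_place_E by (intro function_field_algebraically_dependent) blast+
    show "\<exists>r s. r \<in> Domain ?H \<and> s \<in> Domain ?H \<and> s \<noteq> 0 \<and> w = r / s" if "w \<in> function_field" for w
      by (rule place_E_fractions[OF v that])
    fix u assume "(u, 0) \<in> ?H"
    then obtain p r d where *: "homogeneous_of_degree d p" "homogeneous_of_degree d r" "eval_mpoly r v \<noteq> 0"
      "u = eval_hom \<iota> p generic_E / eval_hom \<iota> r generic_E" "0 = eval_mpoly p v / eval_mpoly r v"
      by (elim place_EE)
    then have p0: "eval_mpoly p q = 0" using eval_v[OF *(1)] i0 by simp
    have r0: "eval_mpoly r q \<noteq> 0" using eval_v[OF *(2)] *(3) by auto
    obtain m where m: "\<forall>i. (m i, 0) \<in> ?H"
      "eval_hom \<iota> p w - \<iota> (eval_mpoly p q) - (\<Sum>i\<in>UNIV. \<iota> (gradient p q $ i) * z $ i) = (\<Sum>i\<in>UNIV. m i * z $ i)"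
      using expand[of p] unfolding second_order_def by blast
    then have "eval_hom \<iota> p w = (\<Sum>i\<in>UNIV. \<iota> (gradient p q $ i) * z $ i) + (\<Sum>i\<in>UNIV. m i * z $ i)"
      using p0 by (simp add: diff_eq_eq add.commute)
    then have pw: "eval_hom \<iota> p w = (\<Sum>i\<in>UNIV. (\<iota> (gradient p q $ i) + m i) * z $ i)"
      by (simp add: sum.distrib distrib_right)
    have "\<forall>i. \<exists>s b. (s, b) \<in> ?H \<and> z $ i = ?t * s" using z_multiple by blast
    then obtain s b where s: "\<And>i. (s i, b i) \<in> ?H" "\<And>i. z $ i = ?t * s i" by metis
    have "eval_hom \<iota> p w = ?t * (\<Sum>i\<in>UNIV. (\<iota> (gradient p q $ i) + m i) * s i)"
      unfolding pw sum_distrib_left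
      by (rule sum.cong[OF refl]) (subst s(2), simp only: mult.left_commute)
    moreover have "u = eval_hom \<iota> p w / eval_hom \<iota> r w"
      unfolding *(4) eval_w[OF *(1)] eval_w[OF *(2)] using g0 by simp
    ultimately have "u / ?t = (\<Sum>i\<in>UNIV. (\<iota> (gradient p q $ i) + m i) * s i) / eval_hom \<iota> r w"
      using t0 by simp
    moreover have "((\<Sum>i\<in>UNIV. (\<iota> (gradient p q $ i) + m i) * s i) / eval_hom \<iota> r w,
        (\<Sum>i\<in>UNIV. (gradient p q $ i + 0) * b i) / eval_mpoly r q) \<in> ?H"
      using m(1) s(1)
      by (intro local_specialization_divide[OF H] specialization_sum[OF spec] specialization_mult[OF spec]
          specialization_add[OF spec] specialization_const[OF spec] specialization_eval_hom[OF spec] wq r0) auto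
    ultimately show "u / ?t \<in> Domain ?H" by auto
  qed
qed

subsection \<open>Every place has a centre\<close>

text \<open>The ideals of a valuation ring form a chain.\<close>

lemma exists_maximal_coordinate:
  assumes H: "place function_field H" and "finite A" and "\<exists>j\<in>A. generic_E $ j \<noteq> 0"
  shows "\<exists>j\<in>A. generic_E $ j \<noteq> 0 \<and> (\<forall>i\<in>A. generic_E $ i / generic_E $ j \<in> Domain H)"
  using assms(2,3)
proof (induction A rule: finite_induct)
  case (insert a A)
  have spec: "specialization H" using H unfolding place_def local_specialization_def by blast
  have one: "1 \<in> Domain H" and zero: "0 \<in> Domain H"
    using specialization_1[OF spec] specialization_0[OF spec] by blast+
  have mult: "u * u' \<in> Domain H" if "u \<in> Domain H" "u' \<in> Domain H" for u u'
    using that specialization_mult[OF spec] by blast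
  show ?case
  proof (cases "\<exists>j\<in>A. generic_E $ j \<noteq> 0")
    case False
    then have "generic_E $ a \<noteq> 0" "\<forall>i\<in>A. generic_E $ i = 0" using insert.prems by auto
    then show ?thesis using one zero by (intro bexI[of _ a]) auto
  next
    case True
    then obtain j where j: "j \<in> A" "generic_E $ j \<noteq> 0" "\<forall>i\<in>A. generic_E $ i / generic_E $ j \<in> Domain H"
      using insert.IH by blast
    show ?thesis
    proof (cases "generic_E $ a / generic_E $ j \<in> Domain H")
      case True
      then show ?thesis using j by (intro bexI[of _ j]) auto
    next
      case False
      have "generic_E $ a / generic_E $ j \<in> function_field"
        using intermediate_divide[OF intermediate_function_field generic_E_in_function_field generic_E_in_function_field] .
      then have "(1 / (generic_E $ a / generic_E $ j), 0) \<in> H" using H False unfolding place_def by blast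
      then have ja: "generic_E $ j / generic_E $ a \<in> Domain H" by auto
      have a: "generic_E $ a \<noteq> 0" using False zero by auto
      have "generic_E $ i / generic_E $ a \<in> Domain H" if i: "i \<in> A" for i
      proof -
        have "generic_E $ i / generic_E $ a = (generic_E $ i / generic_E $ j) * (generic_E $ j / generic_E $ a)"
          using j(2) by simp
        also have "\<dots> \<in> Domain H" using j(3) i by (intro mult ja) blast
        finally show ?thesis .
      qed
      then show ?thesis using a one by (intro bexI[of _ a]) auto
    qed
  qed
qed simp

text \<open>Divide the coordinates of the generic point by one of largest absolute value with respect to
  the place. The quotients have values, and these are the coordinates of the centre. It lies on
  \<open>E\<close> because the forms that vanish on \<open>E\<close> vanish at the generic point.\<close>

theorem exists_centre:
  assumes H: "place function_field H"
  obtains v where "proj_point v \<in> E" "H = place_E v"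
proof -
  have loc: "local_specialization H" and dom: "Domain H \<subseteq> function_field" using H unfolding place_def by blast+
  note spec = local_specialization_imp[OF loc]
  obtain P where "P \<in> E" using irreducible_E unfolding proj_irreducible_def by blast
  then obtain v' where v': "proj_point v' \<in> E" using mem_E_proj_point by blast
  then obtain j' where "v' $ j' \<noteq> 0" using mem_E_nonzero by (metis vec_eq_iff zero_index)
  then have "\<exists>j\<in>UNIV. generic_E $ j \<noteq> 0" using generic_E_nonzero[OF v'] by blast
  then have "\<exists>j\<in>UNIV. generic_E $ j \<noteq> 0 \<and> (\<forall>i\<in>UNIV. generic_E $ i / generic_E $ j \<in> Domain H)"
    by (rule exists_maximal_coordinate[OF H finite])
  then obtain j where j: "generic_E $ j \<noteq> 0" "\<forall>i\<in>UNIV. generic_E $ i / generic_E $ j \<in> Domain H" by blast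
  from j(2) have "\<forall>i. \<exists>a. (generic_E $ i / generic_E $ j, a) \<in> H" by auto
  from choice[OF this] obtain a where a: "\<And>i. (generic_E $ i / generic_E $ j, a i) \<in> H" by blast
  define v where "v = (\<chi> i. a i)"
  have vj: "v $ j = 1"
    using a[of j] specialization_unique[OF spec _ specialization_1[OF spec]] j by (simp add: v_def)
  from closed_E obtain S where S: "\<And>p. p \<in> S \<Longrightarrow> homogeneous p" "E = proj_zeros S"
    unfolding proj_closed_def by blast
  have "eval_mpoly p v = 0" if p: "p \<in> S" for p
  proof -
    obtain d where d: "homogeneous_of_degree d p" using S(1)[OF p] unfolding homogeneous_def by blast
    have "\<forall>v. proj_point v \<in> E \<longrightarrow> eval_mpoly p v = 0"
      using S p proj_point_mem_zeros[of S] by blast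
    then have "eval_hom \<iota> p generic_E = 0" using generic_vanishing_iff[OF S(1)[OF p]] by blast
    then have "eval_hom \<iota> p (\<chi> i. generic_E $ i / generic_E $ j) = 0"
      using eval_generic_scale[OF d j(1)] j(1) by simp
    moreover have "(eval_hom \<iota> p (\<chi> i. generic_E $ i / generic_E $ j), eval_mpoly p v) \<in> H"
      by (rule specialization_eval_hom[OF spec]) (simp add: v_def a)
    ultimately show ?thesis using specialization_zero[OF spec] by simp
  qed
  moreover have "v \<noteq> 0" using vj by auto
  ultimately have vE: "proj_point v \<in> E" using S proj_point_mem_zeros[of S v] by blast
  have "place_E v \<subseteq> H"
    by (rule place_E_least[OF loc _ j(1)]) (simp_all add: vj, simp add: v_def a)
  then have "place_E v = H" by (rule place_maximal[OF place_E[OF vE] loc _ dom])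
  then show ?thesis using that vE by blast
qed

text \<open>The place determines the values of the quotients of coordinates.\<close>

lemma place_E_inject:
  assumes v: "proj_point v \<in> E" and w: "proj_point w \<in> E" and eq: "place_E v = place_E w"
  shows "proj_point v = proj_point w"
proof -
  note spec = local_specialization_imp[OF local_place_E[OF v]]
  obtain j where j: "v $ j \<noteq> 0" using mem_E_nonzero[OF v] by (metis vec_eq_iff zero_index)
  obtain k where k: "w $ k \<noteq> 0" using mem_E_nonzero[OF w] by (metis vec_eq_iff zero_index)
  note gj = generic_E_nonzero[OF v j] and gk = generic_E_nonzero[OF w k]
  have wk: "(generic_E $ i / generic_E $ k, w $ i / w $ k) \<in> place_E v" for i
    using coordinate_place_E[OF k] eq by simp
  have vj: "(generic_E $ i / generic_E $ j, v $ i / v $ j) \<in> place_E v" for i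
    using coordinate_place_E[OF j] .
  have "(generic_E $ i / generic_E $ j, (w $ i / w $ k) * (v $ k / v $ j)) \<in> place_E v" for i
    using specialization_mult[OF spec wk[of i] vj[of k]] gk by simp
  then have rel: "v $ i / v $ j = (w $ i / w $ k) * (v $ k / v $ j)" for i
    using specialization_unique[OF spec vj] by blast
  have "v $ i = (v $ k / w $ k) * w $ i" for i
  proof -
    have "v $ i = v $ i / v $ j * v $ j" using j by simp
    also have "\<dots> = (w $ i / w $ k) * (v $ k / v $ j) * v $ j" by (simp only: rel[of i])
    also have "\<dots> = (v $ k / w $ k) * w $ i" using j by simp
    finally show ?thesis .
  qed
  then have v_eq: "v = (v $ k / w $ k) *s w" unfolding vec_eq_iff vector_smult_component by blast
  have "v $ k \<noteq> 0"
  proof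
    assume "v $ k = 0"
    then show False using rel[of j] j by simp
  qed
  then have "v $ k / w $ k \<noteq> 0" using k by simp
  then have "proj_point w = proj_point v" unfolding proj_point_eq_iff using v_eq by blast
  then show ?thesis ..
qed

end


section \<open>The places of the quartic double cover\<close>

lemma (in field_hom) poly_map_poly_quartic:
  "poly (map_poly hom [:a0, a1, a2, a3, a4:]) w =
    hom a0 + w * (hom a1 + w * (hom a2 + w * (hom a3 + w * hom a4)))"
  by (simp add: map_poly_pCons_hom)

text \<open>As \<open>y\<close> is integral over the polynomials in \<open>x\<close>, it has a value where \<open>x\<close> has one.\<close>

lemma (in double_cover) place_over_point:
  assumes H: "place function_field H" and x: "(x, \<alpha>) \<in> H"
  shows "\<exists>\<beta>. \<beta> ^ 2 = poly f \<alpha> \<and> H = place_at \<alpha> \<beta>"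
proof -
  have loc: "local_specialization H" and dom: "Domain H \<subseteq> function_field" using H unfolding place_def by blast+
  note spec = local_specialization_imp[OF loc]
  have fx: "(y ^ 2, poly f \<alpha>) \<in> H" unfolding y_square by (rule specialization_poly[OF spec x])
  have y0: "y \<noteq> 0" using regular_eq_0[of 0 1] by (auto simp: regular_def eval_x_simps)
  have "y \<in> Domain H"
  proof (rule ccontr)
    assume "y \<notin> Domain H"
    then have "(1 / y, 0) \<in> H" using H y_in_function_field unfolding place_def by blast
    then have "(y ^ 2 * ((1 / y) * (1 / y)), poly f \<alpha> * (0 * 0)) \<in> H"
      by (intro specialization_mult[OF spec] fx)
    then have "(1, 0) \<in> H" using y0 by (simp add: power2_eq_square)
    then show False using specialization_unique[OF spec specialization_1[OF spec]] by fastforce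
  qed
  then obtain \<beta> where y: "(y, \<beta>) \<in> H" by blast
  have \<beta>: "\<beta> ^ 2 = poly f \<alpha>"
    by (rule specialization_unique[OF spec specialization_power[OF spec y] fx])
  have "place_at \<alpha> \<beta> = H"
    by (rule place_maximal[OF place_at[OF \<beta>] loc place_at_least[OF \<beta> loc x y] dom])
  then show ?thesis using \<beta> by blast
qed

context double_cover
begin

lemma x_place_at: "\<beta> ^ 2 = poly f \<alpha> \<Longrightarrow> (x, \<alpha>) \<in> place_at \<alpha> \<beta>"
  using regular_place_at[of \<beta> \<alpha> "[:0, 1:]" 0] by (simp add: regular_def eval_x_simps)

lemma y_place_at: "\<beta> ^ 2 = poly f \<alpha> \<Longrightarrow> (y, \<beta>) \<in> place_at \<alpha> \<beta>"
  using regular_place_at[of \<beta> \<alpha> 0 1] by (simp add: regular_def eval_x_simps)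

lemma place_at_eqI:
  assumes "\<beta> ^ 2 = poly f \<alpha>" "place function_field H" "(x, \<alpha>) \<in> H" "(y, \<beta>) \<in> H"
  shows "place_at \<alpha> \<beta> = H"
  using place_maximal[OF place_at[OF assms(1)] _ place_at_least[OF assms(1)]] assms
  unfolding place_def by blast

lemma place_at_inject:
  assumes "\<beta> ^ 2 = poly f \<alpha>" "\<beta>' ^ 2 = poly f \<alpha>'" "place_at \<alpha> \<beta> = place_at \<alpha>' \<beta>'"
  shows "\<alpha> = \<alpha>' \<and> \<beta> = \<beta>'"
proof -
  note spec = local_specialization_imp[OF local_place_at[OF assms(1)]]
  show ?thesis
    using specialization_unique[OF spec x_place_at[OF assms(1)]] x_place_at[OF assms(2)]
      specialization_unique[OF spec y_place_at[OF assms(1)]] y_place_at[OF assms(2)] assms(3) by simp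
qed

lemma x_not_constant: "x \<noteq> \<iota> a"
proof
  assume "x = \<iota> a"
  then have "eval_x [:- a, 1:] = 0" unfolding eval_x_simps by (simp add: hom_uminus)
  then show False unfolding eval_x_eq_0_iff by simp
qed

end

context double_cover_alg_closed
begin

text \<open>Split off linear factors one by one.\<close>

lemma algebraic_in_range:
  assumes "poly (map_poly \<iota> a) w = 0" "a \<noteq> 0"
  shows "w \<in> range \<iota>"
  using assms
proof (induction "Polynomial.degree a" arbitrary: a)
  case 0
  then obtain b where "a = [:b:]" by (metis degree_eq_zeroE)
  then show ?case using 0 by (simp add: map_poly_pCons)
next
  case (Suc n)
  then obtain r where "poly a r = 0" using alg_closed_imp_poly_has_root[of a] by auto
  then obtain a' where a': "a = [:- r, 1:] * a'" by (metis dvdE poly_eq_0_iff_dvd)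
  then have nz: "a' \<noteq> 0" using Suc by auto
  interpret map: map_poly_inj_idom_hom \<iota> ..
  have "poly (map_poly \<iota> a) w = (w - \<iota> r) * poly (map_poly \<iota> a') w"
    unfolding a' map.hom_mult poly_mult by (simp add: map_poly_pCons hom_uminus)
  then consider "w = \<iota> r" | "poly (map_poly \<iota> a') w = 0" using Suc by auto
  then show ?case
  proof cases
    case 2
    have "Polynomial.degree a = Suc (Polynomial.degree a')"
      using nz unfolding a' by (subst degree_mult_eq) auto
    then show ?thesis using Suc(1)[of a'] Suc(2) 2 nz by simp
  qed simp
qed

lemma transcendental_inverse:
  assumes "poly (map_poly \<iota> a) (1 / x) = 0"
  shows "a = 0"
proof (rule ccontr)
  assume "a \<noteq> 0"
  then obtain b where "1 / x = \<iota> b" using algebraic_in_range[OF assms] by blast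
  then have "x = \<iota> (1 / b)" by (metis hom_div hom_one div_by_1 divide_divide_eq_right mult_1)
  then show False using x_not_constant by blast
qed

lemma transcendental_power:
  assumes "poly (map_poly \<iota> a) (x ^ n) = 0" "n > 0"
  shows "a = 0"
proof (rule ccontr)
  assume "a \<noteq> 0"
  then obtain b where "x ^ n = \<iota> b" using algebraic_in_range[OF assms(1)] by blast
  then have "eval_x ([:0, 1:] ^ n - [:b:]) = 0" unfolding eval_x_simps by simp
  then have eq: "[:0, 1:] ^ n = [:b:]" unfolding eval_x_eq_0_iff by simp
  show False using degree_linear_power[of "0 :: 'k" n, unfolded eq] assms(2) by simp
qed

end

locale quartic_cover = double_cover_alg_closed \<iota> x y "[:c, 0, - (1 + c), 0, 1:]"
  for \<iota> :: "'k::alg_closed_field \<Rightarrow> 'o::field" and x y c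
begin

lemma quartic: "poly [:c, 0, - (1 + c), 0, 1:] \<alpha> = (\<alpha> ^ 2 - 1) * (\<alpha> ^ 2 - c)"
  by (simp add: algebra_simps power2_eq_square)

lemma c_not_1: "c \<noteq> 1"
  using simple_roots[of 1] by (auto simp: pderiv_pCons)

lemma x_nonzero: "x \<noteq> 0"
  using x_not_constant[of 0] by simp

text \<open>In the coordinates \<open>1 / x\<close> and \<open>y / x\<^sup>2\<close> the points at infinity of \<open>Y\<^sup>2 = (X\<^sup>2 - 1) (X\<^sup>2 -
  c)\<close> become the points \<open>(0, 1)\<close> and \<open>(0, - 1)\<close> of a curve of the same shape.\<close>

sublocale inf: double_cover_alg_closed \<iota> "1 / x" "y / x ^ 2" "[:1, 0, - (1 + c), 0, c:]"
proof
  show "a = 0" if "poly (map_poly \<iota> a) (1 / x) = 0" for a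
    by (rule transcendental_inverse[OF that])
  have "y ^ 2 = \<iota> c + x ^ 2 * (\<iota> (- (1 + c)) + x ^ 2)"
    unfolding y_square poly_map_poly_quartic by (simp add: power2_eq_square algebra_simps)
  then have "(y / x ^ 2) ^ 2 = (\<iota> c + x ^ 2 * (\<iota> (- (1 + c)) + x ^ 2)) / x ^ 4"
    by (simp add: power_divide)
  also have "\<dots> = 1 + (1 / x) ^ 2 * (\<iota> (- (1 + c)) + (1 / x) ^ 2 * \<iota> c)"
    using x_nonzero by (simp add: field_simps power_numeral_reduce)
  also have "\<dots> = poly (map_poly \<iota> [:1, 0, - (1 + c), 0, c:]) (1 / x)"
    unfolding poly_map_poly_quartic by (simp add: power2_eq_square mult.assoc)
  finally show "(y / x ^ 2) ^ 2 = poly (map_poly \<iota> [:1, 0, - (1 + c), 0, c:]) (1 / x)" .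
  show "\<exists>\<alpha>. poly [:1, 0, - (1 + c), 0, c:] \<alpha> = 0"
    by (rule exI[of _ 1]) simp
  show "(2 :: 'k) \<noteq> 0" by (rule two_nonzero)
  fix \<alpha> assume "poly [:1, 0, - (1 + c), 0, c:] \<alpha> = 0"
  then have root: "(1 - \<alpha> ^ 2) * (1 - c * \<alpha> ^ 2) = 0"
    by (simp add: algebra_simps power2_eq_square)
  have deriv: "poly (pderiv [:1, 0, - (1 + c), 0, c:]) \<alpha> = - (2 * \<alpha> * ((1 - c * \<alpha> ^ 2) + c * (1 - \<alpha> ^ 2)))"
    by (simp add: pderiv_pCons algebra_simps power2_eq_square)
  have \<alpha>: "\<alpha> \<noteq> 0" using root by auto
  from root consider "\<alpha> ^ 2 = 1" | "c * \<alpha> ^ 2 = 1" by auto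
  then have "(1 - c * \<alpha> ^ 2) + c * (1 - \<alpha> ^ 2) \<noteq> 0"
  proof cases
    case 1
    then show ?thesis using c_not_1 by simp
  next
    case 2
    then show ?thesis using c_not_1 by (simp add: right_diff_distrib)
  qed
  then show "poly (pderiv [:1, 0, - (1 + c), 0, c:]) \<alpha> \<noteq> 0"
    unfolding deriv using \<alpha> two_nonzero by simp
qed

lemma function_field_inf: "inf.function_field = function_field"
proof
  note I = intermediate_function_field and I' = inf.intermediate_function_field
  show "inf.function_field \<subseteq> function_field"
    using x_in_function_field y_in_function_field
    by (intro inf.function_field_least[OF I] intermediate_divide[OF I] intermediate_power[OF I] intermediate_1[OF I])
  have x: "x \<in> inf.function_field"
    using intermediate_divide[OF I' intermediate_1[OF I'] inf.x_in_function_field] by simp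
  have "y / x ^ 2 * x ^ 2 \<in> inf.function_field"
    by (intro intermediate_mult[OF I'] intermediate_power[OF I'] x inf.y_in_function_field)
  then have "y \<in> inf.function_field" using x_nonzero by simp
  then show "function_field \<subseteq> inf.function_field"
    by (intro function_field_least[OF I'] x)
qed

abbreviation place_inf :: "'k \<Rightarrow> ('o \<times> 'k) set" where "place_inf \<beta> \<equiv> inf.place_at 0 \<beta>"

lemma place_inf: "\<beta> ^ 2 = 1 \<Longrightarrow> place function_field (place_inf \<beta>)"
  using inf.place_at[of \<beta> 0] function_field_inf by simp

lemma place_cases:
  assumes H: "place function_field H"
  shows "(\<exists>(\<alpha>, \<beta>)\<in>curve. H = place_at \<alpha> \<beta>) \<or> (\<exists>\<beta>. \<beta> ^ 2 = 1 \<and> H = place_inf \<beta>)"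
proof (cases "x \<in> Domain H")
  case True
  then obtain \<alpha> where "(x, \<alpha>) \<in> H" by blast
  from place_over_point[OF H this] show ?thesis unfolding curve_def by blast
next
  case False
  then have "(1 / x, 0) \<in> H" using H x_in_function_field unfolding place_def by blast
  from inf.place_over_point[OF _ this] H show ?thesis unfolding function_field_inf by simp
qed

lemma place_at_neq_place_inf:
  assumes "(\<alpha>, \<beta>) \<in> curve" "\<beta>' ^ 2 = 1"
  shows "place_at \<alpha> \<beta> \<noteq> place_inf \<beta>'"
proof
  assume eq: "place_at \<alpha> \<beta> = place_inf \<beta>'"
  have on: "\<beta> ^ 2 = poly [:c, 0, - (1 + c), 0, 1:] \<alpha>" using assms(1) unfolding curve_def by simp
  have on': "\<beta>' ^ 2 = poly [:1, 0, - (1 + c), 0, c:] 0" using assms(2) by simp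
  note spec = local_specialization_imp[OF local_place_at[OF on]]
  have "(1 / x, 0) \<in> place_at \<alpha> \<beta>" using inf.x_place_at[OF on'] eq by simp
  then have "(x * (1 / x), \<alpha> * 0) \<in> place_at \<alpha> \<beta>"
    by (rule specialization_mult[OF spec x_place_at[OF on]])
  then have "(1, 0) \<in> place_at \<alpha> \<beta>" using x_nonzero by simp
  then show False using specialization_unique[OF spec specialization_1[OF spec]] by fastforce
qed

end

section \<open>Frobenius and rational points\<close>

text \<open>The map \<open>\<psi>\<close> is the relative Frobenius: it fixes the constants and raises the coordinates to
  the \<open>l\<close>-th power.\<close>

locale frobenius_quartic = quartic_cover \<iota> x y c
  for \<iota> :: "'k::alg_closed_field \<Rightarrow> 'o::field" and x y c +
  fixes l :: nat and \<psi> :: "'o \<Rightarrow> 'o"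
  assumes l_odd: "odd l"
    and frobenius_add: "\<And>u v :: 'o. (u + v) ^ l = u ^ l + v ^ l"
    and c_rational: "c ^ l = c"
    and \<psi>_const: "\<And>a. \<psi> (\<iota> a) = \<iota> a"
    and \<psi>_x: "\<psi> x = x ^ l" and \<psi>_y: "\<psi> y = y ^ l"
    and \<psi>_add: "\<And>u v. u \<in> function_field \<Longrightarrow> v \<in> function_field \<Longrightarrow> \<psi> (u + v) = \<psi> u + \<psi> v"
    and \<psi>_mult: "\<And>u v. u \<in> function_field \<Longrightarrow> v \<in> function_field \<Longrightarrow> \<psi> (u * v) = \<psi> u * \<psi> v"
    and \<psi>_nonzero: "\<And>u. u \<in> function_field \<Longrightarrow> u \<noteq> 0 \<Longrightarrow> \<psi> u \<noteq> 0"
    and \<psi>_in: "\<And>u. u \<in> function_field \<Longrightarrow> \<psi> u \<in> function_field"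
begin

lemma l_pos: "l > 0"
  using l_odd by (auto intro: Nat.gr0I)

lemma \<psi>_0: "\<psi> 0 = 0" and \<psi>_1: "\<psi> 1 = 1"
  using \<psi>_const[of 0] \<psi>_const[of 1] by simp_all

lemma \<psi>_divide:
  assumes "u \<in> function_field" "v \<in> function_field"
  shows "\<psi> (u / v) = \<psi> u / \<psi> v"
proof (cases "v = 0")
  case False
  have "\<psi> (u / v) * \<psi> v = \<psi> u"
    using \<psi>_mult[OF intermediate_divide[OF intermediate_function_field assms] assms(2)] False by simp
  then show ?thesis using \<psi>_nonzero[OF assms(2) False] by (simp add: nonzero_eq_divide_eq)
qed (simp add: \<psi>_0)

lemma \<psi>_power: "u \<in> function_field \<Longrightarrow> \<psi> (u ^ n) = \<psi> u ^ n"
  by (induction n) (simp_all add: \<psi>_1 \<psi>_mult intermediate_power[OF intermediate_function_field])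

lemma \<psi>_sum: "(\<And>i. i \<in> I \<Longrightarrow> w i \<in> function_field) \<Longrightarrow> \<psi> (sum w I) = (\<Sum>i\<in>I. \<psi> (w i))"
  by (induction I rule: infinite_finite_induct)
     (simp_all add: \<psi>_0 \<psi>_add intermediate_sum[OF intermediate_function_field])

lemma \<psi>_prod: "(\<And>i. i \<in> I \<Longrightarrow> w i \<in> function_field) \<Longrightarrow> \<psi> (prod w I) = (\<Prod>i\<in>I. \<psi> (w i))"
  by (induction I rule: infinite_finite_induct)
     (simp_all add: \<psi>_1 \<psi>_mult intermediate_prod[OF intermediate_function_field])

lemma frobenius_sum: "(sum w I) ^ l = (\<Sum>i\<in>I. w i ^ l)" for w :: "'i \<Rightarrow> 'o"
  using l_pos by (induction I rule: infinite_finite_induct) (simp_all add: frobenius_add power_0_left)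

text \<open>On functions whose coefficients are fixed by the Frobenius of the constants, \<open>\<psi>\<close> is the
  \<open>l\<close>-th power.\<close>

lemma \<psi>_eval_hom:
  fixes w :: "'o ^ 'm::finite"
  assumes "\<And>i. w $ i \<in> function_field" "\<And>i. \<psi> (w $ i) = w $ i ^ l"
    and p: "\<And>m. Poly_Mapping.lookup p m ^ l = Poly_Mapping.lookup p m"
  shows "\<psi> (eval_hom \<iota> p w) = eval_hom \<iota> p w ^ l"
proof -
  note I = intermediate_function_field
  have prod_in: "(\<Prod>i\<in>UNIV. w $ i ^ k i) \<in> function_field" for k
    by (intro intermediate_prod[OF I] intermediate_power[OF I] assms)
  have prod: "\<psi> (\<Prod>i\<in>UNIV. w $ i ^ k i) = (\<Prod>i\<in>UNIV. w $ i ^ k i) ^ l" for k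
  proof -
    have "\<psi> (\<Prod>i\<in>UNIV. w $ i ^ k i) = (\<Prod>i\<in>UNIV. \<psi> (w $ i ^ k i))"
      by (rule \<psi>_prod) (intro intermediate_power[OF I] assms)
    also have "\<dots> = (\<Prod>i\<in>UNIV. (w $ i ^ k i) ^ l)"
      by (simp only: \<psi>_power[OF assms(1)] assms(2) power_mult[symmetric] mult.commute)
    finally show ?thesis by (simp only: prod_power_distrib)
  qed
  have "\<psi> (eval_hom \<iota> p w) = (\<Sum>m\<in>Poly_Mapping.keys p. \<psi> (\<iota> (Poly_Mapping.lookup p m) * (\<Prod>i\<in>UNIV. w $ i ^ Poly_Mapping.lookup m i)))"
    unfolding eval_hom_def
    by (rule \<psi>_sum) (intro intermediate_mult[OF I] intermediate_const[OF I] prod_in)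
  also have "\<dots> = (\<Sum>m\<in>Poly_Mapping.keys p. (\<iota> (Poly_Mapping.lookup p m) * (\<Prod>i\<in>UNIV. w $ i ^ Poly_Mapping.lookup m i)) ^ l)"
  proof (rule sum.cong[OF refl])
    fix m
    have "\<iota> (Poly_Mapping.lookup p m) = \<iota> (Poly_Mapping.lookup p m) ^ l" using p[of m] by (metis hom_power)
    then show "\<psi> (\<iota> (Poly_Mapping.lookup p m) * (\<Prod>i\<in>UNIV. w $ i ^ Poly_Mapping.lookup m i)) =
        (\<iota> (Poly_Mapping.lookup p m) * (\<Prod>i\<in>UNIV. w $ i ^ Poly_Mapping.lookup m i)) ^ l"
      by (simp only: \<psi>_mult[OF intermediate_const[OF I] prod_in] \<psi>_const prod power_mult_distrib)
  qed
  finally show ?thesis unfolding eval_hom_def frobenius_sum .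
qed

text \<open>The pull-back of a place along \<open>\<psi>\<close>.\<close>

definition frobenius_place :: "('o \<times> 'k) set \<Rightarrow> ('o \<times> 'k) set" where
  "frobenius_place H = {(w, a). w \<in> function_field \<and> (\<psi> w, a) \<in> H}"

lemma place_frobenius_place:
  assumes H: "place function_field H"
  shows "place function_field (frobenius_place H)"
proof -
  have loc: "local_specialization H" using H unfolding place_def by blast
  note spec = local_specialization_imp[OF loc]
  note I = intermediate_function_field
  have inverse: "\<psi> (1 / w) = 1 / \<psi> w" if "w \<in> function_field" for w
    using \<psi>_divide[OF intermediate_1[OF I] that] by (simp add: \<psi>_1)
  have inverse_in: "1 / w \<in> function_field" if "w \<in> function_field" for w
    using intermediate_divide[OF I intermediate_1[OF I] that] .
  show ?thesis
    unfolding place_def local_specialization_def specialization_def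
  proof (intro conjI allI impI ballI)
    show "(\<iota> a, a) \<in> frobenius_place H" for a
      unfolding frobenius_place_def using intermediate_const[OF I] specialization_const[OF spec] by (simp add: \<psi>_const)
    fix w a w' a' assume "(w, a) \<in> frobenius_place H" "(w', a') \<in> frobenius_place H"
    then show "(w + w', a + a') \<in> frobenius_place H" "(w * w', a * a') \<in> frobenius_place H"
      unfolding frobenius_place_def
      using intermediate_add[OF I] intermediate_mult[OF I] specialization_add[OF spec] specialization_mult[OF spec]
      by (simp_all add: \<psi>_add \<psi>_mult)
  next
    fix a assume "(0, a) \<in> frobenius_place H"
    then show "a = 0" unfolding frobenius_place_def using specialization_zero[OF spec] by (simp add: \<psi>_0)
  next
    fix w a assume "(w, a) \<in> frobenius_place H" "a \<noteq> 0"
    then show "(1 / w, 1 / a) \<in> frobenius_place H"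
      unfolding frobenius_place_def using loc inverse_in by (simp add: inverse local_specialization_def)
  next
    show "Domain (frobenius_place H) \<subseteq> function_field" unfolding frobenius_place_def by auto
    fix w assume w: "w \<in> function_field"
    then have "\<psi> w \<in> Domain H \<or> (1 / \<psi> w, 0) \<in> H" using H \<psi>_in unfolding place_def by blast
    then show "w \<in> Domain (frobenius_place H) \<or> (1 / w, 0) \<in> frobenius_place H"
      unfolding frobenius_place_def using w inverse inverse_in by auto
  qed
qed

lemma frobenius_curve:
  assumes "(\<alpha>, \<beta>) \<in> curve"
  shows "(\<alpha> ^ l, \<beta> ^ l) \<in> curve"
proof -
  have add: "(u + v) ^ l = u ^ l + v ^ l" for u v :: 'k
  proof -
    have "\<iota> ((u + v) ^ l) = \<iota> (u ^ l + v ^ l)"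
      unfolding hom_power hom_add by (rule frobenius_add)
    then show ?thesis by simp
  qed
  have minus: "(u - v) ^ l = u ^ l - v ^ l" for u v :: 'k
    using add[of u "- v"] l_odd by (simp add: power_minus_odd)
  from assms have "\<beta> ^ 2 = (\<alpha> ^ 2 - 1) * (\<alpha> ^ 2 - c)" unfolding curve_def quartic by simp
  then have "(\<beta> ^ 2) ^ l = ((\<alpha> ^ 2 - 1) * (\<alpha> ^ 2 - c)) ^ l" by simp
  then have "(\<beta> ^ l) ^ 2 = ((\<alpha> ^ l) ^ 2 - 1) * ((\<alpha> ^ l) ^ 2 - c)"
    unfolding power_mult_distrib minus c_rational power_one by (simp only: power_mult[symmetric] mult.commute)
  then show ?thesis unfolding curve_def quartic by simp
qed

text \<open>A place over the affine curve is determined by the values of \<open>x\<close> and \<open>y\<close>.\<close>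

lemma frobenius_place_at:
  assumes "(\<alpha>, \<beta>) \<in> curve"
  shows "frobenius_place (place_at \<alpha> \<beta>) = place_at (\<alpha> ^ l) (\<beta> ^ l)"
proof -
  have on: "\<beta> ^ 2 = poly [:c, 0, - (1 + c), 0, 1:] \<alpha>" using assms unfolding curve_def by simp
  have on': "(\<beta> ^ l) ^ 2 = poly [:c, 0, - (1 + c), 0, 1:] (\<alpha> ^ l)"
    using frobenius_curve[OF assms] unfolding curve_def by simp
  note spec = local_specialization_imp[OF local_place_at[OF on]]
  have "(x, \<alpha> ^ l) \<in> frobenius_place (place_at \<alpha> \<beta>)" "(y, \<beta> ^ l) \<in> frobenius_place (place_at \<alpha> \<beta>)"
    unfolding frobenius_place_def
    using x_in_function_field y_in_function_field specialization_power[OF spec x_place_at[OF on]]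
      specialization_power[OF spec y_place_at[OF on]] by (simp_all add: \<psi>_x \<psi>_y)
  from place_at_eqI[OF on' place_frobenius_place[OF place_at[OF on]] this] show ?thesis ..
qed

lemma frobenius_place_inf:
  assumes \<beta>: "\<beta> ^ 2 = 1"
  shows "frobenius_place (place_inf \<beta>) = place_inf \<beta>"
proof -
  have on: "\<beta> ^ 2 = poly [:1, 0, - (1 + c), 0, c:] 0" using \<beta> by simp
  note spec = local_specialization_imp[OF inf.local_place_at[OF on]]
  note I = intermediate_function_field
  have \<beta>_l: "\<beta> ^ l = \<beta>" using \<beta> l_odd by (auto simp: power2_eq_1_iff)
  have in_field: "1 / x \<in> function_field" "y / x ^ 2 \<in> function_field"
    using intermediate_divide[OF I intermediate_1[OF I] x_in_function_field]
      intermediate_divide[OF I y_in_function_field intermediate_power[OF I x_in_function_field]] by auto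
  have "\<psi> (1 / x) = (1 / x) ^ l"
    using \<psi>_divide[OF intermediate_1[OF I] x_in_function_field] by (simp add: \<psi>_1 \<psi>_x power_one_over)
  moreover have "\<psi> (y / x ^ 2) = (y / x ^ 2) ^ l"
    using \<psi>_divide[OF y_in_function_field intermediate_power[OF I x_in_function_field]]
    by (simp add: \<psi>_y \<psi>_power x_in_function_field \<psi>_x power_divide mult.commute flip: power_mult)
  moreover have "((1 / x) ^ l, 0 ^ l) \<in> place_inf \<beta>" "((y / x ^ 2) ^ l, \<beta> ^ l) \<in> place_inf \<beta>"
    by (rule specialization_power[OF spec inf.x_place_at[OF on]] specialization_power[OF spec inf.y_place_at[OF on]])+
  ultimately have "(1 / x, 0) \<in> frobenius_place (place_inf \<beta>)" "(y / x ^ 2, \<beta>) \<in> frobenius_place (place_inf \<beta>)"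
    unfolding frobenius_place_def using in_field l_pos by (simp_all add: \<beta>_l power_0_left)
  moreover have "place inf.function_field (frobenius_place (place_inf \<beta>))"
    unfolding function_field_inf by (rule place_frobenius_place[OF place_inf[OF \<beta>]])
  ultimately show ?thesis using inf.place_at_eqI[OF on] by metis
qed

definition rational_places :: "('o \<times> 'k) set set" where
  "rational_places = {H. place function_field H \<and> frobenius_place H = H}"

lemma card_rational_places:
  assumes fin: "finite {(\<alpha>, \<beta>)\<in>curve. \<alpha> ^ l = \<alpha> \<and> \<beta> ^ l = \<beta>}"
  shows "card rational_places = card {(\<alpha>, \<beta>)\<in>curve. \<alpha> ^ l = \<alpha> \<and> \<beta> ^ l = \<beta>} + 2"
proof -
  let ?C = "{(\<alpha>, \<beta>)\<in>curve. \<alpha> ^ l = \<alpha> \<and> \<beta> ^ l = \<beta>}"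
  let ?at = "\<lambda>(\<alpha>, \<beta>). place_at \<alpha> \<beta>"
  have on: "\<beta> ^ 2 = poly [:c, 0, - (1 + c), 0, 1:] \<alpha>" if "(\<alpha>, \<beta>) \<in> curve" for \<alpha> \<beta>
    using that unfolding curve_def by simp
  have one: "(1 :: 'k) ^ 2 = 1" "(- 1 :: 'k) ^ 2 = 1" by simp_all
  have "rational_places = ?at ` ?C \<union> {place_inf 1, place_inf (- 1)}"
  proof (intro equalityI subsetI)
    fix H assume "H \<in> rational_places"
    then have H: "place function_field H" "frobenius_place H = H" unfolding rational_places_def by auto
    from place_cases[OF H(1)] show "H \<in> ?at ` ?C \<union> {place_inf 1, place_inf (- 1)}"
    proof
      assume "\<exists>(\<alpha>, \<beta>)\<in>curve. H = place_at \<alpha> \<beta>"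
      then obtain \<alpha> \<beta> where \<alpha>\<beta>: "(\<alpha>, \<beta>) \<in> curve" "H = place_at \<alpha> \<beta>" by blast
      then have "place_at (\<alpha> ^ l) (\<beta> ^ l) = place_at \<alpha> \<beta>" using H(2) frobenius_place_at by simp
      then have "\<alpha> ^ l = \<alpha> \<and> \<beta> ^ l = \<beta>"
        using place_at_inject on[OF \<alpha>\<beta>(1)] on[OF frobenius_curve[OF \<alpha>\<beta>(1)]] by blast
      then show ?thesis using \<alpha>\<beta> by auto
    next
      assume "\<exists>\<beta>. \<beta> ^ 2 = 1 \<and> H = place_inf \<beta>"
      then show ?thesis by (auto simp: power2_eq_1_iff)
    qed
  next
    fix H assume "H \<in> ?at ` ?C \<union> {place_inf 1, place_inf (- 1)}"
    then consider \<alpha> \<beta> where "(\<alpha>, \<beta>) \<in> curve" "\<alpha> ^ l = \<alpha>" "\<beta> ^ l = \<beta>" "H = place_at \<alpha> \<beta>"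
      | "H = place_inf 1" | "H = place_inf (- 1)" by auto
    then show "H \<in> rational_places"
    proof cases
      case 1
      then show ?thesis using place_at[OF on] frobenius_place_at[OF 1(1)] unfolding rational_places_def by simp
    next
      case 2
      then show ?thesis using place_inf[OF one(1)] frobenius_place_inf[OF one(1)] unfolding rational_places_def by simp
    next
      case 3
      then show ?thesis using place_inf[OF one(2)] frobenius_place_inf[OF one(2)] unfolding rational_places_def by simp
    qed
  qed
  moreover have "card (?at ` ?C) = card ?C"
  proof (rule card_image, rule inj_onI)
    fix P Q assume PQ: "P \<in> ?C" "Q \<in> ?C" "?at P = ?at Q"
    obtain \<alpha> \<beta> \<alpha>' \<beta>' where eq: "P = (\<alpha>, \<beta>)" "Q = (\<alpha>', \<beta>')" by (cases P, cases Q)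
    then have "(\<alpha>, \<beta>) \<in> curve" "(\<alpha>', \<beta>') \<in> curve" "place_at \<alpha> \<beta> = place_at \<alpha>' \<beta>'" using PQ by auto
    then show "P = Q" using place_at_inject[OF on on] eq by blast
  qed
  moreover have "?at ` ?C \<inter> {place_inf 1, place_inf (- 1)} = {}"
  proof -
    have "place_at \<alpha> \<beta> \<notin> {place_inf 1, place_inf (- 1)}" if "(\<alpha>, \<beta>) \<in> curve" for \<alpha> \<beta>
      using place_at_neq_place_inf[OF that one(1)] place_at_neq_place_inf[OF that one(2)] by simp
    then show ?thesis by auto
  qed
  moreover have "place_inf 1 \<noteq> place_inf (- 1)"
  proof
    assume "place_inf 1 = place_inf (- 1)"
    then have "(1 :: 'k) = - 1" using inf.place_at_inject[of 1 0 "- 1" 0] by simp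
    then have "(1 :: 'k) + 1 = 0" by (metis add.right_inverse)
    then show False using two_nonzero by simp
  qed
  ultimately show ?thesis using fin by (simp add: card_Un_disjoint)
qed

end

locale frobenius_model = nonsingular_model \<iota> x y "[:c, 0, - (1 + c), 0, 1:]" F G E dF dG +
    frobenius_quartic \<iota> x y c l \<psi>
  for \<iota> :: "'k::alg_closed_field \<Rightarrow> 'o::field" and x y c
    and F :: "('n::finite, 'k) mpoly ^ 3" and G :: "(3, 'k) mpoly ^ 'n" and E :: "('k ^ 'n) set set"
    and dF dG l :: nat and \<psi> +
  assumes G_rational: "\<And>i m. Poly_Mapping.lookup (G $ i) m ^ l = Poly_Mapping.lookup (G $ i) m"
begin

lemma \<psi>_generic_E: "\<psi> (generic_E $ i) = generic_E $ i ^ l"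
proof -
  have gen: "generic $ j \<in> function_field \<and> \<psi> (generic $ j) = generic $ j ^ l" for j
  proof -
    have "\<forall>j. generic $ j \<in> function_field \<and> \<psi> (generic $ j) = generic $ j ^ l"
      unfolding forall_3 generic_nth
      using x_in_function_field y_in_function_field intermediate_1[OF intermediate_function_field]
      by (simp add: \<psi>_x \<psi>_y \<psi>_1)
    then show ?thesis by blast
  qed
  show ?thesis
    unfolding generic_E_def vec_lambda_beta by (rule \<psi>_eval_hom) (simp_all add: gen G_rational)
qed

lemma coordinate_frobenius_place:
  assumes "place function_field H" "(generic_E $ i / generic_E $ j, a) \<in> H"
  shows "(generic_E $ i / generic_E $ j, a ^ l) \<in> frobenius_place H"
proof -
  have spec: "specialization H"
    using assms(1) unfolding place_def local_specialization_def by blast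
  have "\<psi> (generic_E $ i / generic_E $ j) = (generic_E $ i / generic_E $ j) ^ l"
    using \<psi>_divide[OF generic_E_in_function_field generic_E_in_function_field]
    by (simp add: \<psi>_generic_E power_divide)
  then show ?thesis
    unfolding frobenius_place_def
    using specialization_power[OF spec assms(2), of l]
      intermediate_divide[OF intermediate_function_field generic_E_in_function_field generic_E_in_function_field]
    by simp
qed

text \<open>The place depends on the projective point alone.\<close>

lemma place_E_scale:
  assumes "a \<noteq> 0"
  shows "place_E (a *s v) = place_E v"
proof -
  have sub: "place_E (a *s v) \<subseteq> place_E v" if a: "a \<noteq> 0" for a v
  proof (rule subrelI)
    fix w b assume "(w, b) \<in> place_E (a *s v)"
    then obtain p r d where *: "homogeneous_of_degree d p" "homogeneous_of_degree d r" "eval_mpoly r (a *s v) \<noteq> 0"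
      "w = eval_hom \<iota> p generic_E / eval_hom \<iota> r generic_E" "b = eval_mpoly p (a *s v) / eval_mpoly r (a *s v)"
      by (elim place_EE)
    then have "eval_mpoly r v \<noteq> 0" "b = eval_mpoly p v / eval_mpoly r v"
      using a by (auto simp: eval_mpoly_scale[OF *(1)] eval_mpoly_scale[OF *(2)])
    then show "(w, b) \<in> place_E v" using place_EI[OF *(1,2)] *(4) by simp
  qed
  have "place_E ((1 / a) *s (a *s v)) \<subseteq> place_E (a *s v)" using assms by (intro sub) simp
  then show ?thesis using sub[OF assms, of v] assms by (simp add: vector_smult_assoc)
qed

text \<open>If the quotient of two coordinates has the value \<open>a\<close> at a place, then it has the value \<open>a^l\<close>
  at the pull-back.\<close>

lemma rational_place_iff:
  assumes v: "proj_point v \<in> E"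
  shows "place_E v \<in> rational_places \<longleftrightarrow> (\<exists>w. proj_point v = proj_point w \<and> (\<forall>i. w $ i ^ l = w $ i))"
proof
  obtain j where j: "v $ j \<noteq> 0" using mem_E_nonzero[OF v] by (metis vec_eq_iff zero_index)
  note spec = local_specialization_imp[OF local_place_E[OF v]]
  assume "place_E v \<in> rational_places"
  then have "frobenius_place (place_E v) = place_E v" unfolding rational_places_def by blast
  then have "(generic_E $ i / generic_E $ j, (v $ i / v $ j) ^ l) \<in> place_E v" for i
    using coordinate_frobenius_place[OF place_E[OF v] coordinate_place_E[OF j]] by simp
  then have "(v $ i / v $ j) ^ l = v $ i / v $ j" for i
    using specialization_unique[OF spec _ coordinate_place_E[OF j]] by blast
  moreover have "proj_point v = proj_point (\<chi> i. v $ i / v $ j)"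
    unfolding proj_point_eq_iff using j by (intro exI[of _ "1 / v $ j"]) (simp add: vec_eq_iff)
  ultimately show "\<exists>w. proj_point v = proj_point w \<and> (\<forall>i. w $ i ^ l = w $ i)"
    by (intro exI[of _ "\<chi> i. v $ i / v $ j"]) simp
next
  assume "\<exists>w. proj_point v = proj_point w \<and> (\<forall>i. w $ i ^ l = w $ i)"
  then obtain w :: "'k ^ 'n" where w: "proj_point v = proj_point w" "\<And>i. w $ i ^ l = w $ i" by blast
  then have wE: "proj_point w \<in> E" using v by simp
  obtain j where j: "w $ j \<noteq> 0" using mem_E_nonzero[OF wE] by (metis vec_eq_iff zero_index)
  have "(generic_E $ i / generic_E $ j, w $ i / w $ j) \<in> frobenius_place (place_E w)" for i
    using coordinate_frobenius_place[OF place_E[OF wE] coordinate_place_E[OF j], of i] w(2)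
    by (simp add: power_divide)
  moreover have frob: "place function_field (frobenius_place (place_E w))"
    by (rule place_frobenius_place[OF place_E[OF wE]])
  ultimately have "place_E w \<subseteq> frobenius_place (place_E w)"
    by (intro place_E_least[OF _ j generic_E_nonzero[OF wE j]]) (auto simp: place_def)
  then have "place_E w = frobenius_place (place_E w)"
    using place_maximal[OF place_E[OF wE]] frob unfolding place_def by blast
  moreover have "place_E v = place_E w" using w(1) place_E_scale unfolding proj_point_eq_iff by metis
  ultimately show "place_E v \<in> rational_places" using place_E[OF wE] unfolding rational_places_def by simp
qed

text \<open>Both sides count the places fixed by the pull-back, and the two places at infinity are among
  these.\<close>

theorem card_rational_points:
  assumes fin: "finite {(\<alpha>, \<beta>)\<in>curve. \<alpha> ^ l = \<alpha> \<and> \<beta> ^ l = \<beta>}"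
  shows "card {P \<in> E. \<exists>w. P = proj_point w \<and> (\<forall>i. w $ i ^ l = w $ i)} =
    card {(\<alpha>, \<beta>)\<in>curve. \<alpha> ^ l = \<alpha> \<and> \<beta> ^ l = \<beta>} + 2"
proof -
  let ?R = "{P \<in> E. \<exists>w. P = proj_point w \<and> (\<forall>i. w $ i ^ l = w $ i)}"
  define rep where "rep P = (SOME v. P = proj_point v)" for P :: "('k ^ 'n) set"
  have rep: "proj_point (rep P) = P" if "P \<in> E" for P
    using someI_ex[OF mem_E_proj_point[OF that]] unfolding rep_def by simp
  have "bij_betw (\<lambda>P. place_E (rep P)) ?R rational_places"
  proof (rule bij_betwI')
    fix P Q assume "P \<in> ?R" "Q \<in> ?R"
    then have "P \<in> E" "Q \<in> E" by auto
    then show "place_E (rep P) = place_E (rep Q) \<longleftrightarrow> P = Q"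
      using place_E_inject[of "rep P" "rep Q"] rep by auto
  next
    fix P assume P: "P \<in> ?R"
    then have "proj_point (rep P) \<in> E" "\<exists>w. proj_point (rep P) = proj_point w \<and> (\<forall>i. w $ i ^ l = w $ i)"
      using rep by auto
    then show "place_E (rep P) \<in> rational_places" using rational_place_iff by blast
  next
    fix H assume H: "H \<in> rational_places"
    then have "place function_field H" unfolding rational_places_def by simp
    then obtain v where v: "proj_point v \<in> E" "H = place_E v" by (rule exists_centre)
    have "proj_point (rep (proj_point v)) = proj_point v" using rep v by blast
    then have eq: "place_E (rep (proj_point v)) = place_E v"
      using place_E_scale unfolding proj_point_eq_iff by metis
    have "proj_point v \<in> ?R" using v H rational_place_iff[OF v(1)] by auto
    then show "\<exists>P\<in>?R. H = place_E (rep P)" using eq v(2) by blast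
  qed
  then show ?thesis using card_rational_places[OF fin] by (simp add: bij_betw_same_card)
qed

end


section \<open>Quadratic character sums\<close>

lemma of_int_to_int_mod_ring: "of_int (to_int_mod_ring a) = (a :: 'p::prime_card mod_ring)"
  by (simp add: of_int_of_int_mod_ring)

lemma chi_cases: "chi (a :: 'p::prime_card mod_ring) = (if a = 0 then 0 else if \<exists>b. b ^ 2 = a then 1 else - 1)"
proof -
  have cong: "[m = n] (mod (int CARD('p))) \<longleftrightarrow> of_int m = (of_int n :: 'p mod_ring)" for m n
    by (simp add: of_int_eq_iff_cong_CHAR)
  have "[to_int_mod_ring a = 0] (mod (int CARD('p))) \<longleftrightarrow> a = 0"
    unfolding cong by (simp add: of_int_to_int_mod_ring)
  moreover have "QuadRes (int CARD('p)) (to_int_mod_ring a) \<longleftrightarrow> (\<exists>b. b ^ 2 = a)"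
  proof
    assume "QuadRes (int CARD('p)) (to_int_mod_ring a)"
    then show "\<exists>b. b ^ 2 = a" unfolding QuadRes_def cong by (auto simp: of_int_to_int_mod_ring)
  next
    assume "\<exists>b. b ^ 2 = a"
    then obtain b where "b ^ 2 = a" by blast
    then have "of_int (to_int_mod_ring b ^ 2) = (of_int (to_int_mod_ring a) :: 'p mod_ring)"
      by (simp add: of_int_to_int_mod_ring)
    then show "QuadRes (int CARD('p)) (to_int_mod_ring a)" unfolding QuadRes_def cong by blast
  qed
  ultimately show ?thesis unfolding chi_def Legendre_def by simp
qed

lemma chi_0 [simp]: "chi (0 :: 'p::prime_card mod_ring) = 0"
  by (simp add: chi_cases)

lemma chi_square: "a \<noteq> 0 \<Longrightarrow> chi (a ^ 2 :: 'p::prime_card mod_ring) = 1"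
  by (auto simp: chi_cases)

context
  assumes odd_char: "CARD('p::prime_card) > 2"
begin

lemma chi_euler: "of_int (chi a) = (a :: 'p mod_ring) ^ ((CARD('p) - 1) div 2)"
proof -
  have "[Legendre (to_int_mod_ring a) (int CARD('p)) = to_int_mod_ring a ^ ((CARD('p) - 1) div 2)] (mod (int CARD('p)))"
    using euler_criterion[OF prime_card odd_char] by simp
  then have "of_int (chi a) = (of_int (to_int_mod_ring a ^ ((CARD('p) - 1) div 2)) :: 'p mod_ring)"
    unfolding chi_def by (simp only: of_int_eq_iff_cong_CHAR semiring_char_mod_ring)
  then show ?thesis by (simp add: of_int_to_int_mod_ring)
qed

text \<open>By Euler's criterion the two sides agree modulo \<open>l\<close>, and they differ by at most 2.\<close>

lemma chi_mult: "chi (a * b) = chi a * chi (b :: 'p mod_ring)"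
proof -
  have "of_int (chi (a * b)) = (of_int (chi a * chi b) :: 'p mod_ring)"
    by (simp add: chi_euler power_mult_distrib)
  then have "[chi (a * b) = chi a * chi b] (mod (int CARD('p)))"
    by (simp only: of_int_eq_iff_cong_CHAR semiring_char_mod_ring)
  then have dvd: "int CARD('p) dvd chi (a * b) - chi a * chi b" by (simp add: cong_iff_dvd_diff)
  have abs: "\<bar>chi c\<bar> \<le> 1" for c :: "'p mod_ring" by (simp add: chi_cases)
  have "\<bar>chi a * chi b\<bar> \<le> 1" using abs[of a] abs[of b] mult_mono[of "\<bar>chi a\<bar>" 1 "\<bar>chi b\<bar>" 1] by (simp add: abs_mult)
  then have "\<bar>chi (a * b) - chi a * chi b\<bar> < int CARD('p)"
    using abs[of "a * b"] odd_char by linarith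
  then show ?thesis using dvd zdvd_imp_le[of "int CARD('p)" "\<bar>chi (a * b) - chi a * chi b\<bar>"] by fastforce
qed

lemma two_nonzero_mod_ring: "(2 :: 'p mod_ring) \<noteq> 0"
proof
  assume "(2 :: 'p mod_ring) = 0"
  then have "CARD('p) dvd 2" using of_nat_0_mod_ring_dvd[of 2] by simp
  then show False using odd_char by (auto dest: dvd_imp_le)
qed

lemma card_square_roots: "int (card {b :: 'p mod_ring. b ^ 2 = a}) = 1 + chi a"
proof -
  consider "a = 0" | b where "b ^ 2 = a" "a \<noteq> 0" | "a \<noteq> 0" "\<nexists>b. b ^ 2 = a" by blast
  then show ?thesis
  proof cases
    case 1
    then have "{b. b ^ 2 = a} = {0}" by auto
    then show ?thesis using 1 by simp
  next
    case 2
    then have "{b'. b' ^ 2 = a} = {b, - b}" by (auto simp: power2_eq_iff)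
    moreover have "b \<noteq> - b"
    proof
      assume "b = - b"
      then have "2 * b = 0" by (metis add.right_inverse mult_2)
      then show False using two_nonzero_mod_ring 2 by auto
    qed
    ultimately show ?thesis using 2 chi_square[of b] by auto
  next
    case 3
    then have "{b. b ^ 2 = a} = {}" by blast
    then show ?thesis using 3 by (simp add: chi_cases)
  qed
qed

lemma sum_over_squares: "(\<Sum>z\<in>UNIV. g (z ^ 2)) = (\<Sum>u\<in>UNIV. (1 + chi u) * g (u :: 'p mod_ring))" for g :: "_ \<Rightarrow> int"
proof -
  have "(\<Sum>z\<in>UNIV. g (z ^ 2)) = (\<Sum>u\<in>UNIV. \<Sum>z\<in>{z\<in>UNIV. z ^ 2 = u}. g (z ^ 2))"
    by (rule sum.group[symmetric]) auto
  also have "\<dots> = (\<Sum>u\<in>UNIV. (1 + chi u) * g u)"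
    by (rule sum.cong) (simp_all add: card_square_roots)
  finally show ?thesis .
qed

text \<open>Multiplication by the nonresidue \<open>c\<close> permutes the field and changes the sign of each
  summand.\<close>

lemma sum_chi:
  assumes "\<not> (\<exists>b. b ^ 2 = (c :: 'p mod_ring))"
  shows "(\<Sum>a\<in>UNIV. chi (a :: 'p mod_ring)) = 0"
proof -
  have c: "c \<noteq> 0" "chi c = - 1" using assms by (force simp: chi_cases)+
  have "(\<Sum>a\<in>UNIV. chi (a :: 'p mod_ring)) = (\<Sum>a\<in>UNIV. chi (c * a))"
    by (rule sum.reindex_bij_witness[of _ "\<lambda>a. c * a" "\<lambda>a. a / c"]) (use c in auto)
  also have "\<dots> = - (\<Sum>a\<in>UNIV. chi (a :: 'p mod_ring))" by (simp add: chi_mult c sum_negf)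
  finally show ?thesis by simp
qed

text \<open>For \<open>u \<noteq> 1\<close>, dividing by the square of \<open>u - 1\<close> leaves a fractional linear function of \<open>u\<close>,
  which permutes the elements other than 1.\<close>

lemma sum_chi_quadratic:
  assumes c: "\<not> (\<exists>b. b ^ 2 = (c :: 'p mod_ring))"
  shows "(\<Sum>u\<in>UNIV. chi ((u - 1) * (u - c))) = - 1"
proof -
  have c1: "1 - c \<noteq> 0" using c by (metis one_power2 right_minus_eq)
  \<comment> \<open>This fractional linear map is an involution of the complement of 1.\<close>
  let ?h = "\<lambda>u. 1 + (1 - c) / (u - 1)"
  have "(\<Sum>u\<in>UNIV. chi ((u - 1) * (u - c))) = (\<Sum>u\<in>UNIV - {1}. chi ((u - 1) * (u - c)))"
    by (subst sum.remove[of UNIV 1]) auto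
  also have "\<dots> = (\<Sum>u\<in>UNIV - {1}. chi (?h u))"
  proof (rule sum.cong[OF refl])
    fix u :: "'p mod_ring" assume "u \<in> UNIV - {1}"
    then have u: "u - 1 \<noteq> 0" by simp
    have "(u - 1) ^ 2 * ?h u = (u - 1) * ((u - 1) + (u - 1) * ((1 - c) / (u - 1)))"
      by (simp only: power2_eq_square distrib_left mult_1_right mult.assoc)
    also have "(u - 1) * ((1 - c) / (u - 1)) = 1 - c" using u by simp
    finally have "(u - 1) * (u - c) = (u - 1) ^ 2 * ?h u" by simp
    then show "chi ((u - 1) * (u - c)) = chi (?h u)" by (simp only: chi_mult chi_square[OF u] mult_1_left)
  qed
  also have "\<dots> = (\<Sum>w\<in>UNIV - {1}. chi (w :: 'p mod_ring))"
    by (rule sum.reindex_bij_witness[of _ ?h ?h]) (use c1 in auto)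
  also have "\<dots> = (\<Sum>w\<in>UNIV. chi (w :: 'p mod_ring)) - chi (1 :: 'p mod_ring)"
    by (simp add: sum_diff1)
  also have "\<dots> = - 1" using chi_square[of "1 :: 'p mod_ring"] by (simp add: sum_chi[OF c])
  finally show ?thesis .
qed

text \<open>The character sum of the curve \<open>Y\<^sup>2 = X (X - 1) (X - c)\<close>, which is minus the Frobenius trace
  of the quartic model.\<close>

definition cubic_sum :: "'p mod_ring \<Rightarrow> int" where
  "cubic_sum c = (\<Sum>u\<in>UNIV. chi (u * ((u - 1) * (u - c))))"

text \<open>Each \<open>u\<close> is the square of \<open>1 + \<chi>(u)\<close> elements, and \<open>u = A w\<close> makes \<open>A\<close> appear as a factor.\<close>

lemma K_sum_twist:
  assumes c: "\<not> (\<exists>b. b ^ 2 = (c :: 'p mod_ring))" and A: "A \<noteq> 0"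
  shows "K_sum A (c * A) = - 1 + chi A * cubic_sum c"
proof -
  have "K_sum A (c * A) = (\<Sum>u\<in>UNIV. (1 + chi u) * chi ((u - A) * (u - c * A)))"
    unfolding K_sum_def by (rule sum_over_squares)
  also have "\<dots> = (\<Sum>w\<in>UNIV. (1 + chi (A * w)) * chi ((A * w - A) * (A * w - c * A)))"
    by (rule sum.reindex_bij_witness[of _ "\<lambda>w. A * w" "\<lambda>u. u / A"]) (use A in auto)
  also have "\<dots> = (\<Sum>w\<in>UNIV. chi ((w - 1) * (w - c)) + chi A * chi (w * ((w - 1) * (w - c))))"
  proof (rule sum.cong[OF refl])
    fix w :: "'p mod_ring"
    have "(A * w - A) * (A * w - c * A) = A ^ 2 * ((w - 1) * (w - c))"
      by (simp add: algebra_simps power2_eq_square)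
    then have eq: "chi ((A * w - A) * (A * w - c * A)) = chi ((w - 1) * (w - c))"
      by (simp only: chi_mult[of "A ^ 2"] chi_square[OF A] mult_1_left)
    show "(1 + chi (A * w)) * chi ((A * w - A) * (A * w - c * A)) =
        chi ((w - 1) * (w - c)) + chi A * chi (w * ((w - 1) * (w - c)))"
      unfolding eq chi_mult[of A] chi_mult[of w] by (simp only: distrib_right mult_1_left mult.assoc)
  qed
  also have "\<dots> = - 1 + chi A * cubic_sum c"
    by (simp only: sum.distrib sum_chi_quadratic[OF c] cubic_sum_def sum_distrib_left)
  finally show ?thesis .
qed

lemma sum_K_sum_squares:
  assumes c: "\<not> (\<exists>b. b ^ 2 = (c :: 'p mod_ring))"
  shows "(\<Sum>A\<in>UNIV - {0}. K_sum A (c * A) ^ 2) = (int CARD('p) - 1) * (cubic_sum c ^ 2 + 1)"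
proof -
  have "(\<Sum>A\<in>UNIV - {0}. K_sum A (c * A) ^ 2) =
      (\<Sum>A\<in>UNIV - {0}. (cubic_sum c ^ 2 + 1) - 2 * cubic_sum c * chi (A :: 'p mod_ring))"
  proof (rule sum.cong[OF refl])
    fix A :: "'p mod_ring" assume "A \<in> UNIV - {0}"
    then have A: "A \<noteq> 0" by simp
    then have "chi A ^ 2 = 1" by (simp add: chi_cases)
    moreover have "(- 1 + chi A * cubic_sum c) ^ 2 = chi A ^ 2 * cubic_sum c ^ 2 + 1 - 2 * cubic_sum c * chi A"
      by (simp add: power2_eq_square algebra_simps)
    ultimately show "K_sum A (c * A) ^ 2 = (cubic_sum c ^ 2 + 1) - 2 * cubic_sum c * chi A"
      by (simp add: K_sum_twist[OF c A])
  qed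
  also have "\<dots> = int (card (UNIV - {0 :: 'p mod_ring})) * (cubic_sum c ^ 2 + 1) - 2 * cubic_sum c * (\<Sum>A\<in>UNIV - {0}. chi (A :: 'p mod_ring))"
    by (simp add: sum_subtractf sum_distrib_left)
  also have "(\<Sum>A\<in>UNIV - {0 :: 'p mod_ring}. chi A) = 0"
    using sum_chi[OF c] by (simp add: sum_diff1)
  also have "int (card (UNIV - {0 :: 'p mod_ring})) = int CARD('p) - 1"
    by (simp add: card_Diff_singleton of_nat_diff)
  finally show ?thesis by simp
qed

lemma card_affine_points:
  assumes c: "\<not> (\<exists>b. b ^ 2 = (c :: 'p mod_ring))"
  shows "int (card {(a, b). b ^ 2 = (a ^ 2 - 1) * (a ^ 2 - c)}) = int CARD('p) - 1 + cubic_sum c"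
proof -
  have "{(a, b). b ^ 2 = (a ^ 2 - 1) * (a ^ 2 - c)} = (SIGMA a:UNIV. {b. b ^ 2 = (a ^ 2 - 1) * (a ^ 2 - c)})"
    by auto
  then have "int (card {(a, b). b ^ 2 = (a ^ 2 - 1) * (a ^ 2 - c)}) =
      (\<Sum>a\<in>UNIV. int (card {b. b ^ 2 = (a ^ 2 - 1) * (a ^ 2 - c)}))"
    by (simp add: card_SigmaI)
  also have "\<dots> = int CARD('p) + K_sum 1 (c * 1)"
    unfolding card_square_roots K_sum_def by (simp add: sum.distrib)
  also have "K_sum 1 (c * 1) = - 1 + cubic_sum c"
    using K_sum_twist[OF c one_neq_zero] chi_square[of "1 :: 'p mod_ring"] by simp
  finally show ?thesis by simp
qed

end


section \<open>Counting the rational points of the model\<close>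

text \<open>The polynomial \<open>X^l - X\<close> has at most \<open>l\<close> roots, and the \<open>l\<close> elements of the prime field are
  among them.\<close>

lemma fixed_iff_rational:
  fixes a :: "'p::prime_card mod_ring alg_closure"
  shows "a ^ CARD('p) = a \<longleftrightarrow> a \<in> range to_ac"
proof -
  let ?l = "CARD('p)"
  have l: "?l > 1" using prime_gt_1_nat[OF prime_card] .
  define q where "q = (Polynomial.monom 1 ?l + [:0, - 1:] :: 'p mod_ring alg_closure poly)"
  have deg: "Polynomial.degree q = ?l"
    unfolding q_def using l by (subst degree_add_eq_left) (auto simp: degree_monom_eq)
  then have "q \<noteq> 0" using l by auto
  have roots: "poly q b = 0 \<longleftrightarrow> b ^ ?l = b" for b
    by (simp add: q_def poly_monom)
  have sub: "range (to_ac :: 'p mod_ring \<Rightarrow> _) \<subseteq> {b. poly q b = 0}"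
  proof safe
    fix b :: "'p mod_ring"
    have "to_ac b ^ ?l = to_ac (b ^ ?l)" by simp
    also have "b ^ ?l = b" using finite_field_power_card_eq_same[of b] by simp
    finally show "poly q (to_ac b) = 0" unfolding roots .
  qed
  have "card (range (to_ac :: 'p mod_ring \<Rightarrow> _)) = ?l"
    by (simp add: card_image inj_to_ac)
  moreover have "card {b. poly q b = 0} \<le> ?l"
    using card_poly_roots_bound[OF \<open>q \<noteq> 0\<close>] deg by simp
  ultimately have "range (to_ac :: 'p mod_ring \<Rightarrow> _) = {b. poly q b = 0}"
    using sub poly_roots_finite[OF \<open>q \<noteq> 0\<close>] by (intro card_seteq) auto
  then show ?thesis using roots by auto
qed

lemma quartic_simple_roots:
  fixes c \<alpha> :: "'a::field"
  assumes "c \<noteq> 0" "c \<noteq> 1" "(2 :: 'a) \<noteq> 0" and root: "poly [:c, 0, - (1 + c), 0, 1:] \<alpha> = 0"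
  shows "poly (pderiv [:c, 0, - (1 + c), 0, 1:]) \<alpha> \<noteq> 0"
proof -
  have deriv: "poly (pderiv [:c, 0, - (1 + c), 0, 1:]) \<alpha> = 2 * \<alpha> * ((\<alpha> ^ 2 - c) + (\<alpha> ^ 2 - 1))"
    by (simp add: pderiv_pCons algebra_simps power2_eq_square)
  have "(\<alpha> ^ 2 - 1) * (\<alpha> ^ 2 - c) = 0" using root by (simp add: algebra_simps power2_eq_square)
  then consider "\<alpha> ^ 2 = 1" | "\<alpha> ^ 2 = c" by auto
  then have "\<alpha> \<noteq> 0 \<and> (\<alpha> ^ 2 - c) + (\<alpha> ^ 2 - 1) \<noteq> 0"
    by cases (use assms in auto)
  then show ?thesis unfolding deriv using assms(3) by simp
qed

definition constant_embedding :: "'a::field \<Rightarrow> 'a poly fract alg_closure" where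
  "constant_embedding a = to_ac (Fract [:a:] 1)"

lemma field_hom_constant_embedding: "field_hom (constant_embedding :: 'a::field \<Rightarrow> _)"
proof
  show "constant_embedding (a + b) = constant_embedding a + constant_embedding b" for a b :: 'a
    unfolding constant_embedding_def by (simp flip: to_ac_add)
  show "constant_embedding (a * b) = constant_embedding a * constant_embedding b" for a b :: 'a
    unfolding constant_embedding_def by (simp add: mult.commute flip: to_ac_mult)
  show "constant_embedding 1 = (1 :: 'a poly fract alg_closure)"
    unfolding constant_embedding_def by (simp add: One_fract_def flip: one_pCons to_ac_1)
  show "constant_embedding 0 = (0 :: 'a poly fract alg_closure)"
    unfolding constant_embedding_def by (simp add: Zero_fract_def flip: to_ac_0)
qed

text \<open>In particular, the variable is transcendental over the constants.\<close>

lemma eval_generic_variable: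
  fixes a :: "'a::field poly"
  shows "poly (map_poly constant_embedding a) (to_ac (Fract [:0, 1:] 1)) = to_ac (Fract a 1)"
proof -
  interpret field_hom "constant_embedding :: 'a \<Rightarrow> _" by (rule field_hom_constant_embedding)
  show ?thesis
  proof (induction a)
    case 0
    show ?case by (simp add: Zero_fract_def flip: to_ac_0)
  next
    case (pCons b a)
    have "poly (map_poly constant_embedding (pCons b a)) (to_ac (Fract [:0, 1:] 1)) =
        to_ac (Fract [:b:] 1) + to_ac (Fract [:0, 1:] 1) * to_ac (Fract a 1)"
      unfolding map_poly_pCons_hom poly_pCons pCons(2) by (simp add: constant_embedding_def)
    also have "\<dots> = to_ac (Fract [:b:] 1 + Fract [:0, 1:] 1 * Fract a 1)"
      by (simp only: to_ac_add to_ac_mult)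
    also have "Fract [:b:] 1 + Fract [:0, 1:] 1 * Fract a 1 = Fract (pCons b a) 1" by simp
    finally show ?case .
  qed
qed

text \<open>It remains to construct the generic point, inside an algebraic closure of the field of
  rational functions over the algebraic closure of the prime field, and the relative Frobenius.\<close>

theorem card_rational_points_model:
  fixes c :: "'p::prime_card mod_ring"
    and E :: "('p mod_ring alg_closure ^ 'n::finite) set set"
  assumes odd_char: "CARD('p) > 2" and c: "\<not> (\<exists>x. x ^ 2 = c)"
    and model: "smooth_projective_model (affine_quartic c) E"
  shows "card (rational_points E) = card {(a, b). b ^ 2 = (a ^ 2 - 1) * (a ^ 2 - c)} + 2"
proof -
  let ?l = "CARD('p)" and ?c = "to_ac c"
  let ?f = "[:?c, 0, - (1 + ?c), 0, 1:]"
  define \<iota> :: "'p mod_ring alg_closure \<Rightarrow> _" where "\<iota> = constant_embedding"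
  define x :: "'p mod_ring alg_closure poly fract alg_closure" where "x = to_ac (Fract [:0, 1:] 1)"
  obtain y where y: "y ^ 2 = poly (map_poly \<iota> ?f) x"
    using nth_root_exists[of 2 "poly (map_poly \<iota> ?f) x"] by auto
  interpret \<iota>: field_hom \<iota> unfolding \<iota>_def by (rule field_hom_constant_embedding)
  have "c \<noteq> 0" "c \<noteq> 1" using c by (metis zero_power2, metis one_power2)
  then have c01: "?c \<noteq> 0" "?c \<noteq> 1" using to_ac_eq_iff[of c 1] by simp_all
  have two: "(2 :: 'p mod_ring alg_closure) \<noteq> 0"
    using two_nonzero_mod_ring[OF odd_char] to_ac_eq_0_iff[of "2 :: 'p mod_ring"] by simp
  interpret quartic_cover \<iota> x y ?c
  proof
    show "a = 0" if "poly (map_poly \<iota> a) x = 0" for a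
    proof -
      have "to_ac (Fract a 1) = 0" using that unfolding \<iota>_def x_def eval_generic_variable .
      then show "a = 0" by (simp add: Zero_fract_def eq_fract)
    qed
    show "y ^ 2 = poly (map_poly \<iota> ?f) x" by (rule y)
    show "poly (pderiv ?f) \<alpha> \<noteq> 0" if "poly ?f \<alpha> = 0" for \<alpha>
      by (rule quartic_simple_roots[OF c01 two that])
    show "\<exists>\<alpha>. poly ?f \<alpha> = 0" by (rule exI[of _ 1]) simp
    show "(2 :: 'p mod_ring alg_closure) \<noteq> 0" by (rule two)
  qed
  have curve_eq: "affine_quartic c = curve"
    unfolding affine_quartic_def curve_def quartic ..
  have variety: "proj_closed E" "proj_irreducible E" "proj_dim E = 1" "nonsingular E"
    using model unfolding smooth_projective_model_def proj_variety_def by auto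
  from model obtain F :: "('n, _) mpoly ^ 3" and G :: "(3, _) mpoly ^ 'n" where
    FG: "forms_over_base F" "forms_over_base G" and
    inverse: "generically_left_inverse G F E (plane_points curve)" "generically_left_inverse F G (plane_points curve) E"
    unfolding smooth_projective_model_def birational_over_base_def curve_eq by blast
  from FG obtain dF dG where dF: "\<And>j. homogeneous_of_degree dF (F $ j)"
    and dG: "\<And>i. homogeneous_of_degree dG (G $ i)" and base: "\<And>i. over_base (G $ i)"
    unfolding forms_over_base_def by blast
  have char: "Factorial_Ring.prime CHAR('p mod_ring alg_closure poly fract alg_closure)"
    "CHAR('p mod_ring alg_closure poly fract alg_closure) = ?l"
  proof -
    have "of_nat ?l = (0 :: 'p mod_ring alg_closure)" by (simp flip: to_ac_of_nat)
    then have "\<iota> (of_nat ?l) = 0" by simp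
    then have "of_nat ?l = (0 :: 'p mod_ring alg_closure poly fract alg_closure)"
      by (simp add: \<iota>.hom_of_nat)
    then have "CHAR('p mod_ring alg_closure poly fract alg_closure) dvd ?l"
      by (simp only: of_nat_eq_0_iff_char_dvd)
    then show "CHAR('p mod_ring alg_closure poly fract alg_closure) = ?l"
      using prime_card[where 'a = 'p] CHAR_not_1' by (auto simp: prime_nat_iff)
    then show "Factorial_Ring.prime CHAR('p mod_ring alg_closure poly fract alg_closure)"
      using prime_card by metis
  qed
  have frob: "(u + v) ^ ?l = u ^ ?l + v ^ ?l" for u v :: "'p mod_ring alg_closure poly fract alg_closure"
    using freshmans_dream[OF char(1), of ?l u v] char(2) by simp
  have odd: "odd ?l" using prime_odd_nat[OF prime_card odd_char] .
  have c_l: "?c ^ ?l = ?c" unfolding fixed_iff_rational by simp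
  have power_l: "poly (map_poly \<iota> a) (x ^ ?l) = 0 \<Longrightarrow> a = 0" for a
    using transcendental_power[of a ?l] by simp
  have \<iota>_c: "\<iota> ?c ^ ?l = \<iota> ?c" using c_l by (metis \<iota>.hom_power)
  have f_l: "(y ^ ?l) ^ 2 = poly (map_poly \<iota> ?f) (x ^ ?l)"
  proof -
    have minus: "(u - v) ^ ?l = u ^ ?l - v ^ ?l" for u v :: "'p mod_ring alg_closure poly fract alg_closure"
      using frob[of u "- v"] odd by (simp add: power_minus_odd)
    have neg: "\<iota> (- (1 + ?c)) = - (1 + \<iota> ?c)"
      by (simp only: \<iota>.hom_uminus \<iota>.hom_add \<iota>.hom_one)
    have eval: "poly (map_poly \<iota> ?f) u = (u ^ 2 - 1) * (u ^ 2 - \<iota> ?c)" for u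
      unfolding \<iota>.poly_map_poly_quartic neg by (simp add: algebra_simps power2_eq_square)
    have "(y ^ ?l) ^ 2 = (y ^ 2) ^ ?l" by (simp only: power_mult[symmetric] mult.commute)
    also have "\<dots> = ((x ^ 2) ^ ?l - 1) * ((x ^ 2) ^ ?l - \<iota> ?c)"
      unfolding y eval power_mult_distrib minus \<iota>_c power_one ..
    also have "(x ^ 2) ^ ?l = (x ^ ?l) ^ 2" by (simp only: power_mult[symmetric] mult.commute)
    finally show ?thesis unfolding eval .
  qed
  obtain \<psi> where \<psi>: "\<And>a. \<psi> (\<iota> a) = \<iota> a" "\<psi> x = x ^ ?l" "\<psi> y = y ^ ?l"
    "\<And>w w'. w \<in> function_field \<Longrightarrow> w' \<in> function_field \<Longrightarrow> \<psi> (w + w') = \<psi> w + \<psi> w'"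
    "\<And>w w'. w \<in> function_field \<Longrightarrow> w' \<in> function_field \<Longrightarrow> \<psi> (w * w') = \<psi> w * \<psi> w'"
    "\<And>w. w \<in> function_field \<Longrightarrow> w \<noteq> 0 \<Longrightarrow> \<psi> w \<noteq> 0"
    "\<And>w. w \<in> function_field \<Longrightarrow> \<psi> w \<in> function_field"
  proof -
    have powers: "x ^ ?l \<in> function_field" "y ^ ?l \<in> function_field"
      by (intro \<iota>.intermediate_power[OF intermediate_function_field] x_in_function_field y_in_function_field)+
    show thesis
    proof (rule exists_substitution[OF _ f_l powers], goal_cases)
      case (1 a)
      then show ?case by (rule power_l)
    next
      case (2 \<psi>)
      show ?case by (rule that[OF 2])
    qed
  qed
  interpret frobenius_model \<iota> x y ?c F G E dF dG ?l \<psi>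
  proof
    show "Poly_Mapping.lookup (G $ i) m ^ ?l = Poly_Mapping.lookup (G $ i) m" for i m
      using base[of i] unfolding over_base_def fixed_iff_rational by blast
  qed (fact dF dG inverse variety odd frob c_l \<psi>)+
  let ?C = "{(a, b). b ^ 2 = (a ^ 2 - 1) * (a ^ 2 - c)}"
  let ?fixed = "{(\<alpha>, \<beta>)\<in>curve. \<alpha> ^ ?l = \<alpha> \<and> \<beta> ^ ?l = \<beta>}"
  have "?fixed = (\<lambda>(a, b). (to_ac a, to_ac b)) ` ?C"
  proof (intro equalityI subsetI)
    fix P assume "P \<in> ?fixed"
    then obtain a b where P: "P = (to_ac a, to_ac b)" "P \<in> curve"
      unfolding fixed_iff_rational by blast
    then have "(to_ac b) ^ 2 = ((to_ac a) ^ 2 - 1) * ((to_ac a) ^ 2 - ?c)"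
      unfolding curve_def quartic by simp
    then have "to_ac (b ^ 2) = to_ac ((a ^ 2 - 1) * (a ^ 2 - c))" by simp
    then have "b ^ 2 = (a ^ 2 - 1) * (a ^ 2 - c)" unfolding to_ac_eq_iff .
    then show "P \<in> (\<lambda>(a, b). (to_ac a, to_ac b)) ` ?C" using P by auto
  next
    fix P assume "P \<in> (\<lambda>(a, b). (to_ac a, to_ac b)) ` ?C"
    then obtain a b where P: "P = (to_ac a, to_ac b)" "b ^ 2 = (a ^ 2 - 1) * (a ^ 2 - c)" by auto
    then have "to_ac (b ^ 2) = to_ac ((a ^ 2 - 1) * (a ^ 2 - c))" by simp
    then have "P \<in> curve" unfolding P(1) curve_def quartic by simp
    moreover have "(to_ac a) ^ ?l = to_ac a" "(to_ac b) ^ ?l = to_ac b"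
      unfolding fixed_iff_rational by simp_all
    ultimately show "P \<in> ?fixed" unfolding P(1) by blast
  qed
  moreover have "inj_on (\<lambda>(a, b). (to_ac a, to_ac b)) ?C" by (auto simp: inj_on_def)
  ultimately have card: "finite ?fixed" "card ?fixed = card ?C"
    by (simp_all add: card_image)
  have "rational_points E = {P \<in> E. \<exists>w. P = proj_point w \<and> (\<forall>i. w $ i ^ ?l = w $ i)}"
  proof -
    have "(\<exists>w :: 'p mod_ring ^ 'n. P = proj_point (\<chi> i. to_ac (w $ i))) \<longleftrightarrow>
        (\<exists>w. P = proj_point w \<and> (\<forall>i. w $ i ^ ?l = w $ i))" for P
    proof
      assume "\<exists>w :: 'p mod_ring ^ 'n. P = proj_point (\<chi> i. to_ac (w $ i))"
      then obtain w :: "'p mod_ring ^ 'n" where "P = proj_point (\<chi> i. to_ac (w $ i))" by blast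
      then show "\<exists>w. P = proj_point w \<and> (\<forall>i. w $ i ^ ?l = w $ i)"
        by (intro exI[of _ "\<chi> i. to_ac (w $ i)"]) (simp add: fixed_iff_rational)
    next
      assume "\<exists>w. P = proj_point w \<and> (\<forall>i. w $ i ^ ?l = w $ i)"
      then obtain w :: "'p mod_ring alg_closure ^ 'n" where w: "P = proj_point w" "\<forall>i. w $ i \<in> range to_ac"
        unfolding fixed_iff_rational by blast
      have "w = (\<chi> i. to_ac ((\<chi> i. of_ac (w $ i)) $ i))"
        using w(2) by (simp add: vec_eq_iff to_ac_of_ac)
      then show "\<exists>w :: 'p mod_ring ^ 'n. P = proj_point (\<chi> i. to_ac (w $ i))" using w(1) by metis
    qed
    then show ?thesis unfolding rational_points_def by simp
  qed
  then show ?thesis using card_rational_points[OF card(1)] card(2) by simp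
qed

theorem theorem7p1:
  fixes c :: "'p::prime_card mod_ring"
    and E :: "('p mod_ring alg_closure ^ 'n::finite) set set"
  assumes "CARD('p) > 2"
    and "c \<noteq> 0"
    and "\<not> (\<exists>x. x^2 = c)"
    and "smooth_projective_model (affine_quartic c) E"
  shows "1 / (real CARD('p) - 1) * (\<Sum>A\<in>UNIV - {0}. real_of_int (K_sum A (c * A))^2)
           = real_of_int (frobenius_trace E)^2 + 1
       \<and> (\<forall>k::'p mod_ring. k \<noteq> 0 \<longrightarrow>
           1 / (real CARD('p) - 1) * (\<Sum>N\<in>UNIV - {0}. real_of_int (K_sum (k * N) (c * k * N))^2)
           = real_of_int (frobenius_trace E)^2 + 1)"
proof -
  have "int (card (rational_points E)) = int CARD('p) + 1 + cubic_sum c"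
    using card_rational_points_model[OF assms(1,3,4)] card_affine_points[OF assms(1,3)] by simp
  then have trace: "frobenius_trace E = - cubic_sum c"
    unfolding frobenius_trace_def by simp
  have "real_of_int (\<Sum>A\<in>UNIV - {0}. K_sum A (c * A) ^ 2) =
      real_of_int ((int CARD('p) - 1) * (frobenius_trace E ^ 2 + 1))"
    unfolding sum_K_sum_squares[OF assms(1,3)] trace by simp
  then have sum: "(\<Sum>A\<in>UNIV - {0}. real_of_int (K_sum A (c * A)) ^ 2) =
      (real CARD('p) - 1) * (real_of_int (frobenius_trace E) ^ 2 + 1)"
    by simp
  have average: "1 / (real CARD('p) - 1) * (\<Sum>A\<in>UNIV - {0}. real_of_int (K_sum A (c * A)) ^ 2) =
      real_of_int (frobenius_trace E) ^ 2 + 1"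
    unfolding sum using assms(1) by simp
  have "(\<Sum>N\<in>UNIV - {0}. real_of_int (K_sum (k * N) (c * k * N)) ^ 2) =
      (\<Sum>A\<in>UNIV - {0}. real_of_int (K_sum A (c * A)) ^ 2)" if "k \<noteq> 0" for k
    by (rule sum.reindex_bij_witness[of _ "\<lambda>A. A / k" "\<lambda>N. k * N"]) (use that in \<open>auto simp: mult.assoc\<close>)
  then show ?thesis using average by simp
qed

end
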